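(* Let $d\geq 1$ and let $\mathcal{P}$ be a simplex in $\mathbb{R}^{d}$ with vertices $\mathbf{0},\mathbf{m}_{1},\ldots,\mathbf{m}_{d}\in\mathbb{Z}^{d}$, and let $M$ be the nonsingular $d\times d$ integer matrix with columns $\mathbf{m}_{1},\ldots,\mathbf{m}_{d}$, which maps the standard simplex $S_d$ onto $\mathcal{P}$. Let $w\in\mathbb{N}=\{0,1,2,\dots\}$, let $q\in C^{w+1}(\mathbb{R}^{d})$, and for $\tau>0$ let $q_{\tau,M}(x)=q(\tau Mx)$. For every positive integer $\tau$ write $$\sum_{n\in\mathbb{Z}^{d}}\omega_{\tau\mathcal{P}}(n)q(n)=|\det M|\sum_{V\in\{1,2\}^{d}}\ \sum_{I\in\{0,1\}^{d}}\ \sum_{|J|\leqslant w,\ J\sqsubseteq I}\tau^{d-|I|-|J|}\left\langle \mu(V,I,J),q_{\tau,M}\right\rangle \mathfrak{B}_{J+I,(MD_{V})^{t}}(0)+\mathcal{R}_{w}.$$ Then for every $\delta>0$ and every $\tau_{0}>0$ there exists a constant $c$, depending on $\delta$ and $\tau_{0}$ (and the dimension $d$) but independent of $q$, $M$ and $w$, such that for every (positive integer) $\tau>\tau_{0}$ $$\left\vert \mathcal{R}_{w}\right\vert \leqslant c\,|\det M|\,\tau^{d-w-1}(2^{d-2}\pi^{-1}+\delta)^{w+1}\sup_{w-d+2\leqslant|\alpha|\leqslant w+1}\ \sup_{x\in S_{d}}\left\vert \frac{\partial^{\alpha}q_{\tau,M}}{\partial x^{\alpha}}(x)\right\vert ,$$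 where $\alpha$ ranges over multi-indices of non-negative integers.
   Context: Standard simplex: $S_d=\{x\in\mathbb{R}^d: x_j\ge 0,\ \sum_{j=1}^d x_j\le 1\}$. For a multi-index, $|J|=j_1+\dots+j_d$. For $I\in\{0,1\}^d$ and a multi-index $J$ of non-negative integers, $J\sqsubseteq I$ means $j_k=0$ whenever $i_k=0$. $L^t$ is the transpose and $\mathbf 1_m=(1,\dots,1)\in\mathbb{R}^m$. Solid angle: $\omega_{A}(x)=\lim_{\varepsilon\to0+}\frac{1}{|\{|y|\le1\}|}\int_{|y|\le1}\chi_{A}(x-\varepsilon y)\,dy$ (the limit exists for every $x$ when $A$ is a convex polytope). Bernoulli polynomials: $\{B_n\}_{n\in\mathbb{N}}$ are the $1$-periodic functions on $\mathbb{R}$ defined on $(0,1)$ by $B_0=1$, $B_{n+1}'=B_n$, $\int_0^1B_{n+1}=0$, with value at integers $B_n(x)=\lim_{\varepsilon\to0+}\frac{B_n(x+\varepsilon)+B_n(x-\varepsilon)}2$. For a multi-index $J=(j_1,\dots,j_d)$ of non-negative integers, $B_J(x)=B_{j_1}(x_1)\cdots B_{j_d}(x_d)$ if $0\le x_k<1$ for all $k$, and $B_J(x)=0$ otherwise. For a nonsingular integer matrix $L$, $B_{J,L}(x)=|\det L|^{-1}B_J((L^{-1})^tx)$ and $\mathfrak{B}_{J,L}(x)=\sum_{n\in\mathbb{Z}^d}B_{J,L}(x+n)$, where at points of discontinuity $\mathfrak B_{J,L}$ is regularized so that $\mathfrak{B}_{J,L}(x)=\lim_{\varepsilon\to0+}\frac1{|\{|y|\le1\}|}\int_{|y|\le1}\mathfrak{B}_{J,L}(x-\varepsilon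 y)\,dy$. Bases: for each $d\ge1$, $\mathcal{F}^{(d)}$ is a collection of $2^{d-1}$ ordered bases of $\mathbb{R}^d$ indexed by $(v_2,\dots,v_d)\in\{1,2\}^{d-1}$, defined recursively. For $d=1$ the only basis is $\{1\}$. For $d\ge2$, let $\{b_1',\dots,b_{d-1}'\}\in\mathcal F^{(d-1)}$ be the basis with index $(v_2,\dots,v_{d-1})$; the basis $\{b_1,\dots,b_d\}$ with index $(v_2,\dots,v_d)$ has $b_d=(0,\dots,0,1)$ and, for $1\le k\le d-1$, $b_k=(b_k',0)$ if $v_d=1$, $b_k=(b_k',-b_k'\cdot\mathbf 1_{d-1})$ if $v_d=2$. For $V=(v_1,\dots,v_d)\in\{1,2\}^d$, $\mathcal B_V$ is the basis with index $(v_2,\dots,v_d)$, and $D_V=[b_1|\cdots|b_d]$ is the matrix whose columns are the vectors of $\mathcal B_V$. Functionals $\mu(V,I,J)$ (for $V\in\{1,2\}^d$, $I\in\{0,1\}^d$, $J\sqsubseteq I$): $\mu(V,I,J)=T_1^{v_1,i_1,j_1}T_2^{v_2,i_2,j_2}\cdots T_d^{v_d,i_d,j_d}$ (composition, $T_d$ applied first), where $T_h^{v,i,j}$ maps (sufficiently smooth) functions on $\mathbb{R}^h$ to functions on $\mathbb{R}^{h-1}$ (to numbers if $h=1$). For $h=1$: $T_1^{1,0,0}g=\int_0^1g(x_1)dx_1$, $T_1^{2,0,0}g=0$, $T_1^{1,1,j}g=-g^{(j)}(0)$, $T_1^{2,1,j}g=g^{(j)}(1)$. For $h\ge2$ and $x'\in\mathbb{R}^{h-1}$: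 $T_h^{1,0,0}g(x')=\int_0^{1-x'\cdot\mathbf 1_{h-1}}g(x',x_h)dx_h$, $T_h^{2,0,0}g(x')=0$, $T_h^{1,1,j}g(x')=-\frac{\partial^jg}{\partial x_h^j}(x',0)$, $T_h^{2,1,j}g(x')=\frac{\partial^jg}{\partial x_h^j}(x',1-x'\cdot\mathbf 1_{h-1})$. $\langle\mu(V,I,J),g\rangle$ is the resulting number. *)

theory Defs
  imports "HOL-Analysis.Analysis" "HOL-Computational_Algebra.Polynomial"
begin

text \<open>
  Points of $d$-dimensional space are vectors of type \<^typ>\<open>real^'n\<close> with \<open>d = CARD('n)\<close>. The linear
  order of the index type fixes which coordinate is the first, the second, and so on. Multi-indices
  are functions \<^typ>\<open>'n \<Rightarrow> nat\<close>. The constructions that recurse on the dimension use lists of reals of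
  length \<open>h\<close> as points of $h$-dimensional space.
\<close>

definition list_to_vec :: "real list \<Rightarrow> real^'n::{finite,wellorder}" where
  "list_to_vec xs = (\<chi> i. xs ! card {j. j < i})"

definition int_lattice :: "(real^'n) set" where
  "int_lattice = {n. \<forall>i. n $ i \<in> \<int>}"

definition std_simplex :: "(real^'n) set" where
  "std_simplex = {x. (\<forall>i. 0 \<le> x $ i) \<and> (\<Sum>i\<in>UNIV. x $ i) \<le> 1}"

definition simplex_of :: "real^'n^'n \<Rightarrow> (real^'n) set" where
  "simplex_of M = convex hull (insert 0 (range (\<lambda>k. column k M)))"

definition regularize :: "(real^'n \<Rightarrow> real) \<Rightarrow> real^'n \<Rightarrow> real" where
  "regularize F x = Lim (at_right 0) (\<lambda>\<epsilon>.
     (LINT y:cball 0 1|lborel. F (x - \<epsilon> *\<^sub>R y)) / measure lborel (cball (0::real^'n) 1))"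

definition solid_angle :: "(real^'n) set \<Rightarrow> real^'n \<Rightarrow> real" where
  "solid_angle A = regularize (indicator A)"

definition partial_deriv :: "'n::finite \<Rightarrow> (real^'n \<Rightarrow> real) \<Rightarrow> real^'n \<Rightarrow> real" where
  "partial_deriv i f x = deriv (\<lambda>t. f (x + t *\<^sub>R axis i 1)) 0"

definition multi_deriv :: "('n::{finite,wellorder} \<Rightarrow> nat) \<Rightarrow> (real^'n::_ \<Rightarrow> real) \<Rightarrow> real^'n::_ \<Rightarrow> real" where
  "multi_deriv \<alpha> f = foldr (\<lambda>i. partial_deriv i ^^ \<alpha> i) (sorted_list_of_set UNIV) f"

primrec C_class :: "nat \<Rightarrow> (real^'n \<Rightarrow> real) \<Rightarrow> bool" where
  "C_class 0 f \<longleftrightarrow> continuous_on UNIV f"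
| "C_class (Suc k) f \<longleftrightarrow> continuous_on UNIV f \<and>
     (\<forall>i. (\<forall>x. (\<lambda>t. f (x + t *\<^sub>R axis i 1)) differentiable at 0) \<and> C_class k (partial_deriv i f))"

text \<open>
  The polynomial that the $n$-th periodic Bernoulli function equals on the open unit interval. With
  this normalization it is the classical Bernoulli polynomial divided by $n!$.
\<close>

primrec bern_poly :: "nat \<Rightarrow> real poly" where
  "bern_poly 0 = 1"
| "bern_poly (Suc n) = (THE p. pderiv p = bern_poly n \<and> integral {0..1} (poly p) = 0)"

lemma ex1_antiderivative_integral_0:
  "\<exists>!p. pderiv p = (q :: real poly) \<and> integral {0..1} (poly p) = 0"
proof -
  define r where "r = (\<Sum>i\<le>degree q. monom (coeff q i / real (Suc i)) (Suc i))"
  have "pderiv r = (\<Sum>i\<le>degree q. monom (coeff q i) i)"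
    unfolding r_def by (simp add: higher_pderiv_sum[where n = 1, simplified] pderiv_monom del: of_nat_Suc)
  then have r: "pderiv r = q"
    by (simp add: poly_as_sum_of_monoms)
  have int_poly: "poly p integrable_on {0..1}" for p :: "real poly"
    by (intro integrable_continuous_interval continuous_intros)
  have int_add: "integral {0..1} (poly (p + [:c:])) = integral {0..1} (poly p) + c"
    for p :: "real poly" and c
  proof -
    have "poly (p + [:c:]) = (\<lambda>x. poly p x + c)"
      by auto
    then show ?thesis
      using integral_add[OF int_poly[of p], of "\<lambda>_. c"] by (simp add: integrable_const_ivl)
  qed
  show ?thesis
  proof (rule ex1I)
    show "pderiv (r + [:- integral {0..1} (poly r):]) = q
      \<and> integral {0..1} (poly (r + [:- integral {0..1} (poly r):])) = 0"
      using r int_add by (simp add: pderiv_add pderiv_pCons)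
  next
    fix p assume p: "pderiv p = q \<and> integral {0..1} (poly p) = 0"
    then have "pderiv (p - r) = 0"
      using r by (simp add: pderiv_diff)
    then obtain c where c: "p - r = [:c:]"
      by (metis pderiv_iszero)
    then have "p = r + [:c:]"
      by (metis add.commute diff_add_cancel)
    then show "p = r + [:- integral {0..1} (poly r):]"
      using p int_add[of r c] by (simp add: add_eq_0_iff)
  qed
qed

lemma
  shows pderiv_bern_poly_Suc: "pderiv (bern_poly (Suc n)) = bern_poly n"
    and integral_bern_poly_Suc: "integral {0..1} (poly (bern_poly (Suc n))) = 0"
  using theI'[OF ex1_antiderivative_integral_0[of "bern_poly n"]] by simp_all

definition bern :: "nat \<Rightarrow> real \<Rightarrow> real" where
  "bern n x =
     (let f = (\<lambda>y. poly (bern_poly n) (frac y))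
      in if x \<in> \<int> then Lim (at_right 0) (\<lambda>\<epsilon>. (f (x + \<epsilon>) + f (x - \<epsilon>)) / 2) else f x)"

definition bern_multi :: "('n::finite \<Rightarrow> nat) \<Rightarrow> real^'n \<Rightarrow> real" where
  "bern_multi J x =
     (if \<forall>k. 0 \<le> x $ k \<and> x $ k < 1 then \<Prod>k\<in>UNIV. bern (J k) (x $ k) else 0)"

definition bern_mat :: "('n::finite \<Rightarrow> nat) \<Rightarrow> real^'n^'n \<Rightarrow> real^'n \<Rightarrow> real" where
  "bern_mat J L x = bern_multi J (transpose (matrix_inv L) *v x) / \<bar>det L\<bar>"

definition bern_periodized :: "('n::finite \<Rightarrow> nat) \<Rightarrow> real^'n^'n \<Rightarrow> real^'n \<Rightarrow> real" where
  "bern_periodized J L = regularize (\<lambda>x. \<Sum>\<^sub>\<infinity>n\<in>int_lattice. bern_mat J L (x + n))"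

text \<open>
  One step of the recursion passes from a basis of dimension \<open>h\<close> to one of dimension \<open>h + 1\<close>. The
  step from the empty basis gives the basis \<open>[[1]]\<close> whatever \<open>v\<close> is, so the first entry of the
  index is irrelevant, as it should be.
\<close>

definition extend_basis :: "nat \<Rightarrow> real list list \<Rightarrow> real list list" where
  "extend_basis v bs =
     map (\<lambda>b. b @ [if v = 1 then 0 else - sum_list b]) bs @ [replicate (length bs) 0 @ [1]]"

definition basis_of :: "('n::{finite,wellorder} \<Rightarrow> nat) \<Rightarrow> real list list" where
  "basis_of V = fold extend_basis (map V (sorted_list_of_set UNIV)) []"

definition D_mat :: "('n::{finite,wellorder} \<Rightarrow> nat) \<Rightarrow> real^'n::_^'n::_" where
  "D_mat V = (\<chi> i k. (list_to_vec (basis_of V ! card {j. j < k}) :: real^'n::_) $ i)"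

text \<open>
  A function of \<open>h\<close> variables is sent to a function of \<open>h - 1\<close> variables, and for \<open>h = 1\<close> to a
  function whose only relevant argument is \<open>[]\<close>. The integral has to be the oriented one: the
  upper limit is negative outside the standard simplex, and the results are later differentiated
  at points where it vanishes.
\<close>

definition T_op :: "nat \<Rightarrow> nat \<Rightarrow> nat \<Rightarrow> (real list \<Rightarrow> real) \<Rightarrow> real list \<Rightarrow> real" where
  "T_op v i j g xs =
     (if i = 0 then
        (if v = 1 then LBINT t=ereal 0..ereal (1 - sum_list xs). g (xs @ [t]) else 0)
      else
        (if v = 1 then - (deriv ^^ j) (\<lambda>t. g (xs @ [t])) 0
         else (deriv ^^ j) (\<lambda>t. g (xs @ [t])) (1 - sum_list xs)))"

definition mu :: "('n::{finite,wellorder} \<Rightarrow> nat) \<Rightarrow> ('n \<Rightarrow> nat) \<Rightarrow> ('n \<Rightarrow> nat) \<Rightarrow> (real^'n::_ \<Rightarrow> real) \<Rightarrow> real" where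
  "mu V I J g =
     foldr (\<lambda>k. T_op (V k) (I k) (J k)) (sorted_list_of_set UNIV) (\<lambda>xs. g (list_to_vec xs)) []"

definition dilated :: "(real^'n \<Rightarrow> real) \<Rightarrow> real \<Rightarrow> real^'n^'n \<Rightarrow> real^'n \<Rightarrow> real" where
  "dilated q \<tau> M x = q (\<tau> *\<^sub>R (M *v x))"

definition lattice_sum :: "real^'n^'n \<Rightarrow> (real^'n \<Rightarrow> real) \<Rightarrow> real \<Rightarrow> real" where
  "lattice_sum M q \<tau> = (\<Sum>\<^sub>\<infinity>n\<in>int_lattice. solid_angle ((*\<^sub>R) \<tau> ` simplex_of M) n * q n)"

definition main_term :: "real^'n::{finite,wellorder}^'n::_ \<Rightarrow> (real^'n::_ \<Rightarrow> real) \<Rightarrow> nat \<Rightarrow> real \<Rightarrow> real" where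
  "main_term M q w \<tau> = \<bar>det M\<bar> *
     (\<Sum>V\<in>{V. \<forall>k. V k \<in> {1, 2}}. \<Sum>I\<in>{I. \<forall>k. I k \<in> {0, 1}}.
      \<Sum>J\<in>{J. sum J UNIV \<le> w \<and> (\<forall>k. I k = 0 \<longrightarrow> J k = 0)}.
        \<tau> powi (int CARD('n) - int (sum I UNIV) - int (sum J UNIV)) * mu V I J (dilated q \<tau> M)
        * bern_periodized (\<lambda>k. J k + I k) (transpose (M ** D_mat V)) 0)"

definition remainder :: "real^'n::{finite,wellorder}^'n::_ \<Rightarrow> (real^'n::_ \<Rightarrow> real) \<Rightarrow> nat \<Rightarrow> real \<Rightarrow> real" where
  "remainder M q w \<tau> = lattice_sum M q \<tau> - main_term M q w \<tau>"

end

theory Submission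
  imports Defs "HOL-Complex_Analysis.Cauchy_Integral_Formula"
begin

text \<open>
  Both solid angles and regularized Bernoulli functions are averages, over the directions \<open>y\<close> of the
  unit ball, of one-sided limits at \<open>z = - \<epsilon> y\<close> for \<open>\<epsilon> \<rightarrow> 0+\<close>. Hence it suffices to expand the lattice
  sum over the translate \<open>\<int>\<^sup>d + z\<close> for almost all small \<open>z\<close>, where no summation point meets a
  discontinuity. Pulled back by \<open>M\<close>, this sum splits into at most \<open>\<bar>det M\<bar>\<close> sums over shifts of
  \<open>\<int>\<^sup>d / \<tau>\<close> in the standard simplex, one for each coset of \<open>\<int>\<^sup>d\<close> in \<open>M\<^sup>-\<^sup>1 \<int>\<^sup>d\<close>.

  Each of them is expanded by summing over one coordinate at a time, the last one first, with the
  one-dimensional Euler-Maclaurin formula; this produces the operators \<open>T\<close>. Every substitution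
  \<open>x\<^sub>h = 1 - (x\<^sub>1 + \<dots> + x\<^bsub>h-1\<^esub>)\<close> doubles the cost of a later derivative, so after \<open>d - 1\<close> substitutions
  the decay rate \<open>1 / (2\<pi>)\<close> of the Bernoulli functions has become \<open>2\<^bsup>d-2\<^esup> / \<pi>\<close>, while every integration
  with a variable upper limit may lower the order of a derivative by one. The number of terms is
  polynomial in \<open>w\<close> and is absorbed by \<open>\<delta>\<close>.
\<close>

section \<open>Bernoulli polynomials\<close>

text \<open>At the unshifted lattice the weights are fractional and the Bernoulli functions are
  averaged, so the comparison is made along rays. For a direction \<open>y\<close> off finitely many
  hyperplanes all arguments at \<open>- \<epsilon> y\<close> are nonintegral once
  \<open>\<epsilon>\<close> is small: the weights are 0 or 1 and the Bernoulli values are polynomial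
  values. The error bound obtained there is the same for all such \<open>\<epsilon>\<close> and
  \<open>y\<close>, hence survives the limit and the average; passing from \<open>q\<close> at
  shifted points back to \<open>q\<close> at lattice points costs nothing in the limit, since
  \<open>q\<close> is continuous. The bases enter through their inverses. Each summation ends at a
  sloping facet, where the Bernoulli argument is a partial sum of coordinates; the matrix that
  replaces chosen coordinates by partial sums is the inverse of \<open>D_mat V\<close>. The
  induction on the dimension \<open>h\<close> carries bounds for a whole window of derivative
  orders, \<open>m + 2 - h\<close> to \<open>m + 1\<close>. It is empty for \<open>h = 0\<close>, a
  single order for \<open>h = 1\<close>, and for \<open>h = d\<close>, \<open>m = w\<close> it is
  the range of \<open>\<alpha>\<close> in the claim.\<close>

definition bern_gen :: "real fps" where
  "bern_gen = inverse (Abs_fps (\<lambda>n. 1 / fact (Suc n)))"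

lemma exp_minus_1_fps:
  "Abs_fps (\<lambda>n. 1 / fact (Suc n)) = fps_shift 1 (fps_exp 1 - 1 :: 'a::{field_char_0} fps)"
  by (rule fps_ext) (simp add: algebra_simps)

text \<open>The generating function \<open>t / (e\<^bsup>t\<^esup> - 1)\<close> has no singularity in the disc of radius \<open>2\<pi>\<close>.\<close>

lemma bern_gen_bound:
  assumes r: "r > 1 / (2 * pi)"
  shows "\<exists>C>0. \<forall>k. \<bar>fps_nth bern_gen k\<bar> \<le> C * r ^ k"
proof -
  \<comment> \<open>The lower bound for the radius of convergence of an inverse series asks for the
    absence of complex zeros, so the coefficients are transported to the complex numbers.\<close>
  define G :: "complex fps" where "G = Abs_fps (\<lambda>n. 1 / fact (Suc n))"
  define b :: "complex fps" where "b = Abs_fps (\<lambda>n. of_real (fps_nth bern_gen n))"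
  have r0: "r > 0"
    by (rule less_trans[OF _ r]) simp
  have G0: "fps_conv_radius G = \<infinity>"
  proof -
    have "fps_conv_radius (fps_exp 1 - 1 :: complex fps) \<ge> \<infinity>"
      by (rule order_trans[OF _ fps_conv_radius_diff]) simp
    then show ?thesis
      unfolding G_def exp_minus_1_fps by (simp only: fps_conv_radius_shift) simp
  qed
  have ne: "eval_fps G z \<noteq> 0" if z: "ereal (norm z) < ereal (2 * pi)" for z
  proof -
    have "eval_fps G z = (if z = 0 then 1 else (exp z - 1) / z)"
      unfolding G_def exp_minus_1_fps
    proof (subst eval_fps_shift)
      show "1 \<le> subdegree (fps_exp 1 - 1 :: complex fps)"
        by (rule subdegree_geI) (auto simp: fps_eq_iff intro!: exI[of _ "1::nat"])
      have "fps_conv_radius (fps_exp 1 - 1 :: complex fps) \<ge> \<infinity>"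
        by (rule order_trans[OF _ fps_conv_radius_diff]) simp
      then show "ereal (norm z) < fps_conv_radius (fps_exp 1 - 1 :: complex fps)"
        by simp
    qed (simp_all add: eval_fps_diff)
    moreover have "exp z \<noteq> 1" if "z \<noteq> 0"
    proof
      assume "exp z = 1"
      then obtain n where n: "Re z = 0" "Im z = of_int (2 * n) * pi"
        by (auto simp: exp_eq_1)
      then have "n \<noteq> 0"
        using that by (auto simp: complex_eq_iff)
      then have "2 * pi \<le> \<bar>of_int (2 * n) * pi\<bar>"
        by (simp add: abs_mult)
      also have "\<dots> \<le> norm z"
        using abs_Im_le_cmod[of z] n by simp
      finally show False
        using z by simp
    qed
    ultimately show ?thesis
      by simp
  qed
  have "bern_gen * Abs_fps (\<lambda>n. 1 / fact (Suc n)) = 1"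
    unfolding bern_gen_def by (rule inverse_mult_eq_1) simp
  then have prod: "(\<Sum>i=0..n. fps_nth bern_gen i * (1 / fact (Suc (n - i)))) = (if n = 0 then 1 else 0)" for n
    by (simp add: fps_eq_iff fps_mult_nth)
  have "b * G = 1"
  proof (rule fps_ext)
    fix n
    have "fps_nth (b * G) n = of_real (\<Sum>i=0..n. fps_nth bern_gen i * (1 / fact (Suc (n - i))))"
      unfolding b_def G_def by (simp add: fps_mult_nth del: fact_Suc)
    then show "fps_nth (b * G) n = fps_nth 1 n"
      unfolding prod by simp
  qed
  then have "inverse G = b"
    by (metis fps_inverse_unique mult.commute)
  then have cr: "fps_conv_radius b \<ge> 2 * pi"
    using fps_conv_radius_inverse[of "ereal (2 * pi)" G] ne G0 by simp
  have "1 / r < 2 * pi"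
    using r r0 by (simp add: field_simps)
  then have "ereal (norm (complex_of_real (1 / r))) < conv_radius (fps_nth b)"
    using cr r0 unfolding fps_conv_radius_def by (simp add: norm_divide less_le_trans[of _ "ereal (2 * pi)"])
  \<comment> \<open>Convergence at the point \<open>1 / r\<close> bounds the individual terms there,
    which is a bound of order \<open>r ^ k\<close> for the coefficients.\<close>
  from abs_summable_in_conv_radius[OF this] obtain C where C: "C > 0" "\<And>k. norm (fps_nth b k * (of_real (1 / r))^k) \<le> C"
    by (auto dest!: summable_imp_Bseq elim!: BseqE)
  have "\<bar>fps_nth bern_gen k\<bar> \<le> C * r ^ k" for k
    using C(2)[of k] r0 by (simp add: b_def norm_mult norm_power norm_divide field_simps)
  then show ?thesis
    using C(1) by blast
qed

lemma integral_poly_pderiv: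
  "integral {0..1} (poly (pderiv p)) = poly p 1 - poly p (0::real)"
proof -
  have "(poly (pderiv p) has_integral poly p 1 - poly p 0) {0..1}"
    by (rule fundamental_theorem_of_calculus)
      (auto intro!: DERIV_subset[OF poly_DERIV] simp: has_real_derivative_iff_has_vector_derivative[symmetric])
  then show ?thesis
    by (rule integral_unique)
qed

text \<open>Coefficient form of the generating function t e^(x t) / (e^t - 1). The right-hand side
  satisfies the defining recursion: differentiation shifts the index, and the mean over the unit
  interval is a coefficient of the product of \<open>bern_gen\<close> with its reciprocal, which is
  1.\<close>

lemma bern_poly_eq:
  "bern_poly n = (\<Sum>i\<le>n. monom (fps_nth bern_gen (n - i) / fact i) i)"
proof -
  define q where "q n = (\<Sum>i\<le>n. monom (fps_nth bern_gen (n - i) / fact i) i)" for n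
  have prod: "bern_gen * Abs_fps (\<lambda>n. 1 / fact (Suc n)) = 1"
    unfolding bern_gen_def by (rule inverse_mult_eq_1) simp
  have dq: "pderiv (q (Suc n)) = q n" for n
    unfolding q_def
    by (simp add: sum.atMost_Suc_shift higher_pderiv_sum[where n = 1, simplified] pderiv_monom pderiv_add
        field_simps del: of_nat_Suc sum.atMost_Suc)
  have iq: "integral {0..1} (poly (q (Suc n))) = 0" for n
  proof -
    \<comment> \<open>\<open>q (Suc (Suc n))\<close> is a primitive; its constant term cancels in
      the increment, and what is left is the coefficient \<open>Suc n\<close> of a Cauchy product,
      hence 0.\<close>
    have "integral {0..1} (poly (q (Suc n))) = poly (q (Suc (Suc n))) 1 - poly (q (Suc (Suc n))) 0"
      by (simp only: dq[symmetric, of "Suc n"] integral_poly_pderiv)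
    also have "\<dots> = (\<Sum>i\<le>Suc n. fps_nth bern_gen (Suc n - i) / fact (Suc i))"
      unfolding q_def
      by (simp only: sum.atMost_Suc_shift[of _ "Suc n"]) (simp add: poly_sum poly_monom)
    also have "\<dots> = (\<Sum>i\<le>Suc n. fps_nth bern_gen i / fact (Suc (Suc n - i)))"
      by (subst sum.nat_diff_reindex[symmetric, of _ "Suc (Suc n)", unfolded lessThan_Suc_atMost])
        (rule sum.cong; simp)
    also have "\<dots> = fps_nth (bern_gen * Abs_fps (\<lambda>n. 1 / fact (Suc n))) (Suc n)"
      unfolding fps_mult_nth by (simp add: atLeast0AtMost del: fact_Suc)
    finally show ?thesis
      by (simp only: prod) simp
  qed
  have "bern_poly n = q n"
  proof (induction n)
    case 0
    then show ?case
      by (simp add: q_def bern_gen_def monom_0 one_pCons)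
  next
    case (Suc n)
    then have "pderiv (q (Suc n)) = bern_poly n \<and> integral {0..1} (poly (q (Suc n))) = 0"
      using dq iq by simp
    then show ?case
      using ex1_antiderivative_integral_0[of "bern_poly n"] pderiv_bern_poly_Suc integral_bern_poly_Suc
      by blast
  qed
  then show ?thesis
    by (simp add: q_def)
qed

text \<open>The geometric bound for the coefficients turns the sum over \<open>i\<close> into
  \<open>r ^ n\<close> times a partial sum of the series of \<open>exp (1 / r)\<close>. The constant
  is raised to at least 1 so that its powers can later be compared with 1.\<close>

lemma bern_poly_bound:
  assumes r: "r > 1 / (2 * pi)"
  shows "\<exists>C\<ge>1. \<forall>n. \<forall>x\<in>{0..1}. \<bar>poly (bern_poly n) x\<bar> \<le> C * r ^ n"
proof -
  obtain C where C: "C > 0" "\<And>k. \<bar>fps_nth bern_gen k\<bar> \<le> C * r ^ k"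
    using bern_gen_bound[OF r] by blast
  have r0: "r > 0"
    by (rule less_trans[OF _ r]) simp
  have "\<bar>poly (bern_poly n) x\<bar> \<le> max 1 (C * exp (1 / r)) * r ^ n" if x: "x \<in> {0..1}" for n x
  proof -
    have "\<bar>poly (bern_poly n) x\<bar> \<le> (\<Sum>i\<le>n. \<bar>fps_nth bern_gen (n - i) / fact i * x ^ i\<bar>)"
      using sum_abs[of "\<lambda>i. fps_nth bern_gen (n - i) / fact i * x ^ i" "{..n}"]
      by (simp add: bern_poly_eq poly_sum poly_monom)
    also have "\<dots> \<le> (\<Sum>i\<le>n. C * r ^ n * ((1 / r) ^ i / fact i))"
    proof (rule sum_mono)
      fix i assume i: "i \<in> {..n}"
      have "\<bar>fps_nth bern_gen (n - i) / fact i * x ^ i\<bar> \<le> (C * r ^ (n - i)) / fact i * 1"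
        unfolding abs_mult abs_divide
        by (intro mult_mono divide_mono C) (use x C r0 in \<open>auto simp: power_le_one abs_le_iff\<close>)
      also have "\<dots> = C * r ^ n * ((1 / r) ^ i / fact i)"
        using i r0 by (simp add: power_diff field_simps)
      finally show "\<bar>fps_nth bern_gen (n - i) / fact i * x ^ i\<bar> \<le> C * r ^ n * ((1 / r) ^ i / fact i)" .
    qed
    also have "\<dots> = C * r ^ n * (\<Sum>i\<le>n. (1 / r) ^ i / fact i)"
      by (simp add: sum_distrib_left)
    also have "\<dots> \<le> C * r ^ n * exp (1 / r)"
    proof (intro mult_left_mono)
      have "(\<Sum>i\<le>n. inverse (fact i) * (1 / r) ^ i) \<le> exp (1 / r)"
        unfolding exp_def real_scaleR_def
        using summable_exp[of "1 / r"] r0 by (intro sum_le_suminf) auto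
      then show "(\<Sum>i\<le>n. (1 / r) ^ i / fact i) \<le> exp (1 / r)"
        by (simp add: field_simps)
    qed (use C r0 in auto)
    also have "\<dots> \<le> max 1 (C * exp (1 / r)) * r ^ n"
      using r0 by (simp add: mult_right_mono field_simps)
    finally show ?thesis .
  qed
  then show ?thesis
    by (intro exI[of _ "max 1 (C * exp (1 / r))"]) auto
qed

section \<open>Periodic Bernoulli functions\<close>

definition bern_per :: "nat \<Rightarrow> real \<Rightarrow> real" where
  "bern_per n x = poly (bern_poly n) (frac x)"

text \<open>At integers \<open>bern_per\<close> takes the limit from the right, while
  \<open>bern\<close> averages both sides. The expansion is written with \<open>bern_per\<close>,
  and generic shifts keep its coefficients away from integers.\<close>

lemma bern_nonint: "x \<notin> \<int> \<Longrightarrow> bern n x = bern_per n x"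
  by (simp add: bern_def bern_per_def)

lemma bern_int_shift: "m \<in> \<int> \<Longrightarrow> bern n (x + m) = bern n x"
proof -
  assume m: "m \<in> \<int>"
  then have "frac (x + m + y) = frac (x + y)" "frac (x + m - y) = frac (x - y)" "frac (x + m) = frac x"
    "x + m \<in> \<int> \<longleftrightarrow> x \<in> \<int>" for y
    using frac_add_int_right[OF m, of "x + y"] frac_add_int_right[OF m, of "x - y"] frac_add_int_right[OF m, of x]
    by (auto simp: algebra_simps)
  then show ?thesis
    unfolding bern_def by simp
qed

lemma bern_int: "x \<in> \<int> \<Longrightarrow> bern n x = bern n 0"
  using bern_int_shift[of x n 0] by simp

lemma bern_frac: "bern n (frac x) = bern n x"
  using bern_int_shift[of "of_int \<lfloor>x\<rfloor>" n "frac x"] by (simp add: frac_def)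

lemma bern_bounded: "\<exists>C. \<forall>x. \<bar>bern n x\<bar> \<le> C"
proof -
  obtain C where C: "\<And>x. x \<in> {0..1} \<Longrightarrow> \<bar>poly (bern_poly n) x\<bar> \<le> C"
  proof -
    have "1 > 1 / (2 * pi)"
      using pi_gt3 by simp
    then obtain C where "\<forall>n. \<forall>x\<in>{0..1}. \<bar>poly (bern_poly n) x\<bar> \<le> C * 1 ^ n"
      using bern_poly_bound by blast
    then show ?thesis
      by (intro that[of C]) (simp del: bern_poly.simps)
  qed
  have "\<bar>bern n x\<bar> \<le> max C \<bar>bern n 0\<bar>" for x
    using C[of "frac x"] frac_lt_1[of x] frac_ge_0[of x]
    by (cases "x \<in> \<int>")
      (use bern_int[of x n] in \<open>auto simp: bern_nonint bern_per_def le_max_iff_disj simp del: bern_poly.simps\<close>)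
  then show ?thesis
    by blast
qed

lemma borel_measurable_bern [measurable]: "bern n \<in> borel_measurable borel"
proof -
  have "bern_per n \<in> borel_measurable borel"
    unfolding bern_per_def frac_def by (intro borel_measurable_continuous_on[of "poly (bern_poly n)"]) 
      (auto intro!: continuous_intros)
  then show ?thesis
    by (rule measurable_discrete_difference[where X = "\<int>"])
      (auto simp: bern_nonint countable_int)
qed

lemma bern_eq_on_unit_interval:
  assumes "of_int k < x" "x < of_int k + 1"
  shows "x \<notin> \<int>" "bern_per n x = poly (bern_poly n) (x - of_int k)"
proof -
  have "\<lfloor>x\<rfloor> = k"
    using assms by linarith
  then show "bern_per n x = poly (bern_poly n) (x - of_int k)" "x \<notin> \<int>"
    using assms by (auto simp: bern_per_def frac_def elim!: Ints_cases)
qed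

text \<open>A moving point leaves \<open>a\<close> at once, enters one open unit interval and stays
  there for a while; for integral \<open>a\<close> the sign of \<open>b\<close> decides which one.
  This is why the one-sided limits depend on the direction.\<close>

lemma eventually_in_unit_interval:
  fixes a b :: real
  assumes "b \<noteq> 0"
  shows "\<exists>k. \<forall>\<^sub>F \<epsilon> in at_right 0. of_int k < a + \<epsilon> * b \<and> a + \<epsilon> * b < of_int k + 1"
proof -
  have lim: "((\<lambda>\<epsilon>. a + \<epsilon> * b) \<longlongrightarrow> a) (at_right 0)"
    by (auto intro!: tendsto_eq_intros)
  consider "b > 0" | "b < 0"
    using assms by linarith
  then show ?thesis
  proof cases
    case 1
    have "\<forall>\<^sub>F \<epsilon> in at_right 0. a + \<epsilon> * b < of_int \<lfloor>a\<rfloor> + 1"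
      by (rule order_tendstoD(2)[OF lim]) linarith
    then have "\<forall>\<^sub>F \<epsilon> in at_right 0. of_int \<lfloor>a\<rfloor> < a + \<epsilon> * b \<and> a + \<epsilon> * b < of_int \<lfloor>a\<rfloor> + 1"
      using eventually_at_right_less[of 0]
    proof eventually_elim
      case (elim \<epsilon>)
      then have "\<epsilon> * b > 0"
        using 1 by simp
      then show ?case
        using elim(1) of_int_floor_le[of a] by linarith
    qed
    then show ?thesis ..
  next
    case 2
    have "\<forall>\<^sub>F \<epsilon> in at_right 0. a + \<epsilon> * b > of_int (\<lceil>a\<rceil> - 1)"
      by (rule order_tendstoD(1)[OF lim]) linarith
    then have "\<forall>\<^sub>F \<epsilon> in at_right 0. of_int (\<lceil>a\<rceil> - 1) < a + \<epsilon> * b \<and> a + \<epsilon> * b < of_int (\<lceil>a\<rceil> - 1) + 1"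
      using eventually_at_right_less[of 0]
    proof eventually_elim
      case (elim \<epsilon>)
      then have "\<epsilon> * b < 0"
        using 2 by (simp add: mult_pos_neg)
      then show ?case
        using elim(1) le_of_int_ceiling[of a] unfolding of_int_diff of_int_1 by linarith
    qed
    then show ?thesis ..
  qed
qed

lemma eventually_nonint: "b \<noteq> 0 \<Longrightarrow> \<forall>\<^sub>F \<epsilon> in at_right 0. a + \<epsilon> * b \<notin> \<int>" for a b :: real
  using eventually_in_unit_interval[of b a] bern_eq_on_unit_interval(1) by (auto elim: eventually_mono)

lemma bern_directional_limit:
  "\<exists>l. ((\<lambda>\<epsilon>. bern n (a + \<epsilon> * b)) \<longlongrightarrow> l) (at_right 0)"
proof (cases "b = 0")
  case False
  then obtain k where k: "\<forall>\<^sub>F \<epsilon> in at_right 0. of_int k < a + \<epsilon> * b \<and> a + \<epsilon> * b < of_int k + 1"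
    using eventually_in_unit_interval by blast
  have "((\<lambda>\<epsilon>. bern n (a + \<epsilon> * b)) \<longlongrightarrow> poly (bern_poly n) (a + 0 * b - of_int k)) (at_right 0)"
  proof (rule Lim_transform_eventually)
    show "((\<lambda>\<epsilon>. poly (bern_poly n) (a + \<epsilon> * b - of_int k)) \<longlongrightarrow> poly (bern_poly n) (a + 0 * b - of_int k)) (at_right 0)"
      by (intro tendsto_intros)
    show "\<forall>\<^sub>F \<epsilon> in at_right 0. poly (bern_poly n) (a + \<epsilon> * b - of_int k) = bern n (a + \<epsilon> * b)"
      using k by eventually_elim (metis bern_eq_on_unit_interval bern_nonint)
  qed
  then show ?thesis ..
qed auto

text \<open>The vanishing mean of one polynomial is the increment of the next one over the unit
  interval. So the periodic functions of index at least 2 are continuous, and only the sawtooth of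
  index 1 jumps.\<close>

lemma bern_poly_endpoints: "poly (bern_poly (Suc (Suc n))) 1 = poly (bern_poly (Suc (Suc n))) 0"
  using integral_poly_pderiv[of "bern_poly (Suc (Suc n))"]
  by (simp only: pderiv_bern_poly_Suc integral_bern_poly_Suc)

lemma bern_poly_1: "poly (bern_poly (Suc 0)) x = x - 1 / 2"
proof -
  have "pderiv [:- 1 / 2, 1:] = (bern_poly 0 :: real poly)"
    by (simp add: pderiv_pCons one_pCons)
  moreover have "integral {0..1} (poly [:- 1 / 2, 1:]) = (0::real)"
    using integral_poly_pderiv[of "[:0, - 1 / 2, 1 / 2:]"] by (simp add: pderiv_pCons)
  ultimately have "bern_poly (Suc 0) = [:- 1 / 2, 1:]"
    using ex1_antiderivative_integral_0[of "bern_poly 0"] pderiv_bern_poly_Suc[of 0] integral_bern_poly_Suc[of 0]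
    by blast
  then show ?thesis
    by simp
qed

lemma continuous_on_bern_per: "continuous_on UNIV (bern_per (Suc (Suc n)))"
proof -
  let ?P = "poly (bern_poly (Suc (Suc n)))"
  have piece: "continuous_on {of_int k..of_int k + 1} (bern_per (Suc (Suc n)))" for k
  proof (rule continuous_on_eq)
    show "continuous_on {of_int k..of_int k + 1} (\<lambda>x. ?P (x - of_int k))"
      by (intro continuous_intros)
    fix x :: real assume x: "x \<in> {of_int k..of_int k + 1}"
    show "?P (x - of_int k) = bern_per (Suc (Suc n)) x"
    proof (cases "x = of_int k + 1")
      case True
      then have "frac x = 0"
        by simp
      then show ?thesis
        using True by (simp add: bern_per_def bern_poly_endpoints del: bern_poly.simps frac_eq_0_iff)
    next
      case False
      then have "\<lfloor>x\<rfloor> = k"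
        using x by (intro floor_unique) auto
      then show ?thesis
        by (simp add: bern_per_def frac_def)
    qed
  qed
  have "isCont (bern_per (Suc (Suc n))) x" for x
  proof -
    let ?k = "\<lfloor>x\<rfloor>"
    \<comment> \<open>Two neighbouring closed unit intervals cover a neighbourhood of
      \<open>x\<close>, even when \<open>x\<close> is an integer.\<close>
    have "continuous_on ({of_int (?k - 1)..of_int (?k - 1) + 1} \<union> {of_int ?k..of_int ?k + 1}) (bern_per (Suc (Suc n)))"
      by (intro continuous_on_closed_Un piece closed_atLeastAtMost)
    then have "continuous_on {of_int ?k - 1 <..< of_int ?k + 1 :: real} (bern_per (Suc (Suc n)))"
      by (rule continuous_on_subset) auto
    then show ?thesis
      by (rule continuous_on_interior) (auto simp: interior_open, linarith+)
  qed
  then show ?thesis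
    by (simp add: continuous_at_imp_continuous_on)
qed

lemma bern_per_has_derivative:
  assumes "x \<notin> \<int>"
  shows "(bern_per (Suc n) has_real_derivative bern_per n x) (at x)"
proof -
  have x: "of_int \<lfloor>x\<rfloor> < x" "x < of_int \<lfloor>x\<rfloor> + 1"
    using assms by (metis Ints_of_int floor_correct less_le, linarith)
  have "((\<lambda>y. poly (bern_poly (Suc n)) (y - of_int \<lfloor>x\<rfloor>)) has_real_derivative
      poly (bern_poly n) (x - of_int \<lfloor>x\<rfloor>) * (1 - 0)) (at x)"
    by (rule DERIV_chain2[OF poly_DERIV[of "bern_poly (Suc n)", unfolded pderiv_bern_poly_Suc]])
      (auto intro!: derivative_eq_intros)
  then have "((\<lambda>y. poly (bern_poly (Suc n)) (y - of_int \<lfloor>x\<rfloor>)) has_real_derivative bern_per n x) (at x)"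
    by (simp add: bern_per_def frac_def)
  then show ?thesis
    by (rule has_field_derivative_transform_within_open[where S = "{of_int \<lfloor>x\<rfloor> <..< of_int \<lfloor>x\<rfloor> + 1}"])
      (use x in \<open>auto simp: bern_eq_on_unit_interval simp del: bern_poly.simps\<close>)
qed

lemma bern_per_bound:
  assumes r: "r > 1 / (2 * pi)"
  shows "\<exists>C\<ge>1. \<forall>n x. \<bar>bern_per n x\<bar> \<le> C * r ^ n"
  using bern_poly_bound[OF r] unfolding bern_per_def
  by (meson atLeastAtMost_iff frac_ge_0 frac_lt_1 less_imp_le)

lemma bern_per_1: "bern_per (Suc 0) x = frac x - 1 / 2"
  by (simp add: bern_per_def bern_poly_1 del: bern_poly.simps)

section \<open>Euler-Maclaurin summation on an interval\<close>

definition grid :: "real \<Rightarrow> real \<Rightarrow> real \<Rightarrow> real set" where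
  "grid \<tau> \<xi> t = {s. \<tau> * s - \<xi> \<in> \<int> \<and> 0 \<le> s \<and> s \<le> t}"

lemma grid_eq_image:
  fixes \<tau> \<xi> t :: real
  assumes "\<tau> > 0"
  shows "grid \<tau> \<xi> t = (\<lambda>n. (\<xi> + of_int n) / \<tau>) ` {\<lceil>- \<xi>\<rceil>..\<lfloor>\<tau> * t - \<xi>\<rfloor>}"
proof (intro equalityI subsetI)
  fix s assume "s \<in> grid \<tau> \<xi> t"
  then obtain n :: int where n: "\<tau> * s - \<xi> = of_int n" and s: "0 \<le> s" "s \<le> t"
    by (auto simp: grid_def elim: Ints_cases)
  have "s = (\<xi> + of_int n) / \<tau>"
    using n assms by (simp add: field_simps)
  moreover have "0 \<le> \<tau> * s" "\<tau> * s \<le> \<tau> * t"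
    using s assms by simp_all
  then have "n \<in> {\<lceil>- \<xi>\<rceil>..\<lfloor>\<tau> * t - \<xi>\<rfloor>}"
    using n by (auto simp: ceiling_le_iff le_floor_iff)
  ultimately show "s \<in> (\<lambda>n. (\<xi> + of_int n) / \<tau>) ` {\<lceil>- \<xi>\<rceil>..\<lfloor>\<tau> * t - \<xi>\<rfloor>}"
    by blast
qed (use assms in \<open>auto simp: grid_def ceiling_le_iff le_floor_iff field_simps\<close>)

lemma finite_grid:
  fixes \<tau> \<xi> t :: real
  assumes "\<tau> > 0"
  shows "finite (grid \<tau> \<xi> t)"
  by (simp add: grid_eq_image[OF assms])

lemma card_grid:
  fixes \<tau> \<xi> t :: real
  assumes "\<tau> > 0"
  shows "card (grid \<tau> \<xi> t) = nat (\<lfloor>\<tau> * t - \<xi>\<rfloor> + \<lfloor>\<xi>\<rfloor> + 1)"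
proof -
  have "inj_on (\<lambda>n::int. (\<xi> + of_int n) / \<tau>) A" for A
    using assms by (auto intro!: inj_onI)
  then show ?thesis
    unfolding grid_eq_image[OF assms] by (simp add: card_image ceiling_minus algebra_simps)
qed

lemma card_grid_le:
  fixes \<tau> \<xi> t :: real
  assumes "\<tau> > 0" "t \<ge> 0"
  shows "card (grid \<tau> \<xi> t) \<le> \<tau> * t + 1"
proof -
  have "0 \<le> \<tau> * t"
    using assms by simp
  then have "real (nat (\<lfloor>\<tau> * t - \<xi>\<rfloor> + \<lfloor>\<xi>\<rfloor> + 1)) \<le> \<tau> * t + 1"
    by linarith
  then show ?thesis
    by (simp add: card_grid[OF assms(1)])
qed

text \<open>For a nonintegral \<open>y\<close> the floor of \<open>- y\<close> is one less than
  minus the floor of \<open>y\<close>; with \<open>y = \<xi> - \<tau> * t\<close> the count becomes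
  linear growth plus a difference of fractional parts.\<close>

lemma card_grid_frac:
  fixes \<tau> \<xi> t :: real
  assumes "\<tau> > 0" "t \<ge> 0" "\<xi> - \<tau> * t \<notin> \<int>"
  shows "real (card (grid \<tau> \<xi> t)) = \<tau> * t + frac (\<xi> - \<tau> * t) - frac \<xi>"
proof -
  have "0 \<le> \<tau> * t"
    using assms by simp
  then have "\<lfloor>\<tau> * t - \<xi>\<rfloor> + \<lfloor>\<xi>\<rfloor> + 1 \<ge> 0"
    by linarith
  moreover have "\<lfloor>\<tau> * t - \<xi>\<rfloor> = - \<lfloor>\<xi> - \<tau> * t\<rfloor> - 1"
    using floor_minus[of "\<xi> - \<tau> * t"] assms(3) by (simp add: ceiling_altdef) (metis Ints_of_int)
  ultimately show ?thesis
    by (simp add: card_grid[OF assms(1)] frac_def)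
qed

text \<open>
  Abel summation: \<open>f b - f s\<close> is the integral of \<open>f'\<close> over \<open>{s..b}\<close>, and the number of
  summation points in \<open>{0..t}\<close> differs from \<open>\<tau> t\<close> by a difference of two values of the sawtooth.
\<close>

lemma euler_maclaurin_0:
  fixes f f' :: "real \<Rightarrow> real"
  assumes f: "\<And>t. (f has_real_derivative f' t) (at t)"
    and "\<tau> > 0" "b \<ge> 0" "\<xi> \<notin> \<int>" "\<xi> - \<tau> * b \<notin> \<int>"
  shows "((\<lambda>t. f' t * bern_per (Suc 0) (\<xi> - \<tau> * t)) has_integral
    \<tau> * integral {0..b} f + (f b * bern_per (Suc 0) (\<xi> - \<tau> * b) - f 0 * bern_per (Suc 0) \<xi>)
      - (\<Sum>t\<in>grid \<tau> \<xi> b. f t)) {0..b}"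
proof -
  define P where "P = grid \<tau> \<xi> b"
  have fin: "finite P"
    unfolding P_def by (rule finite_grid) fact
  have ftc: "(f' has_integral f y - f x) {x..y}" if "x \<le> y" for x y
    by (rule fundamental_theorem_of_calculus[OF that])
      (auto simp: has_real_derivative_iff_has_vector_derivative[symmetric] intro: DERIV_subset[OF f])
  have "((\<lambda>t. if t \<in> {s..b} then f' t else 0) has_integral f b - f s) {0..b}" if "s \<in> P" for s
    using that ftc[of s b] by (subst has_integral_restrict) (auto simp: P_def grid_def)
  then have "((\<lambda>t. \<Sum>s\<in>P. if t \<in> {s..b} then f' t else 0) has_integral (\<Sum>s\<in>P. f b - f s)) {0..b}"
    by (intro has_integral_sum fin)
  then have 1: "((\<lambda>t. f' t * (\<tau> * t + frac (\<xi> - \<tau> * t) - frac \<xi>)) has_integral (\<Sum>s\<in>P. f b - f s)) {0..b}"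
  \<comment> \<open>Away from the summation points, the indicators of \<open>{s..b}\<close> at
    \<open>t\<close> add up to the number of points in \<open>{0..t}\<close>, which
    \<open>card_grid_frac\<close> evaluates.\<close>
  proof (rule has_integral_spike_finite[OF fin, rotated])
    fix t assume t: "t \<in> {0..b} - P"
    have "\<xi> - \<tau> * t \<notin> \<int>"
      using t Ints_minus[of "\<xi> - \<tau> * t"] by (auto simp: P_def grid_def)
    then have "f' t * (\<tau> * t + frac (\<xi> - \<tau> * t) - frac \<xi>)
        = f' t * real (card (grid \<tau> \<xi> t))"
      using card_grid_frac[of \<tau> t \<xi>] assms t by simp
    also have "grid \<tau> \<xi> t = {s\<in>P. t \<in> {s..b}}"
      using t by (auto simp: P_def grid_def)
    also have "f' t * real (card \<dots>) = (\<Sum>s\<in>P. if t \<in> {s..b} then f' t else 0)"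
      using fin by (simp add: sum.If_cases Int_def)
    finally show "f' t * (\<tau> * t + frac (\<xi> - \<tau> * t) - frac \<xi>) = (\<Sum>s\<in>P. if t \<in> {s..b} then f' t else 0)" .
  qed
  have cont: "continuous_on {0..b} f"
    using f by (meson DERIV_isCont continuous_at_imp_continuous_on)
  have 2: "((\<lambda>t. f' t * (\<tau> * t)) has_integral f b * (\<tau> * b) - \<tau> * integral {0..b} f) {0..b}"
  proof (rule integration_by_parts[OF bounded_bilinear_mult])
    show "continuous_on {0..b} f" "continuous_on {0..b} ((*) \<tau>)"
      by (intro cont continuous_intros)+
    show "(f has_vector_derivative f' x) (at x)" "((*) \<tau> has_vector_derivative \<tau>) (at x)" for x
      using f by (auto intro!: derivative_eq_intros simp: has_real_derivative_iff_has_vector_derivative[symmetric])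
    have "((\<lambda>t. f t * \<tau>) has_integral integral {0..b} f * \<tau>) {0..b}"
      using integrable_continuous_interval[OF cont] by (intro has_integral_mult_left integrable_integral)
    then show "((\<lambda>t. f t * \<tau>) has_integral f b * (\<tau> * b) - f 0 * (\<tau> * 0)
        - (f b * (\<tau> * b) - \<tau> * integral {0..b} f)) {0..b}"
      by (simp add: mult.commute)
  qed fact
  \<comment> \<open>This correction replaces the subtracted \<open>frac \<xi>\<close> by 1/2 and so
    produces the sawtooth.\<close>
  have 3: "((\<lambda>t. f' t * (frac \<xi> - 1 / 2)) has_integral (f b - f 0) * (frac \<xi> - 1 / 2)) {0..b}"
    by (intro has_integral_mult_left ftc) fact
  have card: "real (card P) = \<tau> * b + frac (\<xi> - \<tau> * b) - frac \<xi>"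
    unfolding P_def using card_grid_frac assms by blast
  have "((\<lambda>t. f' t * (\<tau> * t + frac (\<xi> - \<tau> * t) - frac \<xi>) - f' t * (\<tau> * t) + f' t * (frac \<xi> - 1 / 2)) has_integral
      (\<Sum>s\<in>P. f b - f s) - (f b * (\<tau> * b) - \<tau> * integral {0..b} f) + (f b - f 0) * (frac \<xi> - 1 / 2)) {0..b}"
    by (intro has_integral_add has_integral_diff 1 2 3)
  also have "(\<lambda>t. f' t * (\<tau> * t + frac (\<xi> - \<tau> * t) - frac \<xi>) - f' t * (\<tau> * t) + f' t * (frac \<xi> - 1 / 2))
      = (\<lambda>t. f' t * bern_per (Suc 0) (\<xi> - \<tau> * t))"
    by (simp add: bern_per_1 algebra_simps)
  also have "(\<Sum>s\<in>P. f b - f s) - (f b * (\<tau> * b) - \<tau> * integral {0..b} f) + (f b - f 0) * (frac \<xi> - 1 / 2)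
      = \<tau> * integral {0..b} f + (f b * bern_per (Suc 0) (\<xi> - \<tau> * b) - f 0 * bern_per (Suc 0) \<xi>) - (\<Sum>t\<in>P. f t)"
    by (simp add: bern_per_1 sum_subtractf card field_simps)
  finally show ?thesis
    by (simp only: P_def)
qed

text \<open>Integration by parts: in \<open>t\<close>,
  \<open>bern_per (Suc (Suc n)) (\<xi> - \<tau> * t)\<close> has as derivative
  \<open>- \<tau>\<close> times the function of index one less. For \<open>n = 0\<close> this fails
  at the grid points, where the sawtooth jumps; they are finitely many and the primitive is
  continuous across them.\<close>

lemma euler_maclaurin_step:
  fixes u u' :: "real \<Rightarrow> real"
  assumes u: "\<And>t. (u has_real_derivative u' t) (at t)"
    and "\<tau> > 0" "b \<ge> 0"
    and y: "((\<lambda>t. u t * bern_per (Suc n) (\<xi> - \<tau> * t)) has_integral y) {0..b}"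
  shows "((\<lambda>t. u' t * bern_per (Suc (Suc n)) (\<xi> - \<tau> * t)) has_integral
    \<tau> * y + (u b * bern_per (Suc (Suc n)) (\<xi> - \<tau> * b) - u 0 * bern_per (Suc (Suc n)) \<xi>)) {0..b}"
proof (rule integration_by_parts_interior_strong[OF bounded_bilinear_mult, where s = "grid \<tau> \<xi> b"])
  show "finite (grid \<tau> \<xi> b)"
    by (rule finite_grid) fact
  show "continuous_on {0..b} u"
    using u by (meson DERIV_isCont continuous_at_imp_continuous_on)
  show "continuous_on {0..b} (\<lambda>t. bern_per (Suc (Suc n)) (\<xi> - \<tau> * t))"
    by (intro continuous_on_compose2[OF continuous_on_bern_per] continuous_intros) auto
  show "(u has_vector_derivative u' x) (at x)" for x
    using u by (simp add: has_real_derivative_iff_has_vector_derivative[symmetric])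
  fix x assume x: "x \<in> {0<..<b} - grid \<tau> \<xi> b"
  then have "\<xi> - \<tau> * x \<notin> \<int>"
    using Ints_minus[of "\<xi> - \<tau> * x"] by (auto simp: grid_def)
  then have "((\<lambda>t. bern_per (Suc (Suc n)) (\<xi> - \<tau> * t)) has_real_derivative
      bern_per (Suc n) (\<xi> - \<tau> * x) * (- \<tau>)) (at x)"
    by (intro DERIV_chain2[OF bern_per_has_derivative]) (auto intro!: derivative_eq_intros)
  then show "((\<lambda>t. bern_per (Suc (Suc n)) (\<xi> - \<tau> * t)) has_vector_derivative
      bern_per (Suc n) (\<xi> - \<tau> * x) * (- \<tau>)) (at x)"
    by (simp add: has_real_derivative_iff_has_vector_derivative)
next
  have "((\<lambda>t. (u t * bern_per (Suc n) (\<xi> - \<tau> * t)) * (- \<tau>)) has_integral y * (- \<tau>)) {0..b}"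
    by (intro has_integral_mult_left y)
  then show "((\<lambda>t. u t * (bern_per (Suc n) (\<xi> - \<tau> * t) * (- \<tau>))) has_integral
      u b * bern_per (Suc (Suc n)) (\<xi> - \<tau> * b) - u 0 * bern_per (Suc (Suc n)) (\<xi> - \<tau> * 0)
      - (\<tau> * y + (u b * bern_per (Suc (Suc n)) (\<xi> - \<tau> * b) - u 0 * bern_per (Suc (Suc n)) \<xi>))) {0..b}"
    by (simp add: algebra_simps)
qed fact

text \<open>\<open>F j\<close> stands for the \<open>j\<close>-th derivative. The form
  \<open>has_integral\<close> carries the integrability of the top-order integrand through the
  induction, and \<open>\<tau> ^ m\<close> collects the factors produced by the integrations by
  parts.\<close>

lemma euler_maclaurin:
  fixes F :: "nat \<Rightarrow> real \<Rightarrow> real"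
  assumes F: "\<And>j t. j \<le> m \<Longrightarrow> (F j has_real_derivative F (Suc j) t) (at t)"
    and "\<tau> > 0" "b \<ge> 0" "\<xi> \<notin> \<int>" "\<xi> - \<tau> * b \<notin> \<int>"
  shows "((\<lambda>t. F (Suc m) t * bern_per (Suc m) (\<xi> - \<tau> * t)) has_integral
    \<tau> ^ m * (\<tau> * integral {0..b} (F 0)
      + (\<Sum>j\<le>m. (F j b * bern_per (Suc j) (\<xi> - \<tau> * b) - F j 0 * bern_per (Suc j) \<xi>) / \<tau> ^ j)
      - (\<Sum>t\<in>grid \<tau> \<xi> b. F 0 t))) {0..b}"
  using F
proof (induction m)
  case 0
  then show ?case
    using euler_maclaurin_0[of "F 0" "F (Suc 0)" \<tau> b \<xi>] assms by simp
next
  case (Suc m)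
  note IH = Suc.IH[OF Suc.prems[OF le_SucI]]
  show ?case
  proof (rule has_integral_eq_rhs[OF euler_maclaurin_step[OF Suc.prems[OF order_refl] assms(2,3) IH] sym])
    have *: "\<tau> * (\<tau> ^ m * (A + S - P)) + X = \<tau> ^ Suc m * (A + (S + X / \<tau> ^ Suc m) - P)" for A S P X
      using assms(2) by (simp add: algebra_simps)
    show "\<tau> * (\<tau> ^ m * (\<tau> * integral {0..b} (F 0)
        + (\<Sum>j\<le>m. (F j b * bern_per (Suc j) (\<xi> - \<tau> * b) - F j 0 * bern_per (Suc j) \<xi>) / \<tau> ^ j)
        - (\<Sum>t\<in>grid \<tau> \<xi> b. F 0 t)))
      + (F (Suc m) b * bern_per (Suc (Suc m)) (\<xi> - \<tau> * b) - F (Suc m) 0 * bern_per (Suc (Suc m)) \<xi>)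
      = \<tau> ^ Suc m * (\<tau> * integral {0..b} (F 0)
        + (\<Sum>j\<le>Suc m. (F j b * bern_per (Suc j) (\<xi> - \<tau> * b) - F j 0 * bern_per (Suc j) \<xi>) / \<tau> ^ j)
        - (\<Sum>t\<in>grid \<tau> \<xi> b. F 0 t))"
      unfolding sum.atMost_Suc by (rule *)
  qed
qed

lemma euler_maclaurin_bound:
  fixes F :: "nat \<Rightarrow> real \<Rightarrow> real"
  assumes F: "\<And>j t. j \<le> m \<Longrightarrow> (F j has_real_derivative F (Suc j) t) (at t)"
    and "\<tau> > 0" "b \<ge> 0" "\<xi> \<notin> \<int>" "\<xi> - \<tau> * b \<notin> \<int>"
    and K: "\<And>t. t \<in> {0..b} \<Longrightarrow> \<bar>F (Suc m) t\<bar> \<le> K"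
    and B: "\<And>x. \<bar>bern_per (Suc m) x\<bar> \<le> B"
  shows "\<bar>(\<Sum>t\<in>grid \<tau> \<xi> b. F 0 t) - \<tau> * integral {0..b} (F 0)
      - (\<Sum>j\<le>m. (F j b * bern_per (Suc j) (\<xi> - \<tau> * b) - F j 0 * bern_per (Suc j) \<xi>) / \<tau> ^ j)\<bar>
    \<le> b * (K * B) / \<tau> ^ m" (is "\<bar>?R\<bar> \<le> _")
proof -
  have *: "((\<lambda>t. F (Suc m) t * bern_per (Suc m) (\<xi> - \<tau> * t)) has_integral \<tau> ^ m * (- ?R)) (cbox 0 b)"
    using euler_maclaurin[of m F, OF F assms(2-5)] by (simp add: algebra_simps)
  have "K \<ge> 0" "B \<ge> 0"
    using K[of 0] B[of 0] assms(3) by auto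
  then have "norm (\<tau> ^ m * (- ?R)) \<le> (K * B) * measure lborel (cbox 0 b)"
    by (intro has_integral_bound[OF _ *]) (use K B in \<open>auto simp: abs_mult intro!: mult_mono\<close>)
  moreover have "\<bar>R\<bar> \<le> b * (K * B) / \<tau> ^ m" if "norm (\<tau> ^ m * (- R)) \<le> (K * B) * measure lborel (cbox 0 b)" for R
    using that assms(2,3) by (simp add: abs_mult field_simps)
  ultimately show ?thesis
    by blast
qed

section \<open>Partial derivatives\<close>

lemma C_class_continuous: "C_class m f \<Longrightarrow> continuous_on UNIV f"
  by (cases m) auto

lemma C_class_SucD: "C_class (Suc m) f \<Longrightarrow> C_class m f"
  by (induction m arbitrary: f) auto

lemma C_class_mono: "C_class n f \<Longrightarrow> m \<le> n \<Longrightarrow> C_class m f"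
  by (induction n) (metis le_zero_eq, metis C_class_SucD le_SucE)

abbreviation pd :: "'n::finite \<Rightarrow> (real^'n \<Rightarrow> real) \<Rightarrow> real^'n \<Rightarrow> real" where
  "pd \<equiv> partial_deriv"

lemma C_class_partial_deriv: "C_class (Suc m) f \<Longrightarrow> C_class m (pd i f)"
  by simp

lemma partial_deriv_eqI:
  assumes "\<And>x. ((\<lambda>t. f (x + t *\<^sub>R axis i 1)) has_real_derivative g x) (at 0)"
  shows "pd i f = g"
  using DERIV_imp_deriv[OF assms] by (auto simp: partial_deriv_def)

lemma C_class_SucI:
  assumes "continuous_on UNIV f"
    and "\<And>i x. ((\<lambda>t. f (x + t *\<^sub>R axis i 1)) has_real_derivative g i x) (at 0)"
    and "\<And>i. C_class m (g i)"
  shows "C_class (Suc m) f"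
proof -
  have "pd i f = g i" for i
    by (rule partial_deriv_eqI) fact
  moreover have "(\<lambda>t. f (x + t *\<^sub>R axis i 1)) differentiable at 0" for i x
    using assms(2)[of x i] by (auto simp: real_differentiable_def)
  ultimately show ?thesis
    using assms(1,3) by simp
qed

lemma DERIV_partial_deriv:
  assumes "C_class (Suc m) f"
  shows "((\<lambda>t. f (x + t *\<^sub>R axis i 1)) has_real_derivative pd i f (x + s *\<^sub>R axis i 1)) (at s)"
proof -
  let ?\<phi> = "\<lambda>t. f ((x + s *\<^sub>R axis i 1) + t *\<^sub>R axis i 1)"
  have "?\<phi> field_differentiable at 0"
    using assms by (simp add: real_differentiable_def field_differentiable_def)
  then have "(?\<phi> has_real_derivative pd i f (x + s *\<^sub>R axis i 1)) (at 0)"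
    unfolding partial_deriv_def by (rule field_differentiable_derivI)
  then have "((\<lambda>t. f (x + t *\<^sub>R axis i 1)) has_real_derivative pd i f (x + s *\<^sub>R axis i 1)) (at (0 + s))"
    by (subst DERIV_shift) (simp add: scaleR_add_left algebra_simps)
  then show ?thesis
    by simp
qed

lemma DERIV_partial_deriv_0:
  "C_class (Suc m) f \<Longrightarrow> ((\<lambda>t. f (x + t *\<^sub>R axis i 1)) has_real_derivative pd i f x) (at 0)"
  using DERIV_partial_deriv[of m f x i 0] by simp

text \<open>Joint differentiability of \<open>H\<close> follows from one partial derivative at a
  single point and a continuous other one; the chain rule does the rest. It serves for directional
  derivatives and for integrals whose upper limit moves with the parameter.\<close>

lemma DERIV_along_curve:
  fixes H Hy :: "real \<Rightarrow> real \<Rightarrow> real"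
  assumes "((\<lambda>r. H r (\<eta> 0)) has_real_derivative a) (at 0)"
    and "\<And>r y. (H r has_real_derivative Hy r y) (at y)"
    and "continuous_on UNIV (\<lambda>(r, y). Hy r y)"
    and "(\<eta> has_real_derivative b) (at 0)"
  shows "((\<lambda>r. H r (\<eta> r)) has_real_derivative a + Hy 0 (\<eta> 0) * b) (at 0)"
proof -
  have "((\<lambda>(x, y). H x y) has_derivative (\<lambda>(tx, ty). a * tx + blinfun_mult_right (Hy 0 (\<eta> 0)) ty))
      (at (0, \<eta> 0) within UNIV \<times> UNIV)"
  proof (rule has_derivative_partialsI)
    show "((\<lambda>x. H x (\<eta> 0)) has_derivative (*) a) (at 0)"
      using assms(1) by (simp add: has_field_derivative_def)
    show "(H x has_derivative blinfun_apply (blinfun_mult_right (Hy x y))) (at y)" for x y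
      using assms(2)[of x y] by (simp add: has_field_derivative_def)
    have "continuous_on UNIV (\<lambda>p. blinfun_mult_right (case p of (r, y) \<Rightarrow> Hy r y))"
      by (intro bounded_linear.continuous_on[OF bounded_linear_blinfun_mult_right] assms(3))
    then show "continuous (at (0, \<eta> 0) within UNIV \<times> UNIV) (\<lambda>(x, y). blinfun_mult_right (Hy x y))"
      by (simp add: continuous_on_eq_continuous_within case_prod_unfold)
  qed auto
  then have "((\<lambda>(x, y). H x y) has_derivative (\<lambda>(tx, ty). a * tx + Hy 0 (\<eta> 0) * ty)) (at (0, \<eta> 0))"
    by simp
  moreover have "((\<lambda>r. (r, \<eta> r)) has_derivative (\<lambda>t. (t, b * t))) (at 0)"
    using assms(4) by (intro derivative_intros) (simp_all add: has_field_derivative_def)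
  ultimately have "((\<lambda>(x, y). H x y) \<circ> (\<lambda>r. (r, \<eta> r)) has_derivative
      (\<lambda>(tx, ty). a * tx + Hy 0 (\<eta> 0) * ty) \<circ> (\<lambda>t. (t, b * t))) (at 0)"
    by (intro diff_chain_at) auto
  then show ?thesis
    unfolding has_field_derivative_def o_def case_prod_conv
    by (rule has_derivative_eq_rhs) (auto simp: algebra_simps)
qed

text \<open>\<open>C_class\<close> knows only derivatives along the axes. The direction is assembled
  one coordinate at a time, each new coordinate entering by the chain rule along a curve.\<close>

lemma DERIV_directional:
  fixes f :: "real^'n \<Rightarrow> real"
  assumes f: "C_class (Suc m) f"
  shows "((\<lambda>r. f (x + r *\<^sub>R u)) has_real_derivative (\<Sum>i\<in>UNIV. u $ i * pd i f x)) (at 0)"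
proof -
  have "((\<lambda>r. f (x + r *\<^sub>R (\<Sum>i\<in>A. u $ i *\<^sub>R axis i 1))) has_real_derivative
      (\<Sum>i\<in>A. u $ i * pd i f x)) (at 0)" if "finite A" for A
    using that
  proof (induction A)
    case empty
    then show ?case
      by simp
  next
    case (insert k A)
    let ?w = "\<Sum>i\<in>A. u $ i *\<^sub>R axis i 1 :: real^'n"
    let ?Hy = "\<lambda>r y. pd k f (x + r *\<^sub>R ?w + y *\<^sub>R axis k 1)"
    have "((\<lambda>r. f (x + r *\<^sub>R ?w + (u $ k * r) *\<^sub>R axis k 1)) has_real_derivative
        (\<Sum>i\<in>A. u $ i * pd i f x) + ?Hy 0 (u $ k * 0) * u $ k) (at 0)"
    proof (rule DERIV_along_curve[where \<eta> = "(*) (u $ k)" and Hy = ?Hy])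
      show "((\<lambda>y. f (x + r *\<^sub>R ?w + y *\<^sub>R axis k 1)) has_real_derivative ?Hy r y) (at y)" for r y
        by (rule DERIV_partial_deriv[OF f])
      have "continuous_on UNIV (pd k f)"
        using f C_class_continuous by (metis C_class_partial_deriv)
      then show "continuous_on UNIV (\<lambda>(r, y). ?Hy r y)"
        unfolding case_prod_unfold
        by (rule continuous_on_compose2) (auto intro!: continuous_intros)
    qed (use insert.IH in \<open>auto intro!: derivative_eq_intros\<close>)
    then show ?case
      using insert.hyps by (simp add: algebra_simps)
  qed
  from this[OF finite_class.finite_UNIV] show ?thesis
    using basis_expansion[of u] by (simp add: scalar_mult_eq_scaleR)
qed

lemma
  assumes f: "C_class (Suc m) f" and g: "C_class (Suc m) g"
  shows partial_deriv_linear: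
    "pd i (\<lambda>x. a * f x + b * g x) = (\<lambda>x. a * pd i f x + b * pd i g x)"
  by (rule partial_deriv_eqI) (intro DERIV_add DERIV_cmult DERIV_partial_deriv_0[OF f] DERIV_partial_deriv_0[OF g])

lemma C_class_linear:
  "C_class m f \<Longrightarrow> C_class m g \<Longrightarrow> C_class m (\<lambda>x. a * f x + b * g x)"
proof (induction m arbitrary: f g)
  case 0
  then show ?case
    by (auto intro!: continuous_intros)
next
  case (Suc m)
  show ?case
  proof (rule C_class_SucI[where g = "\<lambda>i x. a * pd i f x + b * pd i g x"])
    show "continuous_on UNIV (\<lambda>x. a * f x + b * g x)"
      using Suc.prems by (auto intro!: continuous_intros)
    show "((\<lambda>t. a * f (x + t *\<^sub>R axis i 1) + b * g (x + t *\<^sub>R axis i 1)) has_real_derivative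
        a * pd i f x + b * pd i g x) (at 0)" for i x
      by (intro DERIV_add DERIV_cmult DERIV_partial_deriv_0[OF Suc.prems(1)] DERIV_partial_deriv_0[OF Suc.prems(2)])
    show "C_class m (\<lambda>x. a * pd i f x + b * pd i g x)" for i
      using Suc.prems by (intro Suc.IH C_class_partial_deriv)
  qed
qed

lemma C_class_const: "C_class m (\<lambda>_. c)"
proof (induction m arbitrary: c)
  case (Suc m)
  show ?case
    by (rule C_class_SucI[where g = "\<lambda>_ _. 0"]) (auto intro: Suc.IH)
qed simp

lemma C_class_cmult: "C_class m f \<Longrightarrow> C_class m (\<lambda>x. a * f x)"
  using C_class_linear[of m f f a 0] by simp

lemma C_class_sum:
  "(\<And>i. i \<in> A \<Longrightarrow> C_class m (F i)) \<Longrightarrow> C_class m (\<lambda>x. \<Sum>i\<in>A. F i x)"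
proof (induction A rule: infinite_finite_induct)
  case (insert i A)
  then show ?case
    using C_class_linear[of m "F i" "\<lambda>x. \<Sum>i\<in>A. F i x" 1 1] by simp
qed (simp_all add: C_class_const)

lemma partial_deriv_affine:
  assumes f: "C_class (Suc m) f" and A: "linear A"
  shows "((\<lambda>t. f (A (x + t *\<^sub>R axis k 1) + b)) has_real_derivative
    (\<Sum>i\<in>UNIV. A (axis k 1) $ i * pd i f (A x + b))) (at 0)"
  using DERIV_directional[OF f, of "A x + b" "A (axis k 1)"]
  by (simp add: linear_add[OF A] linear_scale[OF A] algebra_simps)

lemma continuous_on_comp_affine:
  fixes A :: "real^'m \<Rightarrow> real^'n"
  assumes "continuous_on UNIV f" "linear A"
  shows "continuous_on UNIV (\<lambda>x. f (A x + b))"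
  using assms(2) unfolding linear_conv_bounded_linear
  by (intro continuous_on_compose2[OF assms(1)] continuous_on_add continuous_on_const linear_continuous_on) auto

lemma C_class_affine:
  "C_class m f \<Longrightarrow> linear A \<Longrightarrow> C_class m (\<lambda>x. f (A x + b))"
proof (induction m arbitrary: f)
  case 0
  then show ?case
    by (simp add: continuous_on_comp_affine)
next
  case (Suc m)
  show ?case
  proof (rule C_class_SucI[OF _ partial_deriv_affine[OF Suc.prems]])
    show "continuous_on UNIV (\<lambda>x. f (A x + b))"
      using Suc.prems by (simp add: continuous_on_comp_affine)
    show "C_class m (\<lambda>x. \<Sum>i\<in>UNIV. A (axis k 1) $ i * pd i f (A x + b))" for k
      using Suc by (intro C_class_sum C_class_cmult Suc.IH C_class_partial_deriv)
  qed
qed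

section \<open>Symmetry of mixed partial derivatives\<close>

lemma second_difference:
  assumes f: "C_class (Suc (Suc m)) f" and s: "s > 0"
  shows "\<exists>u v. 0 \<le> u \<and> u \<le> s \<and> 0 \<le> v \<and> v \<le> s \<and>
    f (x + s *\<^sub>R axis i 1 + s *\<^sub>R axis j 1) - f (x + s *\<^sub>R axis i 1) - f (x + s *\<^sub>R axis j 1) + f x
      = s * s * pd j (pd i f) (x + u *\<^sub>R axis i 1 + v *\<^sub>R axis j 1)"
proof -
  let ?\<phi> = "\<lambda>t. f ((x + s *\<^sub>R axis j 1) + t *\<^sub>R axis i 1) - f (x + t *\<^sub>R axis i 1)"
  have "(?\<phi> has_real_derivative pd i f ((x + s *\<^sub>R axis j 1) + t *\<^sub>R axis i 1)
      - pd i f (x + t *\<^sub>R axis i 1)) (at t)" for t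
    by (intro derivative_intros DERIV_partial_deriv[OF f])
  from MVT2[OF s this] obtain u where u: "0 < u" "u < s" "?\<phi> s - ?\<phi> 0 = s *
      (pd i f ((x + s *\<^sub>R axis j 1) + u *\<^sub>R axis i 1) - pd i f (x + u *\<^sub>R axis i 1))"
    by auto
  let ?\<psi> = "\<lambda>t. pd i f ((x + u *\<^sub>R axis i 1) + t *\<^sub>R axis j 1)"
  have "(?\<psi> has_real_derivative pd j (pd i f) ((x + u *\<^sub>R axis i 1) + t *\<^sub>R axis j 1)) (at t)" for t
    by (rule DERIV_partial_deriv[OF C_class_partial_deriv[OF f]])
  from MVT2[OF s this] obtain v where v: "0 < v" "v < s" "?\<psi> s - ?\<psi> 0 = s *
      pd j (pd i f) ((x + u *\<^sub>R axis i 1) + v *\<^sub>R axis j 1)"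
    by auto
  have "?\<psi> s - ?\<psi> 0 = pd i f ((x + s *\<^sub>R axis j 1) + u *\<^sub>R axis i 1) - pd i f (x + u *\<^sub>R axis i 1)"
    by (simp add: algebra_simps)
  then have "?\<phi> s - ?\<phi> 0 = s * (s * pd j (pd i f) ((x + u *\<^sub>R axis i 1) + v *\<^sub>R axis j 1))"
    using u(3) v(3) by simp
  then show ?thesis
    using u(1,2) v(1,2) by (intro exI[of _ u] exI[of _ v]) (simp add: algebra_simps)
qed

text \<open>The second difference is symmetric in the two directions. Divided by the square of the
  step it tends to either mixed derivative, since the intermediate points from the mean value
  theorem shrink to \<open>x\<close> and both mixed derivatives are continuous.\<close>

lemma partial_deriv_commute:
  fixes f :: "real^'n \<Rightarrow> real"
  assumes f: "C_class (Suc (Suc m)) f"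
  shows "pd i (pd j f) = pd j (pd i f)"
proof
  fix x
  define s where "s n = 1 / real (Suc n)" for n
  have s0: "s n > 0" for n
    by (simp add: s_def)
  have s_lim: "s \<longlonglongrightarrow> 0"
    unfolding s_def by (rule lim_1_over_n[THEN LIMSEQ_Suc])
  define \<Delta> where "\<Delta> n = f (x + s n *\<^sub>R axis i 1 + s n *\<^sub>R axis j 1) - f (x + s n *\<^sub>R axis i 1)
      - f (x + s n *\<^sub>R axis j 1) + f x" for n
  have lim: "(\<lambda>n. \<Delta> n / (s n * s n)) \<longlonglongrightarrow> pd l (pd k f) x"
    if *: "\<And>n. \<exists>u v. 0 \<le> u \<and> u \<le> s n \<and> 0 \<le> v \<and> v \<le> s n \<and>
      \<Delta> n = s n * s n * pd l (pd k f) (x + u *\<^sub>R axis k 1 + v *\<^sub>R axis l 1)" for k l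
  proof -
    obtain u v where uv: "\<And>n. 0 \<le> u n" "\<And>n. u n \<le> s n" "\<And>n. 0 \<le> v n" "\<And>n. v n \<le> s n"
      "\<And>n. \<Delta> n = s n * s n * pd l (pd k f) (x + u n *\<^sub>R axis k 1 + v n *\<^sub>R axis l 1)"
    proof -
      have "\<forall>n. \<exists>p. 0 \<le> fst p \<and> fst p \<le> s n \<and> 0 \<le> snd p \<and> snd p \<le> s n \<and>
          \<Delta> n = s n * s n * pd l (pd k f) (x + fst p *\<^sub>R axis k 1 + snd p *\<^sub>R axis l 1)"
        using * by simp
      from choice[OF this] obtain p where "\<forall>n. 0 \<le> fst (p n) \<and> fst (p n) \<le> s n \<and> 0 \<le> snd (p n) \<and> snd (p n) \<le> s n \<and>
          \<Delta> n = s n * s n * pd l (pd k f) (x + fst (p n) *\<^sub>R axis k 1 + snd (p n) *\<^sub>R axis l 1)" ..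
      then show ?thesis
        by (intro that[of "\<lambda>n. fst (p n)" "\<lambda>n. snd (p n)"]) auto
    qed
    have "u \<longlonglongrightarrow> 0" "v \<longlonglongrightarrow> 0"
      by (rule tendsto_sandwich[OF _ _ tendsto_const s_lim]; simp add: uv)+
    then have "(\<lambda>n. x + u n *\<^sub>R axis k 1 + v n *\<^sub>R axis l 1) \<longlonglongrightarrow> x + 0 *\<^sub>R axis k 1 + 0 *\<^sub>R axis l 1"
      by (intro tendsto_intros)
    moreover have "isCont (pd l (pd k f)) (x + 0 *\<^sub>R axis k 1 + 0 *\<^sub>R axis l 1)"
      using f C_class_continuous C_class_partial_deriv by (metis continuous_on_eq_continuous_at open_UNIV UNIV_I)
    ultimately have "(\<lambda>n. pd l (pd k f) (x + u n *\<^sub>R axis k 1 + v n *\<^sub>R axis l 1))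
        \<longlonglongrightarrow> pd l (pd k f) (x + 0 *\<^sub>R axis k 1 + 0 *\<^sub>R axis l 1)"
      by (rule isCont_tendsto_compose[rotated])
    moreover have "\<Delta> n / (s n * s n) = pd l (pd k f) (x + u n *\<^sub>R axis k 1 + v n *\<^sub>R axis l 1)" for n
      using uv(5)[of n] s0[of n] by simp
    ultimately show ?thesis
      by simp
  qed
  have "(\<lambda>n. \<Delta> n / (s n * s n)) \<longlonglongrightarrow> pd j (pd i f) x"
    unfolding \<Delta>_def by (rule lim[unfolded \<Delta>_def]) (rule second_difference[OF f s0])
  moreover have "(\<lambda>n. \<Delta> n / (s n * s n)) \<longlonglongrightarrow> pd i (pd j f) x"
  proof (rule lim)
    fix n
    have "\<Delta> n = f (x + s n *\<^sub>R axis j 1 + s n *\<^sub>R axis i 1) - f (x + s n *\<^sub>R axis j 1)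
      - f (x + s n *\<^sub>R axis i 1) + f x"
      by (simp add: \<Delta>_def algebra_simps)
    then show "\<exists>u v. 0 \<le> u \<and> u \<le> s n \<and> 0 \<le> v \<and> v \<le> s n \<and>
        \<Delta> n = s n * s n * pd i (pd j f) (x + u *\<^sub>R axis j 1 + v *\<^sub>R axis i 1)"
      using second_difference[OF f s0, of n x j i] by simp
  qed
  ultimately show "pd i (pd j f) x = pd j (pd i f) x"
    by (rule LIMSEQ_unique[rotated])
qed

lemma C_class_fold: "C_class (length ws + m) f \<Longrightarrow> C_class m (fold pd ws f)"
  by (induction ws arbitrary: f) auto

lemma fold_partial_deriv_commute:
  "C_class (Suc (length ws)) f \<Longrightarrow>
    pd k (fold pd ws f) = fold pd ws (pd k f)"
proof (induction ws arbitrary: f)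
  case (Cons l ws)
  then have "pd k (fold pd ws (pd l f)) =
      fold pd ws (pd k (pd l f))"
    by (intro Cons.IH) simp
  also have "pd k (pd l f) = pd l (pd k f)"
    using partial_deriv_commute Cons.prems by (metis length_Cons)
  finally show ?case
    by simp
qed simp

lemma fold_partial_deriv_mset:
  "C_class (length ws) f \<Longrightarrow> mset ws = mset vs \<Longrightarrow> fold pd ws f = fold pd vs f"
proof (induction ws arbitrary: f vs)
  case (Cons k ws)
  then have "k \<in> set vs"
    by (metis list.set_intros(1) mset_eq_setD)
  then obtain us us' where vs: "vs = us @ k # us'"
    by (meson split_list)
  have len: "length vs = length (k # ws)"
    using Cons.prems by (metis mset_eq_length)
  have "C_class (Suc (length us)) f"
    using len by (intro C_class_mono[OF Cons.prems(1)]) (auto simp: vs)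
  then have "fold pd vs f = fold pd (us @ us') (pd k f)"
    by (simp add: vs fold_partial_deriv_commute)
  moreover have "fold pd ws (pd k f) = fold pd (us @ us') (pd k f)"
    using Cons.prems by (intro Cons.IH) (auto simp: vs)
  ultimately show ?case
    by simp
qed simp

lemma fold_partial_deriv_replicate: "fold pd (replicate n k) f = (pd k ^^ n) f"
  by (induction n arbitrary: f) (auto simp: funpow_swap1)

text \<open>Inductive bounds add one derivative at a time and so speak of words of directions; the
  final supremum speaks of multi-indices. Commuting the derivatives sorts a word and leaves only the
  number of occurrences of each direction.\<close>

lemma fold_partial_deriv_eq_multi_deriv:
  fixes f :: "real^'n::{finite,wellorder} \<Rightarrow> real"
  assumes "C_class (length ws) f"
  shows "fold pd ws f = multi_deriv (count_list ws) f"
proof -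
  \<comment> \<open>\<open>multi_deriv\<close> applies the largest index first and
    \<open>fold\<close> the head of the list first, hence \<open>rev\<close>.\<close>
  define vs where "vs = concat (map (\<lambda>i. replicate (count_list ws i) i) (rev (sorted_list_of_set UNIV)))"
  have fold_eq: "fold pd (concat (map (\<lambda>i. replicate (\<alpha> i) i) (rev xs))) f
      = foldr (\<lambda>i. pd i ^^ \<alpha> i) xs f" for \<alpha> and xs :: "'n list"
    by (induction xs) (simp_all add: fold_partial_deriv_replicate)
  have cnt: "count_list (concat (map (\<lambda>i. replicate (\<alpha> i) i) xs)) k = (if k \<in> set xs then \<alpha> k else 0)"
    if "distinct xs" for \<alpha> k and xs :: "'n list"
  proof -
    have "count_list (replicate n i) k = (if i = k then n else 0)" for n and i k :: 'n
      by (induction n) auto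
    then show ?thesis
      using that by (induction xs) auto
  qed
  have "mset ws = mset vs"
    by (rule multiset_eqI) (simp add: vs_def cnt count_mset)
  then show ?thesis
    using fold_partial_deriv_mset[OF assms] fold_eq unfolding multi_deriv_def vs_def by simp
qed

lemma fold_partial_deriv_diff:
  "C_class (length ws) f \<Longrightarrow> C_class (length ws) g \<Longrightarrow>
    fold pd ws (\<lambda>x. f x - g x) = (\<lambda>x. fold pd ws f x - fold pd ws g x)"
proof (induction ws arbitrary: f g)
  case (Cons k ws)
  have "pd k (\<lambda>x. f x - g x) = (\<lambda>x. pd k f x - pd k g x)"
    using partial_deriv_linear[of "length ws" f g k 1 "-1"] Cons.prems by simp
  then show ?case
    using Cons by simp
qed simp

lemma fold_partial_deriv_cmult:
  "C_class (length ws) f \<Longrightarrow>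
    fold pd ws (\<lambda>x. a * f x) = (\<lambda>x. a * fold pd ws f x)"
proof (induction ws arbitrary: f)
  case (Cons k ws)
  have "pd k (\<lambda>x. a * f x) = (\<lambda>x. a * pd k f x)"
    using partial_deriv_linear[of "length ws" f f k a 0] Cons.prems by simp
  then show ?case
    using Cons by simp
qed simp

lemma sum_count_list: "sum (count_list ws) (UNIV :: 'n::finite set) = length ws"
  by (rule sum_count_set) auto

section \<open>The operators on the faces of the simplex\<close>

text \<open>The coordinates counted from 0 in the order of the index type; the inverse of the
  position \<open>card {j. j < k}\<close> used in \<open>list_to_vec\<close>.\<close>

definition idx :: "nat \<Rightarrow> 'n::{finite,wellorder}" where
  "idx i = sorted_list_of_set UNIV ! i"

lemma length_sorted_UNIV: "length (sorted_list_of_set (UNIV :: 'n::{finite,wellorder} set)) = CARD('n)"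
  by simp

lemma bij_betw_idx: "bij_betw idx {..<CARD('n)} (UNIV :: 'n::{finite,wellorder} set)"
  using bij_betw_nth[OF distinct_sorted_list_of_set[of "UNIV :: 'n set"] refl refl]
  by (simp add: idx_def[abs_def])

lemma idx_eq_iff:
  "i < CARD('n) \<Longrightarrow> j < CARD('n) \<Longrightarrow> (idx i :: 'n::{finite,wellorder}) = idx j \<longleftrightarrow> i = j"
  using bij_betw_idx[where 'n = 'n] by (auto simp: bij_betw_def inj_on_def)

lemma idx_less_iff:
  "i < CARD('n) \<Longrightarrow> j < CARD('n) \<Longrightarrow> (idx i :: 'n::{finite,wellorder}) < idx j \<longleftrightarrow> i < j"
  unfolding idx_def
  using sorted_wrt_nth_less[OF strict_sorted_list_of_set[of "UNIV :: 'n set"]]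
  by (metis length_sorted_UNIV less_asym linorder_neqE_nat order_less_irrefl)

lemma idx_cases:
  obtains i where "i < CARD('n)" "(k :: 'n::{finite,wellorder}) = idx i"
  using bij_betw_idx[where 'n = 'n] by (metis UNIV_I bij_betw_def imageE lessThan_iff)

lemma card_less_idx:
  assumes "i < CARD('n)"
  shows "card {j. j < (idx i :: 'n::{finite,wellorder})} = i"
proof -
  have "{j. j < (idx i :: 'n)} = idx ` {..<i}"
  proof (intro equalityI subsetI)
    fix k :: 'n assume "k \<in> {j. j < idx i}"
    then show "k \<in> idx ` {..<i}"
      using assms idx_less_iff by (cases k rule: idx_cases) auto
  qed (use assms in \<open>auto simp: idx_less_iff\<close>)
  moreover have "inj_on (idx :: nat \<Rightarrow> 'n) {..<i}"
    using assms by (auto simp: inj_on_def idx_eq_iff)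
  ultimately show ?thesis
    by (simp add: card_image)
qed

definition upd :: "'n \<Rightarrow> real \<Rightarrow> real^'n \<Rightarrow> real^'n::finite" where
  "upd k t x = x + (t - x $ k) *\<^sub>R axis k 1"

lemma upd_nth: "upd k t x $ i = (if i = k then t else x $ i)"
  by (simp add: upd_def axis_def)

definition psum :: "nat \<Rightarrow> real^'n::{finite,wellorder} \<Rightarrow> real" where
  "psum h x = (\<Sum>i<h. x $ idx i)"

lemma psum_linear: "psum h (x + y) = psum h x + psum h y" "psum h (c *\<^sub>R x) = c * psum h x"
  by (simp_all add: psum_def sum.distrib sum_distrib_left)

lemma psum_axis:
  assumes "h \<le> CARD('n)"
  shows "psum h (axis (k :: 'n::{finite,wellorder}) 1) = of_bool (k \<in> idx ` {..<h})"
proof (cases "k \<in> idx ` {..<h}")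
  case True
  then obtain j where j: "j < h" "k = idx j"
    by auto
  have "psum h (axis k 1) = (\<Sum>i<h. if i = j then 1 else 0)"
    unfolding psum_def using assms j by (intro sum.cong) (auto simp: axis_def idx_eq_iff)
  then show ?thesis
    using j True by simp
next
  case False
  then show ?thesis
    by (auto simp: psum_def axis_def intro!: sum.neutral)
qed

lemma psum_upd: "h < CARD('n) \<Longrightarrow> psum h (upd (idx h) t x) = psum h (x :: real^'n::{finite,wellorder})"
  unfolding psum_def by (intro sum.cong) (auto simp: upd_nth idx_eq_iff)

lemma continuous_on_psum [continuous_intros]:
  "continuous_on S f \<Longrightarrow> continuous_on S (\<lambda>x. psum h (f x))"
  unfolding psum_def by (intro continuous_intros)

lemma continuous_on_upd [continuous_intros]:
  "continuous_on S f \<Longrightarrow> continuous_on S g \<Longrightarrow> continuous_on S (\<lambda>x. upd k (f x) (g x))"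
  unfolding upd_def by (intro continuous_intros)

text \<open>The number of variables cannot change the type, so a function of \<open>h\<close>
  variables lives on the whole space and ignores the later coordinates. With coordinates counted
  from 0, the parameter \<open>h\<close> belongs to the operators that pass from
  \<open>Suc h\<close> to \<open>h\<close> variables, and \<open>psum h x\<close> is the sum of the
  remaining ones.\<close>

definition T0 :: "nat \<Rightarrow> (real^'n::{finite,wellorder} \<Rightarrow> real) \<Rightarrow> real^'n::_ \<Rightarrow> real" where
  "T0 h f x = (LBINT t=ereal 0..ereal (1 - psum h x). f (upd (idx h) t x))"

definition T1 :: "nat \<Rightarrow> (real^'n::{finite,wellorder} \<Rightarrow> real) \<Rightarrow> real^'n::_ \<Rightarrow> real" where
  "T1 h f x = f (upd (idx h) 0 x)"

definition T2 :: "nat \<Rightarrow> (real^'n::{finite,wellorder} \<Rightarrow> real) \<Rightarrow> real^'n::_ \<Rightarrow> real" where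
  "T2 h f x = f (upd (idx h) (1 - psum h x) x)"

lemma T1_affine:
  "T1 h f x = f ((x - x $ idx h *\<^sub>R axis (idx h) 1) + 0)"
  by (simp add: T1_def upd_def scaleR_diff_left)

lemma T2_affine:
  "T2 h f x = f ((x - (x $ idx h + psum h x) *\<^sub>R axis (idx h) 1) + axis (idx h) 1)"
  by (simp add: T2_def upd_def algebra_simps)

lemma linear_T1: "linear (\<lambda>x. x - x $ idx h *\<^sub>R axis (idx h) 1)"
  by (rule linearI) (simp_all add: algebra_simps)

lemma linear_T2: "linear (\<lambda>x. x - (x $ idx h + psum h x) *\<^sub>R axis (idx h) 1)"
  by (rule linearI) (simp_all add: algebra_simps psum_linear)

lemma C_class_T1: "C_class m f \<Longrightarrow> C_class m (T1 h f)"
  unfolding T1_affine[abs_def] by (rule C_class_affine[OF _ linear_T1])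

lemma C_class_T2: "C_class m f \<Longrightarrow> C_class m (T2 h f)"
  unfolding T2_affine[abs_def] by (rule C_class_affine[OF _ linear_T2])

lemma partial_deriv_T1:
  assumes "C_class (Suc m) f"
  shows "pd k (T1 h f) = (\<lambda>x. if k = idx h then 0 else T1 h (pd k f) x)"
proof (rule partial_deriv_eqI)
  fix x
  have "(\<Sum>i\<in>UNIV. (axis k 1 - axis k 1 $ idx h *\<^sub>R axis (idx h) 1) $ i * pd i f y)
      = (if k = idx h then 0 else pd k f y)" for y
    by (auto simp: axis_def if_distrib[of "\<lambda>x. x * _"] cong: if_cong)
  then show "((\<lambda>t. T1 h f (x + t *\<^sub>R axis k 1)) has_real_derivative
      (if k = idx h then 0 else T1 h (pd k f) x)) (at 0)"
    using partial_deriv_affine[OF assms linear_T1[of h], where x = x and k = k and b = 0] by (simp only: T1_affine)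
qed

lemma partial_deriv_T2:
  fixes f :: "real^'n::{finite,wellorder} \<Rightarrow> real"
  assumes "C_class (Suc m) f" "h < CARD('n)" "k \<in> idx ` {..<h}"
  shows "pd k (T2 h f) = (\<lambda>x. T2 h (pd k f) x - T2 h (pd (idx h) f) x)"
proof (rule partial_deriv_eqI)
  fix x
  have "k \<noteq> idx h"
    using assms by (auto simp: idx_eq_iff)
  then have "(\<Sum>i\<in>UNIV. (axis k 1 - (axis k 1 $ idx h + psum h (axis k 1)) *\<^sub>R axis (idx h) 1) $ i * pd i f y)
      = pd k f y - pd (idx h) f y" for y
    using assms by (simp add: psum_axis left_diff_distrib sum_subtractf)
      (simp add: axis_def if_distrib[of "\<lambda>x. x * _"] cong: if_cong)
  then show "((\<lambda>t. T2 h f (x + t *\<^sub>R axis k 1)) has_real_derivative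
      T2 h (pd k f) x - T2 h (pd (idx h) f) x) (at 0)"
    using partial_deriv_affine[OF assms(1) linear_T2[of h], where x = x and k = k and b = "axis (idx h) 1"] by (simp only: T2_affine)
qed

text \<open>Rescaling to the fixed interval moves the parameter from the domain into the integrand,
  where the standard theorems on parameter integrals apply. It is valid for both signs of
  \<open>y\<close> because the integral is oriented.\<close>

lemma LBINT_eq_scaled_integral:
  fixes \<phi> :: "real \<Rightarrow> real"
  assumes "continuous_on UNIV \<phi>"
  shows "(LBINT t=ereal 0..ereal y. \<phi> t) = y * integral (cbox 0 1) (\<lambda>u. \<phi> (y * u))"
proof -
  have cont: "continuous_on {0..1} (\<lambda>u. y *\<^sub>R \<phi> (y * u))"
    by (intro continuous_intros continuous_on_compose2[OF assms]) auto
  have "(LBINT t=ereal (y * 0)..ereal (y * 1). \<phi> t) = (LBINT u=ereal 0..ereal 1. y *\<^sub>R \<phi> (y * u))"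
    by (rule interval_integral_substitution_finite[symmetric])
      (auto intro!: derivative_eq_intros continuous_on_subset[OF assms])
  also have "\<dots> = integral {0..1} (\<lambda>u. y *\<^sub>R \<phi> (y * u))"
    by (rule interval_integral_eq_integral[OF _ borel_integrable_atLeastAtMost'[OF cont]]) simp
  finally show ?thesis
    by simp
qed

lemma DERIV_LBINT:
  fixes \<phi> :: "real \<Rightarrow> real"
  assumes "continuous_on UNIV \<phi>"
  shows "((\<lambda>y. LBINT t=ereal 0..ereal y. \<phi> t) has_real_derivative \<phi> y) (at y)"
proof -
  have "((\<lambda>u. LBINT t=ereal 0..ereal u. \<phi> t) has_vector_derivative \<phi> y) (at y within {- \<bar>y\<bar> - 1..\<bar>y\<bar> + 1})"
    by (rule interval_integral_FTC2) (auto intro: continuous_on_subset[OF assms])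
  then show ?thesis
    by (subst (asm) at_within_interior) (auto simp: has_real_derivative_iff_has_vector_derivative)
qed

lemma DERIV_LBINT_param:
  fixes f :: "real^'n \<Rightarrow> real"
  assumes f: "C_class (Suc m) f" and p: "continuous_on UNIV p"
  shows "((\<lambda>r. LBINT t=ereal 0..ereal y. f (p t + r *\<^sub>R axis k 1)) has_real_derivative
    (LBINT t=ereal 0..ereal y. pd k f (p t))) (at 0)"
proof -
  have cf: "continuous_on UNIV f" and cpd: "continuous_on UNIV (pd k f)"
    using f C_class_continuous C_class_partial_deriv by blast+
  have cp: "continuous_on UNIV (\<lambda>t. p t + r *\<^sub>R axis k 1)" for r
    by (intro continuous_intros p)
  have 1: "(LBINT t=ereal 0..ereal y. f (p t + r *\<^sub>R axis k 1))
      = y * integral (cbox 0 1) (\<lambda>u. f (p (y * u) + r *\<^sub>R axis k 1))" for r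
    by (rule LBINT_eq_scaled_integral) (intro continuous_on_compose2[OF cf cp], simp)
  have 2: "(LBINT t=ereal 0..ereal y. pd k f (p t))
      = y * integral (cbox 0 1) (\<lambda>u. pd k f (p (y * u) + 0 *\<^sub>R axis k 1))"
    using LBINT_eq_scaled_integral[OF continuous_on_compose2[OF cpd p]] by simp
  show ?thesis
    unfolding 1 2
  proof (intro DERIV_cmult leibniz_rule_field_derivative[where U = UNIV])
    show "((\<lambda>r. f (p (y * u) + r *\<^sub>R axis k 1)) has_real_derivative
        pd k f (p (y * u) + r *\<^sub>R axis k 1)) (at r)" for r u
      by (rule DERIV_partial_deriv[OF f])
    show "(\<lambda>u. f (p (y * u) + r *\<^sub>R axis k 1)) integrable_on cbox 0 1" for r
      by (intro integrable_continuous continuous_on_compose2[OF cf] continuous_intros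
          continuous_on_compose2[OF p]) auto
    show "continuous_on (UNIV \<times> cbox 0 1) (\<lambda>(r, u). pd k f (p (y * u) + r *\<^sub>R axis k 1))"
      unfolding case_prod_unfold
      by (intro continuous_on_compose2[OF cpd] continuous_intros continuous_on_compose2[OF p]) auto
  qed auto
qed

lemma continuous_on_T0:
  fixes f :: "real^'n::{finite,wellorder} \<Rightarrow> real"
  assumes f: "continuous_on UNIV f"
  shows "continuous_on UNIV (T0 h f)"
proof -
  have "T0 h f = (\<lambda>x. (1 - psum h x) * integral (cbox 0 1) (\<lambda>u. f (upd (idx h) ((1 - psum h x) * u) x)))"
    unfolding T0_def
    by (intro ext LBINT_eq_scaled_integral continuous_on_compose2[OF f] continuous_intros) auto
  moreover have "continuous_on UNIV
      (\<lambda>x. (1 - psum h x) * integral (cbox 0 1) (\<lambda>u. f (upd (idx h) ((1 - psum h x) * u) x)))"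
    unfolding case_prod_unfold
    by (intro continuous_on_mult integral_continuous_on_param, unfold case_prod_unfold)
      (intro continuous_intros continuous_on_compose2[OF f]; simp)+
  ultimately show ?thesis
    by simp
qed

text \<open>Leibniz rule: differentiation under the integral gives \<open>T0\<close> of a
  derivative, and the moving upper limit gives minus the boundary value, which is
  \<open>T2 h f\<close>. The latter contains \<open>f\<close> undifferentiated; this is how the
  order of a derivative gets lost.\<close>

lemma DERIV_T0:
  fixes f :: "real^'n::{finite,wellorder} \<Rightarrow> real"
  assumes f: "C_class (Suc m) f" and h: "h < CARD('n)"
  shows "((\<lambda>r. T0 h f (x + r *\<^sub>R axis k 1)) has_real_derivative
    (if k = idx h then 0 else 1 * T0 h (pd k f) x + (- of_bool (k \<in> idx ` {..<h})) * T2 h f x)) (at 0)"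
proof (cases "k = idx h")
  case True
  have "k \<notin> idx ` {..<h}"
    using h True by (auto simp: idx_eq_iff)
  then have "T0 h f (x + r *\<^sub>R axis k 1) = T0 h f x" for r
    using h True by (simp add: T0_def upd_def psum_linear psum_axis algebra_simps)
  then show ?thesis
    using True by simp
next
  case False
  have cf: "continuous_on UNIV f"
    using f by (rule C_class_continuous)
  define \<sigma> :: real where "\<sigma> = of_bool (k \<in> idx ` {..<h})"
  define \<eta> where "\<eta> r = 1 - (psum h x + r * \<sigma>)" for r
  have eq: "T0 h f (x + r *\<^sub>R axis k 1) = (LBINT t=ereal 0..ereal (\<eta> r). f (upd (idx h) t x + r *\<^sub>R axis k 1))" for r
  proof -
    have "axis k 1 $ idx h = (0 :: real)"
      using False by (simp add: axis_def)
    then show ?thesis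
      using h by (simp add: T0_def upd_def psum_linear psum_axis \<eta>_def \<sigma>_def algebra_simps)
  qed
  have "((\<lambda>r. LBINT t=ereal 0..ereal (\<eta> r). f (upd (idx h) t x + r *\<^sub>R axis k 1)) has_real_derivative
      (LBINT t=ereal 0..ereal (\<eta> 0). pd k f (upd (idx h) t x))
        + f (upd (idx h) (\<eta> 0) x + 0 *\<^sub>R axis k 1) * - \<sigma>) (at 0)"
  proof (rule DERIV_along_curve[where \<eta> = \<eta> and H = "\<lambda>r y. LBINT t=ereal 0..ereal y. f (upd (idx h) t x + r *\<^sub>R axis k 1)"
        and Hy = "\<lambda>r y. f (upd (idx h) y x + r *\<^sub>R axis k 1)"])
    show "((\<lambda>r. LBINT t=ereal 0..ereal (\<eta> 0). f (upd (idx h) t x + r *\<^sub>R axis k 1)) has_real_derivative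
        (LBINT t=ereal 0..ereal (\<eta> 0). pd k f (upd (idx h) t x))) (at 0)"
      by (rule DERIV_LBINT_param[OF f]) (intro continuous_intros)
    show "((\<lambda>y. LBINT t=ereal 0..ereal y. f (upd (idx h) t x + r *\<^sub>R axis k 1)) has_real_derivative
        f (upd (idx h) y x + r *\<^sub>R axis k 1)) (at y)" for r y
      by (rule DERIV_LBINT) (intro continuous_on_compose2[OF cf] continuous_intros, simp)
    show "continuous_on UNIV (\<lambda>(r, y). f (upd (idx h) y x + r *\<^sub>R axis k 1))"
      unfolding case_prod_unfold by (intro continuous_on_compose2[OF cf] continuous_intros) auto
    show "(\<eta> has_real_derivative - \<sigma>) (at 0)"
      unfolding \<eta>_def by (auto intro!: derivative_eq_intros)
  qed
  then show ?thesis
    unfolding eq using False by (simp add: T0_def T2_def \<eta>_def \<sigma>_def mult.commute)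
qed

lemma partial_deriv_T0:
  fixes f :: "real^'n::{finite,wellorder} \<Rightarrow> real"
  assumes "C_class (Suc m) f" "h < CARD('n)" "k \<in> idx ` {..<h}"
  shows "pd k (T0 h f) = (\<lambda>x. T0 h (pd k f) x - T2 h f x)"
proof (rule partial_deriv_eqI)
  fix x
  have "k \<noteq> idx h"
    using assms by (auto simp: idx_eq_iff)
  then show "((\<lambda>t. T0 h f (x + t *\<^sub>R axis k 1)) has_real_derivative T0 h (pd k f) x - T2 h f x) (at 0)"
    using DERIV_T0[OF assms(1,2), of x k] assms(3) by simp
qed

lemma C_class_T0:
  fixes f :: "real^'n::{finite,wellorder} \<Rightarrow> real"
  assumes h: "h < CARD('n)"
  shows "C_class m f \<Longrightarrow> C_class m (T0 h f)"
proof (induction m arbitrary: f)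
  case 0
  then show ?case
    by (simp add: continuous_on_T0)
next
  case (Suc m)
  show ?case
  proof (rule C_class_SucI[OF _ DERIV_T0[OF Suc.prems h]])
    show "continuous_on UNIV (T0 h f)"
      using Suc.prems by (intro continuous_on_T0 C_class_continuous)
    show "C_class m (\<lambda>x. if k = idx h then 0
        else 1 * T0 h (pd k f) x + - of_bool (k \<in> idx ` {..<h}) * T2 h f x)" for k
    proof (cases "k = idx h")
      case False
      have "C_class m (\<lambda>x. 1 * T0 h (pd k f) x + - of_bool (k \<in> idx ` {..<h}) * T2 h f x)"
        by (intro C_class_linear Suc.IH C_class_T2 C_class_partial_deriv Suc.prems C_class_SucD)
      then show ?thesis
        using False by simp
    qed (simp add: C_class_const)
  qed
qed

section \<open>Bounds for derivatives\<close>

lemma idx_notin: "h < CARD('n) \<Longrightarrow> (idx h :: 'n::{finite,wellorder}) \<notin> idx ` {..<h}"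
  by (auto simp: idx_eq_iff)

definition face :: "nat \<Rightarrow> (real^'n::{finite,wellorder}) set" where
  "face h = {x \<in> std_simplex. \<forall>k. k \<notin> idx ` {..<h} \<longrightarrow> x $ k = 0}"

lemma sum_eq_psum:
  assumes "x \<in> face h" "h \<le> CARD('n)"
  shows "(\<Sum>k\<in>UNIV. x $ k) = psum h (x :: real^'n::{finite,wellorder})"
proof -
  have "(\<Sum>k\<in>UNIV. x $ k) = (\<Sum>k\<in>idx ` {..<h}. x $ k)"
    using assms by (intro sum.mono_neutral_right) (auto simp: face_def)
  also have "\<dots> = psum h x"
    unfolding psum_def using assms by (subst sum.reindex) (auto simp: inj_on_def idx_eq_iff)
  finally show ?thesis .
qed

lemma psum_face:
  assumes "x \<in> face h" "h \<le> CARD('n)"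
  shows "0 \<le> psum h (x :: real^'n::{finite,wellorder})" "psum h x \<le> 1"
  using assms sum_eq_psum[OF assms] by (auto simp: face_def std_simplex_def psum_def sum_nonneg)

lemma upd_in_face:
  assumes x: "x \<in> face h" and h: "h < CARD('n)" and t: "0 \<le> t" "t \<le> 1 - psum h x"
  shows "upd (idx h) t (x :: real^'n::{finite,wellorder}) \<in> face (Suc h)"
proof -
  have 0: "x $ idx h = 0"
    using x idx_notin[OF h] by (auto simp: face_def)
  have "(\<Sum>k\<in>UNIV. upd (idx h) t x $ k) = (\<Sum>k\<in>UNIV. x $ k) + t"
    by (simp add: upd_def 0 sum.distrib flip: sum_distrib_left) (simp add: axis_def)
  then show ?thesis
    using x t sum_eq_psum[OF x] h by (auto simp: face_def std_simplex_def upd_nth lessThan_Suc)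
qed

lemma face_Suc_D:
  assumes x: "x \<in> face (Suc h)" and h: "h < CARD('n)"
  shows "upd (idx h) 0 (x :: real^'n::{finite,wellorder}) \<in> face h" "0 \<le> x $ idx h" "x $ idx h \<le> 1 - psum h x"
proof -
  show nonneg: "0 \<le> x $ idx h"
    using x by (auto simp: face_def std_simplex_def)
  have "(\<Sum>k\<in>UNIV. x $ k) \<le> 1"
    using x by (auto simp: face_def std_simplex_def)
  moreover have "(\<Sum>k\<in>UNIV. x $ k) = psum (Suc h) x"
    using x h by (intro sum_eq_psum) auto
  ultimately show "x $ idx h \<le> 1 - psum h x"
    by (simp add: psum_def)
  have "(\<Sum>k\<in>UNIV. upd (idx h) 0 x $ k) \<le> (\<Sum>k\<in>UNIV. x $ k)"
    by (rule sum_mono) (use nonneg in \<open>simp add: upd_nth\<close>)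
  then show "upd (idx h) 0 x \<in> face h"
    using x by (auto simp: face_def std_simplex_def upd_nth lessThan_Suc intro: order_trans)
qed

lemma face_0: "face 0 = {0}"
  by (auto simp: face_def std_simplex_def vec_eq_iff)

lemma face_CARD: "face CARD('n) = (std_simplex :: (real^'n::{finite,wellorder}) set)"
  using bij_betw_idx[where 'n = 'n] by (auto simp: face_def bij_betw_def)

text \<open>Only derivatives of order exactly \<open>m\<close> along the face are bounded, with the
  later coordinates frozen at 0. Words make it possible to peel off the innermost derivative, as in
  \<open>deriv_bound_Suc_iff\<close>.\<close>

definition deriv_bound :: "nat \<Rightarrow> nat \<Rightarrow> real \<Rightarrow> (real^'n::{finite,wellorder} \<Rightarrow> real) \<Rightarrow> bool" where
  "deriv_bound h m K f \<longleftrightarrow> (\<forall>ws. set ws \<subseteq> idx ` {..<h} \<longrightarrow> length ws = m \<longrightarrow>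
     (\<forall>x\<in>face h. \<bar>fold pd ws f x\<bar> \<le> K))"

lemma deriv_bound_mono: "deriv_bound h m K f \<Longrightarrow> K \<le> K' \<Longrightarrow> deriv_bound h m K' f"
  by (force simp: deriv_bound_def)

lemma deriv_bound_Suc_iff:
  fixes f :: "real^'n::{finite,wellorder} \<Rightarrow> real"
  shows "deriv_bound h (Suc m) K f \<longleftrightarrow> (\<forall>k\<in>idx ` {..<h}. deriv_bound h m K (pd k f))"
  (is "?L \<longleftrightarrow> ?R")
proof
  assume L: ?L
  show ?R
    unfolding deriv_bound_def
  proof (intro ballI allI impI)
    fix k :: 'n and ws :: "'n list" and x assume "k \<in> idx ` {..<h}" "set ws \<subseteq> idx ` {..<h}" "length ws = m" "(x :: real^'n::_) \<in> face h"
    then show "\<bar>fold pd ws (pd k f) x\<bar> \<le> K"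
      using L unfolding deriv_bound_def by (elim allE[of _ "k # ws"]) auto
  qed
next
  assume R: ?R
  show ?L
    unfolding deriv_bound_def
  proof (intro ballI allI impI)
    fix ws :: "'n list" and x assume "set ws \<subseteq> idx ` {..<h}" "length ws = Suc m" "(x :: real^'n::_) \<in> face h"
    then show "\<bar>fold pd ws f x\<bar> \<le> K"
      using R unfolding deriv_bound_def by (cases ws) auto
  qed
qed

lemma deriv_bound_0: "deriv_bound h 0 K f \<longleftrightarrow> (\<forall>x\<in>face h. \<bar>f x\<bar> \<le> K)"
  by (auto simp: deriv_bound_def)

lemma deriv_bound_diff:
  fixes f g :: "real^'n::{finite,wellorder} \<Rightarrow> real"
  assumes "deriv_bound h m K f" "deriv_bound h m L g" "C_class m f" "C_class m g"
  shows "deriv_bound h m (K + L) (\<lambda>x. f x - g x)"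
  unfolding deriv_bound_def
proof (intro allI impI ballI)
  fix ws :: "'n list" and x assume *: "set ws \<subseteq> idx ` {..<h}" "length ws = m" "(x :: real^'n::_) \<in> face h"
  then have "\<bar>fold pd ws f x\<bar> \<le> K" "\<bar>fold pd ws g x\<bar> \<le> L"
    using assms by (auto simp: deriv_bound_def)
  then show "\<bar>fold pd ws (\<lambda>x. f x - g x) x\<bar> \<le> K + L"
    using fold_partial_deriv_diff[of ws f g] assms * by simp
qed

lemma deriv_bound_cmult:
  assumes "deriv_bound h m K f" "C_class m f"
  shows "deriv_bound h m (\<bar>a\<bar> * K) (\<lambda>x. a * f x)"
  using assms fold_partial_deriv_cmult[of _ f a] by (auto simp: deriv_bound_def abs_mult mult_left_mono)

lemma deriv_bound_funpow:
  assumes "deriv_bound h (j + m) K f" "k \<in> idx ` {..<h}"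
  shows "deriv_bound h m K ((pd k ^^ j) f)"
  using assms
proof (induction j arbitrary: f)
  case (Suc j)
  have "deriv_bound h (j + m) K (pd k f)"
    using Suc.prems unfolding add_Suc deriv_bound_Suc_iff by blast
  then show ?case
    using Suc by (simp add: funpow_Suc_right del: funpow.simps)
qed simp

lemma idx_in_Suc: "idx h \<in> idx ` {..<Suc h}" "k \<in> idx ` {..<h} \<Longrightarrow> k \<in> idx ` {..<Suc h}"
  by auto

text \<open>Restriction to a coordinate hyperplane commutes with the derivatives along it, so no
  power of two arises.\<close>

lemma deriv_bound_T1:
  fixes f :: "real^'n::{finite,wellorder} \<Rightarrow> real"
  assumes h: "h < CARD('n)"
  shows "C_class m f \<Longrightarrow> deriv_bound (Suc h) m K f \<Longrightarrow> deriv_bound h m K (T1 h f)"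
proof (induction m arbitrary: f)
  case 0
  then show ?case
    using upd_in_face[OF _ h, where t = 0] psum_face(2)[where 'n = 'n and h = h] h by (auto simp: deriv_bound_0 T1_def)
next
  case (Suc m)
  show ?case
    unfolding deriv_bound_Suc_iff
  proof
    fix k :: 'n assume k: "k \<in> idx ` {..<h}"
    then have "pd k (T1 h f) = T1 h (pd k f)"
      using partial_deriv_T1[OF Suc.prems(1), of k h] h by (auto simp: idx_eq_iff)
    moreover have "deriv_bound h m K (T1 h (pd k f))"
      using Suc k by (intro Suc.IH C_class_partial_deriv) (auto simp: deriv_bound_Suc_iff)
    ultimately show "deriv_bound h m K (pd k (T1 h f))"
      by simp
  qed
qed

text \<open>Each derivative of \<open>T2 h f\<close> is a difference of two derivatives of \<open>f\<close>: the source of the powers of two.\<close>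

lemma deriv_bound_T2:
  fixes f :: "real^'n::{finite,wellorder} \<Rightarrow> real"
  assumes h: "h < CARD('n)"
  shows "C_class m f \<Longrightarrow> deriv_bound (Suc h) m K f \<Longrightarrow> deriv_bound h m (2 ^ m * K) (T2 h f)"
proof (induction m arbitrary: f)
  case 0
  then show ?case
    using upd_in_face[OF _ h] psum_face(2)[where 'n = 'n and h = h] h by (auto simp: deriv_bound_0 T2_def)
next
  case (Suc m)
  show ?case
    unfolding deriv_bound_Suc_iff
  proof
    fix k :: 'n assume k: "k \<in> idx ` {..<h}"
    have bnd: "deriv_bound h m (2 ^ m * K) (T2 h (pd l f))" if "l \<in> idx ` {..<Suc h}" for l
      using Suc that by (intro Suc.IH C_class_partial_deriv) (auto simp: deriv_bound_Suc_iff)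
    have "deriv_bound h m (2 ^ m * K + 2 ^ m * K) (\<lambda>x. T2 h (pd k f) x - T2 h (pd (idx h) f) x)"
      using k by (intro deriv_bound_diff bnd idx_in_Suc C_class_T2 C_class_partial_deriv Suc.prems(1))
    then show "deriv_bound h m (2 ^ Suc m * K) (pd k (T2 h f))"
      using partial_deriv_T2[OF Suc.prems(1) h k] by (simp add: mult_ac)
  qed
qed

lemma T0_eq_integral:
  fixes f :: "real^'n::{finite,wellorder} \<Rightarrow> real"
  assumes f: "continuous_on UNIV f" and "psum h x \<le> 1"
  shows "T0 h f x = integral {0..1 - psum h x} (\<lambda>t. f (upd (idx h) t x))"
  unfolding T0_def using assms(2)
  by (intro interval_integral_eq_integral borel_integrable_atLeastAtMost'
      continuous_on_compose2[OF f] continuous_intros) auto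

lemma T0_bound:
  fixes f :: "real^'n::{finite,wellorder} \<Rightarrow> real"
  assumes f: "continuous_on UNIV f" and h: "h < CARD('n)" and K: "\<forall>x\<in>face (Suc h). \<bar>f x\<bar> \<le> K" and x: "x \<in> face h"
  shows "\<bar>T0 h f x\<bar> \<le> K"
proof -
  note p = psum_face[OF x less_imp_le[OF h]]
  have "norm (integral {0..1 - psum h x} (\<lambda>t. f (upd (idx h) t x))) \<le> K * (1 - psum h x - 0)"
    using p upd_in_face[OF x h] K
    by (intro integral_bound continuous_on_compose2[OF f] continuous_intros) auto
  also have "\<dots> \<le> K"
    using p K upd_in_face[OF x h, of 0] by (auto simp: mult_left_le abs_le_iff)
  finally show ?thesis
    using T0_eq_integral[OF f p(2)] by simp
qed

text \<open>A derivative passes under the integral or hits the moving limit. In the second case the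
  integral is replaced by a substitution with one derivative less, hence the bound of order
  \<open>m - 1\<close>; the doubling of \<open>T2\<close> then takes over. In the induction the two
  contributions are \<open>2 ^ m * K\<close> each.\<close>

lemma deriv_bound_T0:
  fixes f :: "real^'n::{finite,wellorder} \<Rightarrow> real"
  assumes h: "h < CARD('n)"
  shows "C_class m f \<Longrightarrow> deriv_bound (Suc h) m K f \<Longrightarrow> (m \<noteq> 0 \<Longrightarrow> deriv_bound (Suc h) (m - 1) K f) \<Longrightarrow>
    deriv_bound h m (2 ^ m * K) (T0 h f)"
proof (induction m arbitrary: f)
  case 0
  then show ?case
    using T0_bound[OF _ h] by (auto simp: deriv_bound_0)
next
  case (Suc m)
  show ?case
    unfolding deriv_bound_Suc_iff
  proof
    fix k :: 'n assume k: "k \<in> idx ` {..<h}"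
    have f: "C_class m f"
      using Suc.prems(1) by (rule C_class_SucD)
    have 1: "deriv_bound h m (2 ^ m * K) (T0 h (pd k f))"
    proof (rule Suc.IH)
      show "C_class m (pd k f)"
        using Suc.prems by (intro C_class_partial_deriv)
      show "deriv_bound (Suc h) m K (pd k f)"
        using Suc.prems(2) k by (auto simp: deriv_bound_Suc_iff)
      show "deriv_bound (Suc h) (m - 1) K (pd k f)" if "m \<noteq> 0"
        using Suc.prems(3) k that by (cases m) (auto simp: deriv_bound_Suc_iff)
    qed
    have "deriv_bound h m (2 ^ m * K) (T2 h f)"
      using Suc.prems f by (intro deriv_bound_T2[OF h]) auto
    with 1 have "deriv_bound h m (2 ^ m * K + 2 ^ m * K) (\<lambda>x. T0 h (pd k f) x - T2 h f x)"
      by (intro deriv_bound_diff C_class_T0[OF h] C_class_T2 C_class_partial_deriv Suc.prems(1) f)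
    then show "deriv_bound h m (2 ^ Suc m * K) (pd k (T0 h f))"
      using partial_deriv_T0[OF Suc.prems(1) h k] by (simp add: mult_ac)
  qed
qed

section \<open>One summation step as an operator, and its cost\<close>

definition T_step :: "nat \<Rightarrow> nat \<Rightarrow> nat \<Rightarrow> nat \<Rightarrow> (real^'n::{finite,wellorder} \<Rightarrow> real) \<Rightarrow> real^'n::_ \<Rightarrow> real" where
  "T_step h v i j f =
     (if i = 0 then (if v = 1 then T0 h f else (\<lambda>_. 0))
      else if v = 1 then (\<lambda>x. - T1 h ((pd (idx h) ^^ j) f) x)
      else T2 h ((pd (idx h) ^^ j) f))"

text \<open>The entries of \<open>V\<close>, \<open>I\<close> and \<open>J\<close> at one
  coordinate: \<open>i = 0\<close> forces \<open>j = 0\<close>, and \<open>m\<close> is the total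
  order still to be spent.\<close>

definition triples :: "nat \<Rightarrow> (nat \<times> nat \<times> nat) set" where
  "triples m = {1, 2} \<times> insert (0, 0) (Pair 1 ` {..m})"

lemma finite_triples: "finite (triples m)"
  by (simp add: triples_def)

lemma triples_cases:
  assumes "(v, i, j) \<in> triples m"
  obtains "v = 1" "i = 0" "j = 0" | "v = 2" "i = 0" "j = 0" | "v = 1" "i = 1" "j \<le> m" | "v = 2" "i = 1" "j \<le> m"
  using assms by (auto simp: triples_def)

lemma card_triples: "card (triples m) \<le> 2 * (m + 2)"
proof -
  have "card (triples m) = 2 * card (insert (0::nat, 0::nat) (Pair 1 ` {..m}))"
    unfolding triples_def card_cartesian_product by simp
  also have "card (insert (0::nat, 0::nat) (Pair 1 ` {..m})) \<le> Suc (card (Pair (1::nat) ` {..m}))"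
    by (rule card_insert_le_m1) auto
  also have "card (Pair (1::nat) ` {..m}) = Suc m"
    by (subst card_image) (auto simp: inj_on_def)
  finally show ?thesis
    by simp
qed

lemma sum_triples:
  "(\<Sum>(v, i, j)\<in>triples m. F v i j) = F 1 0 0 + F 2 0 0 + (\<Sum>j\<le>m. F 1 1 j + F 2 1 j)"
  for F :: "nat \<Rightarrow> nat \<Rightarrow> nat \<Rightarrow> real"
proof -
  have "(\<Sum>(v, i, j)\<in>triples m. F v i j) = (\<Sum>v\<in>{1, 2}. \<Sum>(i, j)\<in>insert (0, 0) (Pair 1 ` {..m}). F v i j)"
    unfolding triples_def by (subst sum.cartesian_product) (auto intro!: sum.cong)
  moreover have "(\<Sum>(i, j)\<in>insert (0, 0) (Pair 1 ` {..m}). F v i j) = F v 0 0 + (\<Sum>j\<le>m. F v 1 j)" for v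
    by (subst sum.insert) (auto simp: sum.reindex inj_on_def)
  ultimately show ?thesis
    by (simp add: sum.distrib)
qed

lemma C_class_funpow: "C_class (j + m) f \<Longrightarrow> C_class m ((pd k ^^ j) f)"
  by (induction j arbitrary: f) (simp_all add: funpow_Suc_right del: funpow.simps)

lemma C_class_T_step:
  fixes f :: "real^'n::{finite,wellorder} \<Rightarrow> real"
  assumes "C_class (j + m) f" "h < CARD('n)"
  shows "C_class m (T_step h v i j f)"
proof -
  have "C_class m f"
    using assms(1) by (rule C_class_mono) simp
  moreover have "C_class m (\<lambda>x. - T1 h ((pd (idx h) ^^ j) f) x)"
    using C_class_cmult[OF C_class_T1[OF C_class_funpow[OF assms(1)]], of "-1"] by simp
  ultimately show ?thesis
    using assms by (simp add: T_step_def C_class_T0 C_class_T2 C_class_funpow C_class_const)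
qed

text \<open>How the window of orders moves. The bounds for \<open>f\<close> start at order
  \<open>m + 1 - h\<close>, those for the image at \<open>m - j + 2 - h\<close>. An integration,
  where \<open>j = 0\<close>, uses orders \<open>n\<close> and \<open>n - 1\<close> and exactly
  exhausts the difference of one; the boundary operators use order \<open>n + j\<close> and stay
  inside.\<close>

lemma deriv_bound_T_step:
  fixes f :: "real^'n::{finite,wellorder} \<Rightarrow> real"
  assumes f: "C_class (Suc m) f" and h: "h < CARD('n)" and vij: "(v, i, j) \<in> triples m"
    and K: "\<And>n. m + 2 \<le> n + Suc h \<Longrightarrow> n \<le> Suc m \<Longrightarrow> deriv_bound (Suc h) n K f" and K0: "K \<ge> 0"
    and n: "m - j + 2 \<le> n + h" "n \<le> Suc (m - j)"
  shows "deriv_bound h n (2 ^ n * K) (T_step h v i j f)"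
  using vij
proof (cases rule: triples_cases)
  case 1
  have "C_class n f"
    using f by (rule C_class_mono) (use n 1 in auto)
  then show ?thesis
    using 1 n by (simp add: T_step_def) (intro deriv_bound_T0 h K; simp)
next
  case 2
  have "fold pd ws (\<lambda>x. 0 * 0 :: real) = (\<lambda>x. 0 * fold pd ws (\<lambda>x. 0) x)" for ws :: "'n list"
    by (rule fold_partial_deriv_cmult) (rule C_class_const)
  then show ?thesis
    using 2 K0 by (simp add: T_step_def deriv_bound_def)
next
  case 3
  have C: "C_class n ((pd (idx h) ^^ j) f)"
    by (rule C_class_funpow, rule C_class_mono[OF f]) (use n 3 in auto)
  have "deriv_bound (Suc h) n K ((pd (idx h) ^^ j) f)"
    by (intro deriv_bound_funpow K idx_in_Suc) (use n 3 in auto)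
  then have "deriv_bound h n (\<bar>- 1\<bar> * K) (\<lambda>x. - 1 * T1 h ((pd (idx h) ^^ j) f) x)"
    by (intro deriv_bound_cmult deriv_bound_T1 C_class_T1 h C)
  then have "deriv_bound h n K (T_step h v i j f)"
    using 3 by (simp add: T_step_def)
  moreover have "K \<le> 2 ^ n * K"
    using mult_right_mono[of 1 "2 ^ n" K] K0 by simp
  ultimately show ?thesis
    by (rule deriv_bound_mono)
next
  case 4
  have C: "C_class n ((pd (idx h) ^^ j) f)"
    by (rule C_class_funpow, rule C_class_mono[OF f]) (use n 4 in auto)
  have "deriv_bound (Suc h) n K ((pd (idx h) ^^ j) f)"
    by (intro deriv_bound_funpow K idx_in_Suc) (use n 4 in auto)
  then show ?thesis
    using 4 by (simp add: T_step_def deriv_bound_T2[OF h C])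
qed

section \<open>The expansion of a lattice sum over the simplex\<close>

definition steps :: "nat \<Rightarrow> real^'n::{finite,wellorder} \<Rightarrow> real \<Rightarrow> real^'n::_ \<Rightarrow> real set" where
  "steps h \<xi> \<tau> z = grid \<tau> (\<xi> $ idx h) (1 - psum h z)"

definition face_points :: "nat \<Rightarrow> real^'n::{finite,wellorder} \<Rightarrow> real \<Rightarrow> (real^'n::_) set" where
  "face_points h \<xi> \<tau> = {x \<in> face h. \<forall>i<h. \<tau> * x $ idx i - \<xi> $ idx i \<in> \<int>}"

text \<open>The shift that a Bernoulli function sees at the two ends of the summation over
  coordinate \<open>h\<close>: the coordinate of \<open>\<xi>\<close> itself at the end 0 and,
  modulo integers, the partial sum including it at the sloping end.\<close>

definition bern_arg :: "nat \<Rightarrow> nat \<Rightarrow> real^'n::{finite,wellorder} \<Rightarrow> real" where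
  "bern_arg h v \<xi> = (if v = 1 then \<xi> $ idx h else psum (Suc h) \<xi>)"

definition generic :: "real^'n::{finite,wellorder} \<Rightarrow> bool" where
  "generic \<xi> \<longleftrightarrow> (\<forall>h<CARD('n). \<forall>v. bern_arg h v \<xi> \<notin> \<int>)"

definition term_op :: "real^'n::{finite,wellorder} \<Rightarrow> real \<Rightarrow> nat \<Rightarrow> nat \<times> nat \<times> nat \<Rightarrow> (real^'n::_ \<Rightarrow> real) \<Rightarrow> real^'n::_ \<Rightarrow> real" where
  "term_op \<xi> \<tau> h = (\<lambda>(v, i, j) f x. (\<tau> powi (1 - int i - int j) * bern_per (j + i) (bern_arg h v \<xi>)) * T_step h v i j f x)"

text \<open>The budget \<open>m\<close> is lowered by the order spent on each coordinate, so the
  nested sums together run over total orders up to the initial \<open>m\<close>.\<close>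

primrec expansion :: "real^'n::{finite,wellorder} \<Rightarrow> real \<Rightarrow> nat \<Rightarrow> nat \<Rightarrow> (real^'n::_ \<Rightarrow> real) \<Rightarrow> real" where
  "expansion \<xi> \<tau> 0 m f = f 0"
| "expansion \<xi> \<tau> (Suc h) m f = (\<Sum>l\<in>triples m. expansion \<xi> \<tau> h (m - snd (snd l)) (term_op \<xi> \<tau> h l f))"

lemma finite_steps: "\<tau> > 0 \<Longrightarrow> finite (steps h \<xi> \<tau> z)"
  unfolding steps_def by (rule finite_grid)

lemma face_points_0: "face_points 0 \<xi> \<tau> = {0}"
  by (auto simp: face_points_def face_0)

text \<open>A point of the larger face is cut into its projection and its last coordinate; the
  latter ranges over a one-dimensional grid whose length depends on the projection.\<close>

lemma bij_betw_face_points: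
  fixes \<xi> :: "real^'n::{finite,wellorder}"
  assumes h: "h < CARD('n)"
  shows "bij_betw (\<lambda>(z, t). upd (idx h) t z) (Sigma (face_points h \<xi> \<tau>) (steps h \<xi> \<tau>)) (face_points (Suc h) \<xi> \<tau>)"
proof (rule bij_betw_byWitness[where f' = "\<lambda>x. (upd (idx h) 0 x, x $ idx h)"])
  have idx0: "idx i = (idx h :: 'n) \<longleftrightarrow> i = h" if "i \<le> h" for i
    using h that by (simp add: idx_eq_iff)
  have z0: "z $ idx h = 0" if "z \<in> face_points h \<xi> \<tau>" for z
    using that idx_notin[OF h] by (auto simp: face_points_def face_def)
  have upd_0: "upd (idx h) 0 z = z" if "z $ idx h = 0" for z :: "real^'n::_"
    using that by (auto simp: vec_eq_iff upd_nth)
  have upd_upd: "upd (idx h) s (upd (idx h) t z) = upd (idx h) s z" for s t and z :: "real^'n::_"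
    by (auto simp: vec_eq_iff upd_nth)
  show "\<forall>a\<in>Sigma (face_points h \<xi> \<tau>) (steps h \<xi> \<tau>).
      (upd (idx h) 0 (case a of (z, t) \<Rightarrow> upd (idx h) t z), (case a of (z, t) \<Rightarrow> upd (idx h) t z) $ idx h) = a"
    by (auto simp: upd_upd upd_nth intro!: upd_0 z0)
  show "\<forall>x\<in>face_points (Suc h) \<xi> \<tau>. (case (upd (idx h) 0 x, x $ idx h) of (z, t) \<Rightarrow> upd (idx h) t z) = x"
    by (auto simp: vec_eq_iff upd_nth)
  show "(\<lambda>(z, t). upd (idx h) t z) ` Sigma (face_points h \<xi> \<tau>) (steps h \<xi> \<tau>) \<subseteq> face_points (Suc h) \<xi> \<tau>"
  proof clarify
    fix z t assume z: "z \<in> face_points h \<xi> \<tau>" and t: "t \<in> steps h \<xi> \<tau> z"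
    then show "upd (idx h) t z \<in> face_points (Suc h) \<xi> \<tau>"
      using upd_in_face[OF _ h, of z t] idx0
      by (auto simp: face_points_def steps_def grid_def upd_nth less_Suc_eq)
  qed
  show "(\<lambda>x. (upd (idx h) 0 x, x $ idx h)) ` face_points (Suc h) \<xi> \<tau> \<subseteq> Sigma (face_points h \<xi> \<tau>) (steps h \<xi> \<tau>)"
  proof clarify
    fix x assume x: "x \<in> face_points (Suc h) \<xi> \<tau>"
    then show "upd (idx h) 0 x \<in> face_points h \<xi> \<tau> \<and> x $ idx h \<in> steps h \<xi> \<tau> (upd (idx h) 0 x)"
      using face_Suc_D[OF _ h, of x] idx0 h
      by (auto simp: face_points_def steps_def grid_def upd_nth psum_upd)
  qed
qed

lemma
  fixes \<xi> :: "real^'n::{finite,wellorder}" and f :: "real^'n::_ \<Rightarrow> real"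
  assumes "\<tau> > 0"
  shows finite_face_points: "h \<le> CARD('n) \<Longrightarrow> finite (face_points h \<xi> \<tau>)"
    and sum_face_points: "h < CARD('n) \<Longrightarrow>
      (\<Sum>x\<in>face_points (Suc h) \<xi> \<tau>. f x) = (\<Sum>z\<in>face_points h \<xi> \<tau>. \<Sum>t\<in>steps h \<xi> \<tau> z. f (upd (idx h) t z))"
    and card_face_points: "h \<le> CARD('n) \<Longrightarrow> real (card (face_points h \<xi> \<tau>)) \<le> (\<tau> + 1) ^ h"
proof -
  show fin: "finite (face_points h \<xi> \<tau>)" if "h \<le> CARD('n)" for h
    using that
  proof (induction h)
    case (Suc h)
    then have "finite (Sigma (face_points h \<xi> \<tau>) (steps h \<xi> \<tau>))"
      using finite_steps[OF assms] by (intro finite_SigmaI) auto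
    then show ?case
      using bij_betw_finite[OF bij_betw_face_points[of h \<xi> \<tau>]] Suc.prems by auto
  qed (simp add: face_points_0)
  show sum: "(\<Sum>x\<in>face_points (Suc h) \<xi> \<tau>. f x) = (\<Sum>z\<in>face_points h \<xi> \<tau>. \<Sum>t\<in>steps h \<xi> \<tau> z. f (upd (idx h) t z))"
    if "h < CARD('n)" for h and f :: "real^'n::_ \<Rightarrow> real"
    using that fin[of h] finite_steps[OF assms]
    by (subst sum.reindex_bij_betw[OF bij_betw_face_points[OF that], symmetric], subst sum.Sigma)
      (auto simp: case_prod_unfold)
  show "real (card (face_points h \<xi> \<tau>)) \<le> (\<tau> + 1) ^ h" if "h \<le> CARD('n)"
    using that
  proof (induction h)
    case (Suc h)
    have "real (card (face_points (Suc h) \<xi> \<tau>)) = (\<Sum>z\<in>face_points h \<xi> \<tau>. real (card (steps h \<xi> \<tau> z)))"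
      using sum[of h "\<lambda>_. 1"] Suc.prems by simp
    also have "\<dots> \<le> (\<Sum>z\<in>face_points h \<xi> \<tau>. \<tau> + 1)"
    proof (rule sum_mono)
      fix z assume "z \<in> face_points h \<xi> \<tau>"
      then have "0 \<le> psum h z" "psum h z \<le> 1"
        using psum_face[of z h] Suc.prems by (auto simp: face_points_def)
      then have "real (card (steps h \<xi> \<tau> z)) \<le> \<tau> * (1 - psum h z) + 1"
        unfolding steps_def using card_grid_le[OF assms, of "1 - psum h z" "\<xi> $ idx h"] by simp
      also have "\<dots> \<le> \<tau> + 1"
        using assms \<open>0 \<le> psum h z\<close> by (simp add: algebra_simps)
      finally show "real (card (steps h \<xi> \<tau> z)) \<le> \<tau> + 1" .
    qed
    also have "\<dots> = real (card (face_points h \<xi> \<tau>)) * (\<tau> + 1)"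
      by simp
    also have "\<dots> \<le> (\<tau> + 1) ^ h * (\<tau> + 1)"
      using Suc assms by (intro mult_right_mono) auto
    finally show ?case
      by (simp add: mult.commute)
  qed (simp add: face_points_0)
qed

lemma bern_per_int_shift: "m \<in> \<int> \<Longrightarrow> bern_per n (x + m) = bern_per n x"
  by (simp add: bern_per_def frac_add_int_right)

text \<open>
  On a lattice point \<open>z\<close> of a face the upper limit of summation, scaled by the integer \<open>\<tau>\<close>, is
  congruent to a number that does not depend on \<open>z\<close>; this is what decouples the coordinates.
\<close>

lemma one_step:
  fixes f :: "real^'n::{finite,wellorder} \<Rightarrow> real"
  assumes f: "C_class (Suc m) f" and h: "h < CARD('n)" and gen: "generic \<xi>"
    and \<tau>: "\<tau> > 0" "\<tau> \<in> \<int>" and z: "z \<in> face_points h \<xi> \<tau>"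
    and K: "deriv_bound (Suc h) (Suc m) K f" and B: "\<And>x. \<bar>bern_per (Suc m) x\<bar> \<le> B"
  shows "\<bar>(\<Sum>t\<in>steps h \<xi> \<tau> z. f (upd (idx h) t z)) - (\<Sum>l\<in>triples m. term_op \<xi> \<tau> h l f z)\<bar> \<le> K * B / \<tau> ^ m"
proof -
  have zf: "z \<in> face h"
    using z by (simp add: face_points_def)
  note p = psum_face[OF zf less_imp_le[OF h]]
  define b where "b = 1 - psum h z"
  have b: "0 \<le> b" "b \<le> 1"
    using p by (simp_all add: b_def)
  define F where "F j t = (pd (idx h) ^^ j) f (upd (idx h) t z)" for j t
  have F: "(F j has_real_derivative F (Suc j) t) (at t)" if "j \<le> m" for j t
  proof -
    have "C_class (Suc (m - j)) ((pd (idx h) ^^ j) f)"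
      using that f by (intro C_class_funpow) (simp del: C_class.simps)
    from DERIV_partial_deriv[OF this, of "upd (idx h) 0 z" "idx h" t]
    show ?thesis
      by (simp add: F_def[abs_def] upd_def algebra_simps)
  qed
  have psum_int: "psum h \<xi> - \<tau> * psum h z \<in> \<int>"
  proof -
    have "\<tau> * psum h z - psum h \<xi> = (\<Sum>i<h. \<tau> * z $ idx i - \<xi> $ idx i)"
      by (simp add: psum_def sum_subtractf sum_distrib_left)
    also have "\<dots> \<in> \<int>"
      using z by (intro Ints_sum) (auto simp: face_points_def)
    finally show ?thesis
      using Ints_minus by fastforce
  qed
  have shift: "\<xi> $ idx h - \<tau> * b = psum (Suc h) \<xi> + - (\<tau> + (psum h \<xi> - \<tau> * psum h z))"
    by (simp add: b_def psum_def algebra_simps)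
  have int: "- (\<tau> + (psum h \<xi> - \<tau> * psum h z)) \<in> \<int>"
    using psum_int \<tau> by (intro Ints_minus Ints_add)
  have gen1: "\<xi> $ idx h \<notin> \<int>" and gen2: "psum (Suc h) \<xi> \<notin> \<int>"
    using gen h unfolding generic_def bern_arg_def by (metis, metis one_neq_zero)
  have gen3: "\<xi> $ idx h - \<tau> * b \<notin> \<int>"
    unfolding shift using gen2 int by (metis Ints_diff add_diff_cancel_right')
  have bern: "bern_per n (\<xi> $ idx h - \<tau> * b) = bern_per n (psum (Suc h) \<xi>)" for n
    unfolding shift by (rule bern_per_int_shift[OF int])
  have K': "\<bar>F (Suc m) t\<bar> \<le> K" if "t \<in> {0..b}" for t
  proof -
    have "upd (idx h) t z \<in> face (Suc h)"
      using that by (intro upd_in_face[OF zf h]) (auto simp: b_def)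
    moreover have "deriv_bound (Suc h) 0 K ((pd (idx h) ^^ Suc m) f)"
      using K by (intro deriv_bound_funpow idx_in_Suc) simp
    ultimately show ?thesis
      by (simp add: deriv_bound_0 F_def del: funpow.simps)
  qed
  have "C_class 0 f"
    using f by (rule C_class_mono) simp
  then have T0: "T0 h f z = integral {0..b} (F 0)"
    unfolding b_def F_def using p by (simp add: T0_eq_integral)
  \<comment> \<open>The index \<open>(1, 0, 0)\<close> has weight \<open>\<tau>\<close> because
    \<open>bern_poly 0\<close> is 1, and \<open>(2, 0, 0)\<close> contributes 0; the others form the
    two boundary series.\<close>
  have "(\<Sum>l\<in>triples m. term_op \<xi> \<tau> h l f z) =
      \<tau> * T0 h f z + (\<Sum>j\<le>m. \<tau> powi (- int j) * bern_per (Suc j) (\<xi> $ idx h) * - F j 0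
        + \<tau> powi (- int j) * bern_per (Suc j) (psum (Suc h) \<xi>) * F j b)"
    unfolding term_op_def case_prod_unfold[symmetric]
    using sum_triples[where m = m and F = "\<lambda>v i j. (\<tau> powi (1 - int i - int j) * bern_per (j + i) (bern_arg h v \<xi>)) * T_step h v i j f z"]
    by (simp add: case_prod_unfold T_step_def bern_arg_def bern_per_def[of 0] T1_def T2_def F_def b_def del: funpow.simps)
  also have "\<dots> = \<tau> * integral {0..b} (F 0)
      + (\<Sum>j\<le>m. (F j b * bern_per (Suc j) (\<xi> $ idx h - \<tau> * b) - F j 0 * bern_per (Suc j) (\<xi> $ idx h)) / \<tau> ^ j)"
    unfolding T0 bern by (intro arg_cong2[where f = "(+)"] sum.cong refl)
      (simp add: power_int_minus divide_inverse algebra_simps)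
  finally have "\<bar>(\<Sum>t\<in>steps h \<xi> \<tau> z. f (upd (idx h) t z)) - (\<Sum>l\<in>triples m. term_op \<xi> \<tau> h l f z)\<bar> \<le> b * (K * B) / \<tau> ^ m"
    using euler_maclaurin_bound[of m F \<tau> b "\<xi> $ idx h" K B, OF F \<tau>(1) b(1) gen1 gen3 K' B]
    by (simp add: steps_def b_def F_def algebra_simps)
  also have "\<dots> \<le> K * B / \<tau> ^ m"
  proof -
    have "0 \<le> K" "0 \<le> B"
      using K'[of 0] b B[of 0] by auto
    then show ?thesis
      using b \<tau> by (intro divide_right_mono) (auto simp: mult_left_le_one_le)
  qed
  finally show ?thesis .
qed

text \<open>The error has two sources: the one-dimensional remainder, incurred at each of the at
  most \<open>(\<tau> + 1) ^ h\<close> base points, and the errors of the lower-dimensional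
  expansions of the functions \<open>term_op\<close>. For the latter the derivative bounds grow by
  up to \<open>2 ^ Suc (m - j)\<close>, and \<open>Suc (m - j)\<close> is also the exponent of the
  rate, so the rate doubles with each dimension. The second bound in \<open>B\<close> covers the
  Bernoulli index \<open>j + 1\<close> of the boundary terms.\<close>

theorem expansion_error:
  fixes f :: "real^'n::{finite,wellorder} \<Rightarrow> real"
  assumes gen: "generic \<xi>" and \<tau>: "\<tau> \<ge> 1" "\<tau> \<in> \<int>"
    and C: "C \<ge> 1" and r: "r > 0"
    and B: "\<And>j x. \<bar>bern_per j x\<bar> \<le> C * r ^ j" "\<And>j x. \<bar>bern_per (Suc j) x\<bar> \<le> C * r ^ j"
  shows "h \<le> CARD('n) \<Longrightarrow> C_class (Suc m) f \<Longrightarrow> K \<ge> 0 \<Longrightarrow>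
    (\<And>n. m + 2 \<le> n + h \<Longrightarrow> n \<le> Suc m \<Longrightarrow> deriv_bound h n K f) \<Longrightarrow>
    \<bar>(\<Sum>x\<in>face_points h \<xi> \<tau>. f x) - expansion \<xi> \<tau> h m f\<bar>
      \<le> (4 * C * (m + 2)) ^ h * \<tau> powi (int h - int m - 1) * (2 ^ h * r / 2) ^ Suc m * K"
proof (induction h arbitrary: m f K)
  case 0
  then show ?case
    using \<tau> C r by (simp add: face_points_0)
next
  case (Suc h)
  have h: "h < CARD('n)"
    using Suc.prems by simp
  have \<tau>0: "\<tau> > 0"
    using \<tau> by simp
  define X where "X = 4 * C * (real m + 2)"
  define \<rho> where "\<rho> = 2 ^ h * r"
  have \<rho>: "r \<le> \<rho>" "0 < \<rho>"
    using r by (simp_all add: \<rho>_def)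
  have "1 * 2 \<le> C * (real m + 2)"
    using C by (intro mult_mono) auto
  then have X: "X \<ge> 1" "X \<ge> 2"
    by (auto simp: X_def)
  \<comment> \<open>Common size of both kinds of error, up to the factor \<open>X ^ h * C\<close>;
    \<open>int h - int m\<close> is the exponent that belongs to dimension
    \<open>Suc h\<close>.\<close>
  define E where "E = \<tau> powi (int h - int m) * \<rho> ^ Suc m * K"
  have E0: "E \<ge> 0"
    unfolding E_def using \<tau>0 \<rho> Suc.prems by simp
  let ?S = "\<lambda>z. \<Sum>t\<in>steps h \<xi> \<tau> z. f (upd (idx h) t z)"
  let ?Q = "\<lambda>z. \<Sum>l\<in>triples m. term_op \<xi> \<tau> h l f z"
  have "\<bar>\<Sum>z\<in>face_points h \<xi> \<tau>. ?S z - ?Q z\<bar> \<le> (\<Sum>z\<in>face_points h \<xi> \<tau>. K * (C * r ^ Suc m) / \<tau> ^ m)"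
    using one_step[OF Suc.prems(2) h gen \<tau>0 \<tau>(2) _ Suc.prems(4) B(1)]
    by (intro order_trans[OF sum_abs] sum_mono) simp
  also have "\<dots> \<le> (\<tau> + 1) ^ h * (K * (C * r ^ Suc m) / \<tau> ^ m)"
    unfolding sum_constant using h C r \<tau>0 Suc.prems(3) by (intro mult_right_mono card_face_points) auto
  also have "\<dots> \<le> (2 * \<tau>) ^ h * (K * (C * \<rho> ^ Suc m) / \<tau> ^ m)"
    using \<tau> C r \<rho> Suc.prems by (intro mult_mono power_mono divide_right_mono mult_left_mono) auto
  also have "\<dots> = 2 ^ h * (C * E)"
    using \<tau>0 by (simp add: E_def power_mult_distrib power_int_diff)
  also have "\<dots> \<le> X ^ h * (C * E)"
    using X C E0 by (intro mult_right_mono power_mono) auto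
  finally have 1: "\<bar>\<Sum>z\<in>face_points h \<xi> \<tau>. ?S z - ?Q z\<bar> \<le> X ^ h * (C * E)" .
  have 2: "\<bar>(\<Sum>z\<in>face_points h \<xi> \<tau>. term_op \<xi> \<tau> h l f z) - expansion \<xi> \<tau> h (m - snd (snd l)) (term_op \<xi> \<tau> h l f)\<bar>
      \<le> X ^ h * (C * E)" if l: "l \<in> triples m" for l
  proof -
    obtain v i j where vij: "l = (v, i, j)"
      by (cases l)
    have ij: "i \<le> 1" "j \<le> m" "i = 0 \<Longrightarrow> j = 0"
      using l by (auto simp: vij triples_def)
    define a where "a = \<tau> powi (1 - int i - int j) * bern_per (j + i) (bern_arg h v \<xi>)"
    \<comment> \<open>Bound for the coefficient times the doubling for \<open>Suc (m - j)\<close>,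
      the highest order of the smaller window.\<close>
    define K' where "K' = \<tau> powi (1 - int i - int j) * (C * r ^ j) * (2 ^ Suc (m - j) * K)"
    have K'0: "K' \<ge> 0"
      unfolding K'_def using \<tau>0 C r Suc.prems by simp
    have "\<bar>bern_per (j + i) x\<bar> \<le> C * r ^ j" for x
      using B(1)[of j x] B(2)[of j x] ij(1) by (cases i) auto
    then have a: "\<bar>a\<bar> \<le> \<tau> powi (1 - int i - int j) * (C * r ^ j)"
      unfolding a_def using \<tau>0 by (simp add: abs_mult mult_left_mono)
    have op: "term_op \<xi> \<tau> h l f = (\<lambda>x. a * T_step h v i j f x)"
      by (simp add: term_op_def vij a_def)
    have smooth: "C_class (Suc (m - j)) (T_step h v i j f)"
      using Suc.prems(2) ij h by (intro C_class_T_step) (simp_all del: C_class.simps)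
    have bnd: "deriv_bound h n K' (\<lambda>x. a * T_step h v i j f x)" if n: "m - j + 2 \<le> n + h" "n \<le> Suc (m - j)" for n
    proof (rule deriv_bound_mono)
      have "deriv_bound h n (2 ^ n * K) (T_step h v i j f)"
        using l Suc.prems n by (intro deriv_bound_T_step[OF Suc.prems(2) h, of v i j]) (simp_all add: vij)
      then show "deriv_bound h n (\<bar>a\<bar> * (2 ^ n * K)) (\<lambda>x. a * T_step h v i j f x)"
        by (rule deriv_bound_cmult) (rule C_class_mono[OF smooth n(2)])
      show "\<bar>a\<bar> * (2 ^ n * K) \<le> K'"
        unfolding K'_def using a n \<tau>0 C r Suc.prems
        by (intro mult_mono[OF a] mult_right_mono power_increasing) auto
    qed
    have "\<bar>(\<Sum>z\<in>face_points h \<xi> \<tau>. a * T_step h v i j f z) - expansion \<xi> \<tau> h (m - j) (\<lambda>x. a * T_step h v i j f x)\<bar>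
      \<le> (4 * C * real (m - j + 2)) ^ h * \<tau> powi (int h - int (m - j) - 1) * (2 ^ h * r / 2) ^ Suc (m - j) * K'"
      using h bnd K'0 by (intro Suc.IH C_class_cmult smooth) auto
    also have "\<dots> \<le> X ^ h * \<tau> powi (int h - int (m - j) - 1) * (2 ^ h * r / 2) ^ Suc (m - j) * K'"
      unfolding X_def using C r \<tau>0 K'0 ij by (intro mult_right_mono power_mono mult_left_mono) auto
    also have "\<dots> = X ^ h * (C * (\<tau> powi (int h - int m - int i) * (r ^ j * \<rho> ^ Suc (m - j)) * K))"
    proof -
      have e1: "\<tau> powi (int h - int (m - j) - 1) * \<tau> powi (1 - int i - int j) = \<tau> powi (int h - int m - int i)"
        using \<tau>0 ij by (subst power_int_add[symmetric]) (auto simp: of_nat_diff algebra_simps)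
      have e2: "(2 ^ h * r / 2) ^ Suc (m - j) * 2 ^ Suc (m - j) = \<rho> ^ Suc (m - j)"
        unfolding \<rho>_def by (subst power_mult_distrib[symmetric]) simp
      show ?thesis
        unfolding K'_def e1[symmetric] e2[symmetric] by (simp only: mult_ac)
    qed
    \<comment> \<open>A boundary operator has \<open>i = 1\<close> and gains a factor
      \<open>1 / \<tau>\<close>, which is given away; \<open>r\<close> is at most
      \<open>\<rho>\<close>.\<close>
    also have "\<dots> \<le> X ^ h * (C * (\<tau> powi (int h - int m) * (\<rho> ^ j * \<rho> ^ Suc (m - j)) * K))"
      using X C r \<rho> \<tau> Suc.prems
      by (intro mult_left_mono mult_mono power_mono power_int_increasing) auto
    also have "\<rho> ^ j * \<rho> ^ Suc (m - j) = \<rho> ^ Suc m"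
      using ij by (subst power_add[symmetric]) simp
    finally show ?thesis
      using op by (simp add: vij E_def)
  qed
  have "\<bar>(\<Sum>x\<in>face_points (Suc h) \<xi> \<tau>. f x) - expansion \<xi> \<tau> (Suc h) m f\<bar>
      = \<bar>(\<Sum>z\<in>face_points h \<xi> \<tau>. ?S z - ?Q z) + (\<Sum>l\<in>triples m.
        (\<Sum>z\<in>face_points h \<xi> \<tau>. term_op \<xi> \<tau> h l f z) - expansion \<xi> \<tau> h (m - snd (snd l)) (term_op \<xi> \<tau> h l f))\<bar>"
    using sum.swap[of "\<lambda>z l. term_op \<xi> \<tau> h l f z" "triples m" "face_points h \<xi> \<tau>"]
    by (simp add: sum_face_points[OF \<tau>0 h] sum_subtractf)
  also have "\<dots> \<le> X ^ h * (C * E) + (\<Sum>l\<in>triples m. X ^ h * (C * E))"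
    by (intro order_trans[OF abs_triangle_ineq] add_mono 1 order_trans[OF sum_abs] sum_mono 2)
  also have "\<dots> = (1 + real (card (triples m))) * (X ^ h * (C * E))"
    by (simp add: algebra_simps)
  \<comment> \<open>There are at most \<open>2 * (m + 2)\<close> inherited errors and one new
    error.\<close>
  also have "\<dots> \<le> (4 * (real m + 2)) * (X ^ h * (C * E))"
  proof (rule mult_right_mono)
    have "real (card (triples m)) \<le> real (2 * (m + 2))"
      using card_triples[of m] by (simp only: of_nat_le_iff)
    then show "1 + real (card (triples m)) \<le> 4 * (real m + 2)"
      by simp
  qed (use X C E0 in auto)
  also have "\<dots> = X ^ Suc h * E"
    by (simp add: X_def)
  finally show ?case
    by (simp add: X_def E_def \<rho>_def algebra_simps)
qed

section \<open>The explicit form of the expansion\<close>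

lemma deriv_shift: "deriv f (z + y) = deriv (\<lambda>s. f (s + y)) z"
  for f :: "real \<Rightarrow> real"
  unfolding deriv_def by (simp only: DERIV_shift)

lemma funpow_deriv_upd:
  "(deriv ^^ j) (\<lambda>t. f (upd k t x)) = (\<lambda>t. (pd k ^^ j) f (upd k t x))"
proof (induction j)
  case (Suc j)
  have "deriv (\<lambda>t. g (upd k t x)) t = pd k g (upd k t x)" for g t
    unfolding partial_deriv_def
    using deriv_shift[of "\<lambda>t. g (upd k t x)" 0 t] by (simp add: upd_def algebra_simps)
  then show ?case
    using Suc by simp
qed simp

text \<open>Besides linking the list and vector formulations, the relation forces \<open>f\<close>
  to depend on the first \<open>h\<close> coordinates only.\<close>

definition agree :: "nat \<Rightarrow> (real list \<Rightarrow> real) \<Rightarrow> (real^'n::{finite,wellorder} \<Rightarrow> real) \<Rightarrow> bool" where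
  "agree h F f \<longleftrightarrow> (\<forall>x. F (map (\<lambda>i. x $ idx i) [0..<h]) = f x)"

lemma agree_T_op:
  fixes f :: "real^'n::{finite,wellorder} \<Rightarrow> real"
  assumes "agree (Suc h) F f" "h < CARD('n)"
  shows "agree h (T_op v i j F) (T_step h v i j f)"
  unfolding agree_def
proof
  fix x :: "real^'n::_"
  let ?xs = "map (\<lambda>i. x $ idx i) [0..<h]"
  have "map (\<lambda>i. x $ idx i) [0..<h] @ [t] = map (\<lambda>i. upd (idx h) t x $ idx i) [0..<Suc h]" for t
    using assms(2) by (auto simp: upd_nth idx_eq_iff)
  then have F: "F (?xs @ [t]) = f (upd (idx h) t x)" for t
    using assms(1) by (simp only: agree_def)
  have "sum_list ?xs = psum h x"
    by (simp add: psum_def interv_sum_list_conv_sum_set_nat atLeast0LessThan)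
  then show "T_op v i j F ?xs = T_step h v i j f x"
    by (simp add: T_op_def T_step_def F funpow_deriv_upd T0_def T1_def T2_def)
qed

definition T_chain :: "(nat \<Rightarrow> nat \<times> nat \<times> nat) \<Rightarrow> nat \<Rightarrow> (real^'n::{finite,wellorder} \<Rightarrow> real) \<Rightarrow> real^'n::_ \<Rightarrow> real" where
  "T_chain L h f = foldr (\<lambda>i. (\<lambda>(v, i', j). T_step i v i' j) (L i)) [0..<h] f"

lemma T_chain_Suc: "T_chain L (Suc h) f = T_chain L h ((\<lambda>(v, i, j). T_step h v i j) (L h) f)"
  by (simp add: T_chain_def)

lemma sorted_list_of_set_UNIV_idx:
  "sorted_list_of_set (UNIV :: 'n::{finite,wellorder} set) = map idx [0..<CARD('n)]"
  by (rule nth_equalityI) (simp_all add: idx_def)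

lemma agree_foldr:
  fixes f :: "real^'n::{finite,wellorder} \<Rightarrow> real"
  shows "h \<le> CARD('n) \<Longrightarrow> agree h F f \<Longrightarrow>
    agree 0 (foldr (\<lambda>i. T_op (V i) (I i) (J i)) [0..<h] F) (T_chain (\<lambda>i. (V i, I i, J i)) h f)"
  by (induction h arbitrary: F f) (simp_all add: T_chain_Suc agree_T_op, simp add: T_chain_def)

text \<open>The free \<open>x\<close> records that after all coordinates have been consumed the
  result is a constant function.\<close>

lemma mu_eq_T_chain:
  fixes f :: "real^'n::{finite,wellorder} \<Rightarrow> real"
  shows "mu V I J f = T_chain (\<lambda>i. (V (idx i), I (idx i), J (idx i))) CARD('n) f x"
proof -
  have "list_to_vec (map (\<lambda>i. y $ idx i) [0..<CARD('n)]) = y" for y :: "real^'n::_"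
  proof -
    have "list_to_vec (map (\<lambda>i. y $ idx i) [0..<CARD('n)]) $ k = y $ k" for k :: 'n
      by (cases k rule: idx_cases) (simp add: list_to_vec_def card_less_idx)
    then show ?thesis
      by (simp add: vec_eq_iff)
  qed
  then have "agree CARD('n) (\<lambda>xs. f (list_to_vec xs)) f"
    by (simp add: agree_def)
  from agree_foldr[OF order_refl this, of "\<lambda>i. V (idx i)" "\<lambda>i. I (idx i)" "\<lambda>i. J (idx i)"]
  show ?thesis
    by (simp add: agree_def mu_def sorted_list_of_set_UNIV_idx foldr_map o_def)
qed

lemma T_step_cmult:
  assumes "C_class j f"
  shows "T_step h v i j (\<lambda>x. a * f x) = (\<lambda>x. a * T_step h v i j f x)"
proof -
  have "fold pd (replicate j k) (\<lambda>x. a * f x) = (\<lambda>x. a * fold pd (replicate j k) f x)" for k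
    using assms by (intro fold_partial_deriv_cmult) simp
  then have "(pd k ^^ j) (\<lambda>x. a * f x) = (\<lambda>x. a * (pd k ^^ j) f x)" for k
    by (simp only: fold_partial_deriv_replicate)
  then show ?thesis
    by (auto simp: T_step_def T0_def T1_def T2_def)
qed

lemma T_chain_cmult:
  fixes f :: "real^'n::{finite,wellorder} \<Rightarrow> real"
  shows "h \<le> CARD('n) \<Longrightarrow> C_class (\<Sum>i<h. snd (snd (L i))) f \<Longrightarrow>
    T_chain L h (\<lambda>x. a * f x) = (\<lambda>x. a * T_chain L h f x)"
proof (induction h arbitrary: f)
  case (Suc h)
  obtain v i j where L: "L h = (v, i, j)"
    by (cases "L h")
  have "C_class j f"
    using Suc.prems L by (auto intro: C_class_mono)
  then have "T_step h v i j (\<lambda>x. a * f x) = (\<lambda>x. a * T_step h v i j f x)"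
    by (rule T_step_cmult)
  moreover have "C_class (\<Sum>i<h. snd (snd (L i))) (T_step h v i j f)"
    using Suc.prems L by (intro C_class_T_step) (simp_all add: algebra_simps del: C_class.simps)
  ultimately show ?case
    using Suc L by (simp add: T_chain_Suc)
qed (simp add: T_chain_def)

section \<open>Unrolling the recursion into a sum over index lists\<close>

definition term_list :: "real^'n::{finite,wellorder} \<Rightarrow> real \<Rightarrow> (nat \<Rightarrow> nat \<times> nat \<times> nat) \<Rightarrow> nat \<Rightarrow> (real^'n::_ \<Rightarrow> real) \<Rightarrow> real^'n::_ \<Rightarrow> real" where
  "term_list \<xi> \<tau> L h f = foldr (\<lambda>i. term_op \<xi> \<tau> i (L i)) [0..<h] f"

lemma term_list_Suc: "term_list \<xi> \<tau> L (Suc h) f = term_list \<xi> \<tau> L h (term_op \<xi> \<tau> h (L h) f)"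
  by (simp add: term_list_def)

definition coeff_op :: "real^'n::{finite,wellorder} \<Rightarrow> real \<Rightarrow> nat \<Rightarrow> nat \<times> nat \<times> nat \<Rightarrow> real" where
  "coeff_op \<xi> \<tau> h = (\<lambda>(v, i, j). \<tau> powi (1 - int i - int j) * bern_per (j + i) (bern_arg h v \<xi>))"

text \<open>The scalars of \<open>term_op\<close> stand between the operators and are moved to the
  front by linearity. Linearity of the derivatives rests on smoothness, of as many orders as the
  whole chain takes.\<close>

lemma term_list_eq:
  fixes f :: "real^'n::{finite,wellorder} \<Rightarrow> real"
  shows "h \<le> CARD('n) \<Longrightarrow> C_class (\<Sum>i<h. snd (snd (L i))) f \<Longrightarrow>
    term_list \<xi> \<tau> L h f = (\<lambda>x. (\<Prod>i<h. coeff_op \<xi> \<tau> i (L i)) * T_chain L h f x)"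
proof (induction h arbitrary: f)
  case (Suc h)
  obtain v i j where L: "L h = (v, i, j)"
    by (cases "L h")
  have C: "C_class (\<Sum>i<h. snd (snd (L i))) (T_step h v i j f)"
    using Suc.prems L by (intro C_class_T_step) (simp_all add: algebra_simps del: C_class.simps)
  have op: "term_op \<xi> \<tau> h (L h) f = (\<lambda>x. coeff_op \<xi> \<tau> h (L h) * T_step h v i j f x)"
    by (simp add: term_op_def coeff_op_def L)
  have "term_list \<xi> \<tau> L (Suc h) f =
      (\<lambda>x. (\<Prod>i<h. coeff_op \<xi> \<tau> i (L i)) * T_chain L h (\<lambda>x. coeff_op \<xi> \<tau> h (L h) * T_step h v i j f x) x)"
    unfolding term_list_Suc op using Suc.prems C by (intro Suc.IH C_class_cmult) simp_all
  also have "T_chain L h (\<lambda>x. coeff_op \<xi> \<tau> h (L h) * T_step h v i j f x)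
      = (\<lambda>x. coeff_op \<xi> \<tau> h (L h) * T_chain L h (T_step h v i j f) x)"
    using Suc.prems C by (intro T_chain_cmult) auto
  finally show ?case
    by (simp add: L T_chain_Suc mult.assoc)
qed (simp add: term_list_def T_chain_def)

definition triple_lists :: "nat \<Rightarrow> nat \<Rightarrow> (nat \<times> nat \<times> nat) list set" where
  "triple_lists h m = {ls. length ls = h \<and> (\<forall>(v, i, j)\<in>set ls. v \<in> {1, 2} \<and> i \<in> {0, 1} \<and> (i = 0 \<longrightarrow> j = 0))
     \<and> (\<Sum>l\<leftarrow>ls. snd (snd l)) \<le> m}"

lemma triples_iff: "(v, i, j) \<in> triples m \<longleftrightarrow> v \<in> {1, 2} \<and> i \<in> {0, 1} \<and> (i = 0 \<longrightarrow> j = 0) \<and> j \<le> m"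
  by (auto simp: triples_def)

text \<open>Coordinate \<open>h\<close> is treated before the earlier ones but is the last entry of
  the list; removing it leaves the reduced budget for the rest.\<close>

lemma bij_betw_triple_lists:
  "bij_betw (\<lambda>(l, ls). ls @ [l]) (Sigma (triples m) (\<lambda>l. triple_lists h (m - snd (snd l)))) (triple_lists (Suc h) m)"
proof (rule bij_betw_byWitness[where f' = "\<lambda>ls. (last ls, butlast ls)"])
  have len: "length ls = Suc h" if "ls \<in> triple_lists (Suc h) m" for ls
    using that by (simp add: triple_lists_def)
  have nonempty: "ls \<noteq> []" if "ls \<in> triple_lists (Suc h) m" for ls
    using len[OF that] by auto
  show "\<forall>ls\<in>triple_lists (Suc h) m. (case (last ls, butlast ls) of (l, ls) \<Rightarrow> ls @ [l]) = ls"
    by (simp add: nonempty)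
  show "\<forall>a\<in>Sigma (triples m) (\<lambda>l. triple_lists h (m - snd (snd l))).
      (last (case a of (l, ls) \<Rightarrow> ls @ [l]), butlast (case a of (l, ls) \<Rightarrow> ls @ [l])) = a"
    by clarsimp
  show "(\<lambda>(l, ls). ls @ [l]) ` Sigma (triples m) (\<lambda>l. triple_lists h (m - snd (snd l))) \<subseteq> triple_lists (Suc h) m"
  proof clarify
    fix v i j :: nat and ls
    assume "(v, i, j) \<in> triples m" "ls \<in> triple_lists h (m - snd (snd (v, i, j)))"
    then show "ls @ [(v, i, j)] \<in> triple_lists (Suc h) m"
      unfolding triple_lists_def triples_iff mem_Collect_eq set_append ball_Un by (simp, elim conjE, linarith)
  qed
  show "(\<lambda>ls. (last ls, butlast ls)) ` triple_lists (Suc h) m \<subseteq> Sigma (triples m) (\<lambda>l. triple_lists h (m - snd (snd l)))"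
  proof (rule image_subsetI)
    fix ls assume *: "ls \<in> triple_lists (Suc h) m"
    from len[OF *] obtain l ls' where ls: "ls = ls' @ [l]"
      by (cases ls rule: rev_cases) auto
    obtain v i j where l: "l = (v, i, j)"
      by (cases l)
    show "(last ls, butlast ls) \<in> Sigma (triples m) (\<lambda>l. triple_lists h (m - snd (snd l)))"
      using * unfolding ls l by (simp add: triple_lists_def triples_iff ball_Un, elim conjE, linarith)
  qed
qed

lemma finite_triple_lists: "finite (triple_lists h m)"
proof (induction h arbitrary: m)
  case 0
  have "triple_lists 0 m \<subseteq> {[]}"
    by (auto simp: triple_lists_def)
  then show ?case
    by (rule finite_subset) simp
next
  case (Suc h)
  then show ?case
    using bij_betw_finite[OF bij_betw_triple_lists[of m h]] finite_triples by simp
qed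

lemma expansion_eq_sum:
  "expansion \<xi> \<tau> h m f = (\<Sum>ls\<in>triple_lists h m. term_list \<xi> \<tau> ((!) ls) h f 0)"
proof (induction h arbitrary: m f)
  case 0
  have "triple_lists 0 m = {[]}"
    by (auto simp: triple_lists_def)
  then show ?case
    by (simp add: term_list_def)
next
  case (Suc h)
  have "(\<Sum>ls\<in>triple_lists (Suc h) m. term_list \<xi> \<tau> ((!) ls) (Suc h) f 0)
      = (\<Sum>(l, ls)\<in>Sigma (triples m) (\<lambda>l. triple_lists h (m - snd (snd l))). term_list \<xi> \<tau> ((!) (ls @ [l])) (Suc h) f 0)"
    by (subst sum.reindex_bij_betw[OF bij_betw_triple_lists, symmetric]) (simp add: case_prod_unfold)
  also have "\<dots> = (\<Sum>(l, ls)\<in>Sigma (triples m) (\<lambda>l. triple_lists h (m - snd (snd l))).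
      term_list \<xi> \<tau> ((!) ls) h (term_op \<xi> \<tau> h l f) 0)"
  proof (rule sum.cong[OF refl], clarify)
    fix v i j :: nat and ls assume "ls \<in> triple_lists h (m - snd (snd (v, i, j)))"
    then have len: "length ls = h"
      by (simp add: triple_lists_def)
    then have "term_list \<xi> \<tau> ((!) (ls @ [(v, i, j)])) h F = term_list \<xi> \<tau> ((!) ls) h F" for F
      unfolding term_list_def by (intro foldr_cong) (auto simp: nth_append)
    with len show "term_list \<xi> \<tau> ((!) (ls @ [(v, i, j)])) (Suc h) f 0 = term_list \<xi> \<tau> ((!) ls) h (term_op \<xi> \<tau> h (v, i, j) f) 0"
      using nth_append_length[of ls "(v, i, j)" "[]"] by (simp add: term_list_Suc)
  qed
  also have "\<dots> = (\<Sum>l\<in>triples m. \<Sum>ls\<in>triple_lists h (m - snd (snd l)). term_list \<xi> \<tau> ((!) ls) h (term_op \<xi> \<tau> h l f) 0)"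
    by (rule sum.Sigma[symmetric]) (auto simp: finite_triples finite_triple_lists)
  also have "\<dots> = expansion \<xi> \<tau> (Suc h) m f"
    using Suc by simp
  finally show ?case ..
qed

text \<open>Explicit form of the inverse of \<open>D_mat V\<close>; its entry \<open>k\<close> is
  the argument \<open>bern_arg\<close> of that coordinate.\<close>

definition shear :: "('n::{finite,wellorder} \<Rightarrow> nat) \<Rightarrow> real^'n::_ \<Rightarrow> real^'n::_" where
  "shear V x = (\<chi> k. if V k = 1 then x $ k else (\<Sum>j\<in>{..k}. x $ j))"

lemma atMost_idx:
  assumes "i < CARD('n)"
  shows "{..idx i} = (idx ` {..<Suc i} :: 'n::{finite,wellorder} set)"
proof (intro equalityI subsetI)
  fix k :: 'n assume "k \<in> {..idx i}"
  then show "k \<in> idx ` {..<Suc i}"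
    using assms idx_less_iff[where 'n = 'n and i = i] by (cases k rule: idx_cases) (auto simp: not_less[symmetric])
qed (use assms in \<open>auto simp: idx_less_iff not_less[symmetric] less_Suc_eq_le\<close>)

lemma bern_arg_idx:
  fixes \<xi> :: "real^'n::{finite,wellorder}"
  assumes "i < CARD('n)"
  shows "bern_arg i (V (idx i)) \<xi> = shear V \<xi> $ idx i"
proof -
  have "psum (Suc i) \<xi> = (\<Sum>j\<in>idx ` {..<Suc i}. \<xi> $ j)"
    unfolding psum_def using assms by (subst sum.reindex) (auto simp: inj_on_def idx_eq_iff)
  then show ?thesis
    using atMost_idx[OF assms] by (simp add: bern_arg_def shear_def)
qed

definition dirs :: "('n \<Rightarrow> nat) set" where "dirs = {V. \<forall>k. V k \<in> {1, 2}}"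

definition flags :: "('n \<Rightarrow> nat) set" where "flags = {I. \<forall>k. I k \<in> {0, 1}}"

definition orders :: "nat \<Rightarrow> ('n::finite \<Rightarrow> nat) \<Rightarrow> ('n \<Rightarrow> nat) set" where
  "orders w I = {J. sum J UNIV \<le> w \<and> (\<forall>k. I k = 0 \<longrightarrow> J k = 0)}"

lemma finite_dirs: "finite (dirs :: ('n::finite \<Rightarrow> nat) set)"
  using finite_PiE[of "UNIV :: 'n set" "\<lambda>_. {1, 2 :: nat}"] by (simp add: dirs_def PiE_UNIV_domain Pi_def)

lemma finite_flags: "finite (flags :: ('n::finite \<Rightarrow> nat) set)"
  using finite_PiE[of "UNIV :: 'n set" "\<lambda>_. {0, 1 :: nat}"] by (simp add: flags_def PiE_UNIV_domain Pi_def)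

lemma finite_orders: "finite (orders w (I :: 'n::finite \<Rightarrow> nat))"
proof -
  have "finite {J :: 'n \<Rightarrow> nat. \<forall>k. J k \<in> {..w}}"
    using finite_PiE[of "UNIV :: 'n set" "\<lambda>_. {..w}"] by (simp add: PiE_UNIV_domain Pi_def)
  moreover have "J k \<in> {..w}" if "J \<in> orders w I" for J k
    using that member_le_sum[of k UNIV J] by (simp add: orders_def)
  then have "orders w I \<subseteq> {J. \<forall>k. J k \<in> {..w}}"
    by blast
  ultimately show ?thesis
    by (rule finite_subset[rotated])
qed

lemma bij_betw_index_triples:
  "bij_betw (\<lambda>(V, I, J). map (\<lambda>i. (V (idx i), I (idx i), J (idx i))) [0..<CARD('n)])
    ((dirs :: ('n::{finite,wellorder} \<Rightarrow> nat) set) \<times> Sigma (flags :: ('n \<Rightarrow> nat) set) (orders w)) (triple_lists CARD('n) w)"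
proof -
  define pos where "pos k = card {j. j < k}" for k :: 'n
  have pos: "pos (idx i) = i" if "i < CARD('n)" for i
    using card_less_idx[OF that] by (simp add: pos_def)
  have pos_less: "pos k < CARD('n)" "idx (pos k) = k" for k :: 'n
    by (cases k rule: idx_cases, simp add: pos)+
  have sum_idx: "(\<Sum>i<CARD('n). F (idx i)) = (\<Sum>k\<in>UNIV. F k)" for F :: "'n \<Rightarrow> nat"
    by (rule sum.reindex_bij_betw[OF bij_betw_idx])
  let ?f = "\<lambda>(V, I, J). map (\<lambda>i. (V (idx i :: 'n), I (idx i :: 'n), J (idx i :: 'n))) [0..<CARD('n)]"
  let ?g = "\<lambda>ls. (\<lambda>k. fst (ls ! pos k), \<lambda>k. fst (snd (ls ! pos k)), \<lambda>k. snd (snd (ls ! pos k)))"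
  show ?thesis
  proof (rule bij_betw_byWitness[where f' = ?g])
    show "\<forall>a\<in>dirs \<times> Sigma flags (orders w). ?g (?f a) = a"
      by (auto simp: pos_less)
    show "\<forall>ls\<in>triple_lists CARD('n) w. ?f (?g ls) = ls"
    proof
      fix ls assume "ls \<in> triple_lists CARD('n) w"
      then have "length ls = CARD('n)"
        by (simp add: triple_lists_def)
      then show "?f (?g ls) = ls"
        by (intro nth_equalityI) (simp_all add: pos)
    qed
    show "?f ` (dirs \<times> Sigma flags (orders w)) \<subseteq> triple_lists CARD('n) w"
      by (auto simp: triple_lists_def dirs_def flags_def orders_def interv_sum_list_conv_sum_set_nat
          o_def atLeast0LessThan sum_idx)
    show "?g ` triple_lists CARD('n) w \<subseteq> (dirs \<times> Sigma flags (orders w))"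
    proof (rule image_subsetI)
      fix ls assume ls: "ls \<in> triple_lists CARD('n) w"
      have mem: "fst (ls ! pos k) \<in> {1, 2}" "fst (snd (ls ! pos k)) \<in> {0, 1}"
        "fst (snd (ls ! pos k)) = 0 \<longrightarrow> snd (snd (ls ! pos k)) = 0" for k :: 'n
      proof -
        have "ls ! pos k \<in> set ls"
          using ls pos_less(1)[of k] by (simp add: triple_lists_def)
        then show "fst (ls ! pos k) \<in> {1, 2}" "fst (snd (ls ! pos k)) \<in> {0, 1}"
          "fst (snd (ls ! pos k)) = 0 \<longrightarrow> snd (snd (ls ! pos k)) = 0"
          using ls by (auto simp: triple_lists_def case_prod_unfold)
      qed
      have "(\<Sum>k\<in>UNIV. snd (snd (ls ! pos k))) = (\<Sum>i<CARD('n). snd (snd (ls ! i)))"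
        by (subst sum_idx[symmetric]) (simp add: pos)
      also have "\<dots> = (\<Sum>l\<leftarrow>ls. snd (snd l))"
        using ls by (simp add: triple_lists_def sum_list_sum_nth atLeast0LessThan)
      finally have "(\<Sum>k\<in>UNIV. snd (snd (ls ! pos k))) \<le> w"
        using ls by (simp add: triple_lists_def)
      then have "(\<lambda>k. fst (ls ! pos k)) \<in> dirs" "(\<lambda>k. fst (snd (ls ! pos k))) \<in> flags"
          "(\<lambda>k. snd (snd (ls ! pos k))) \<in> orders w (\<lambda>k. fst (snd (ls ! pos k)))"
        using mem unfolding dirs_def flags_def orders_def by blast+
      then show "?g ls \<in> dirs \<times> Sigma flags (orders w)"
        by simp
    qed
  qed
qed

lemma prod_power_int:
  fixes \<tau> :: real
  assumes "\<tau> \<noteq> 0"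
  shows "finite A \<Longrightarrow> (\<Prod>k\<in>A. \<tau> powi F k) = \<tau> powi (\<Sum>k\<in>A. F k)"
  by (induction A rule: finite_induct) (simp_all add: power_int_add assms)

lemma expansion_explicit:
  fixes f :: "real^'n::{finite,wellorder} \<Rightarrow> real"
  assumes f: "C_class (Suc w) f" and \<tau>: "\<tau> \<noteq> 0"
  shows "expansion \<xi> \<tau> CARD('n) w f = (\<Sum>V\<in>dirs. \<Sum>I\<in>flags. \<Sum>J\<in>orders w I.
    \<tau> powi (int CARD('n) - int (sum I UNIV) - int (sum J UNIV)) * mu V I J f
      * (\<Prod>k\<in>UNIV. bern_per (J k + I k) (shear V \<xi> $ k)))"
proof -
  let ?t = "\<lambda>V I J. \<tau> powi (int CARD('n) - int (sum I UNIV) - int (sum J UNIV)) * mu V I J f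
      * (\<Prod>k\<in>UNIV. bern_per (J k + I k) (shear V \<xi> $ k))"
  have prod_idx: "(\<Prod>i<CARD('n). F (idx i)) = (\<Prod>k\<in>UNIV. F k)" for F :: "'n \<Rightarrow> real"
    by (rule prod.reindex_bij_betw[OF bij_betw_idx])
  have sum_idx: "(\<Sum>i<CARD('n). F (idx i)) = (\<Sum>k\<in>UNIV. F k)" for F :: "'n \<Rightarrow> nat"
    by (rule sum.reindex_bij_betw[OF bij_betw_idx])
  have summand: "term_list \<xi> \<tau> ((!) (map (\<lambda>i. (V (idx i), I (idx i), J (idx i))) [0..<CARD('n)])) CARD('n) f 0
      = ?t V I J" if "J \<in> orders w I" for V I J :: "'n \<Rightarrow> nat"
  proof -
    let ?L = "\<lambda>i. (V (idx i), I (idx i), J (idx i))"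
    have "term_list \<xi> \<tau> ((!) (map ?L [0..<CARD('n)])) CARD('n) f = term_list \<xi> \<tau> ?L CARD('n) f"
      unfolding term_list_def by (rule foldr_cong) auto
    moreover have "term_list \<xi> \<tau> ?L CARD('n) f = (\<lambda>x. (\<Prod>i<CARD('n). coeff_op \<xi> \<tau> i (?L i)) * T_chain ?L CARD('n) f x)"
      using that by (intro term_list_eq C_class_mono[OF f]) (simp_all add: sum_idx orders_def)
    moreover have "(\<Prod>i<CARD('n). coeff_op \<xi> \<tau> i (?L i))
        = (\<Prod>k\<in>UNIV. \<tau> powi (1 - int (I k) - int (J k)) * bern_per (J k + I k) (shear V \<xi> $ k))"
      by (subst prod_idx[symmetric], rule prod.cong) (simp_all add: coeff_op_def bern_arg_idx)
    moreover have "\<dots> = \<tau> powi (int CARD('n) - int (sum I UNIV) - int (sum J UNIV))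
        * (\<Prod>k\<in>UNIV. bern_per (J k + I k) (shear V \<xi> $ k))"
      by (simp add: prod.distrib prod_power_int[OF \<tau>] sum_subtractf)
    ultimately show ?thesis
      by (simp add: mu_eq_T_chain[of V I J f 0])
  qed
  have "expansion \<xi> \<tau> CARD('n) w f
      = (\<Sum>(V, I, J)\<in>(dirs \<times> Sigma flags (orders w)).
          term_list \<xi> \<tau> ((!) (map (\<lambda>i. (V (idx i :: 'n), I (idx i :: 'n), J (idx i :: 'n))) [0..<CARD('n)])) CARD('n) f 0)"
    unfolding expansion_eq_sum
    by (subst sum.reindex_bij_betw[OF bij_betw_index_triples, symmetric]) (simp add: case_prod_unfold)
  also have "\<dots> = (\<Sum>(V, I, J)\<in>(dirs \<times> Sigma flags (orders w)).
      ?t V I J)"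
    by (rule sum.cong) (auto simp: summand)
  also have "\<dots> = (\<Sum>V\<in>dirs. \<Sum>(I, J)\<in>Sigma flags (orders w).
      ?t V I J)"
    by (subst sum.Sigma) (auto simp: finite_dirs finite_flags finite_orders)
  also have "\<dots> = (\<Sum>V\<in>dirs. \<Sum>I\<in>flags. \<Sum>J\<in>orders w I.
    ?t V I J)"
    by (rule sum.cong[OF refl], subst sum.Sigma) (auto simp: finite_flags finite_orders)
  finally show ?thesis .
qed

section \<open>The bases and the cosets of the lattice\<close>

definition basis_list :: "nat list \<Rightarrow> real list list" where
  "basis_list vs = fold extend_basis vs []"

lemma basis_list_snoc: "basis_list (vs @ [v]) = extend_basis v (basis_list vs)"
  by (simp add: basis_list_def)

lemma length_basis_list: "length (basis_list vs) = length vs"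
proof (induction vs rule: rev_induct)
  case (snoc v vs)
  then show ?case
    by (simp add: basis_list_snoc extend_basis_def)
qed (simp add: basis_list_def)

lemma length_basis_list_nth: "k < length vs \<Longrightarrow> length (basis_list vs ! k) = length vs"
proof (induction vs arbitrary: k rule: rev_induct)
  case (snoc v vs)
  then show ?case
    by (cases "k < length vs")
      (auto simp: basis_list_snoc extend_basis_def nth_append length_basis_list less_Suc_eq)
qed simp

lemma basis_list_nth:
  "k < length vs \<Longrightarrow> i < length vs \<Longrightarrow> basis_list vs ! k ! i =
    (if i < k then 0 else if i = k then 1 else if vs ! i = 1 then 0 else - (\<Sum>l<i. basis_list vs ! k ! l))"
proof (induction vs arbitrary: k i rule: rev_induct)
  case (snoc v vs)
  have old: "basis_list (vs @ [v]) ! k = basis_list vs ! k @ [if v = 1 then 0 else - sum_list (basis_list vs ! k)]"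
    if "k < length vs" for k
    using that by (simp add: basis_list_snoc extend_basis_def nth_append length_basis_list)
  have new: "basis_list (vs @ [v]) ! length vs = replicate (length vs) 0 @ [1]"
    by (simp add: basis_list_snoc extend_basis_def nth_append length_basis_list)
  show ?case
  proof (cases "k < length vs")
    case k: True
    have prefix: "basis_list (vs @ [v]) ! k ! l = basis_list vs ! k ! l" if "l < length vs" for l
      using that k by (simp add: old nth_append length_basis_list_nth)
    show ?thesis
    proof (cases "i < length vs")
      case True
      then have "(\<Sum>l<i. basis_list (vs @ [v]) ! k ! l) = (\<Sum>l<i. basis_list vs ! k ! l)"
        by (intro sum.cong) (auto simp: prefix)
      then show ?thesis
        using True k snoc.IH[OF k True] by (simp add: prefix nth_append)
    next
      case False
      then have i: "i = length vs"
        using snoc.prems by simp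
      have "(\<Sum>l<i. basis_list (vs @ [v]) ! k ! l) = sum_list (basis_list vs ! k)"
        using k by (simp add: i prefix sum_list_sum_nth length_basis_list_nth atLeast0LessThan)
      then show ?thesis
        using k by (simp add: i old nth_append length_basis_list_nth)
    qed
  next
    case False
    then have "k = length vs"
      using snoc.prems by simp
    then show ?thesis
      using snoc.prems new by (auto simp: nth_append less_Suc_eq)
  qed
qed simp

lemma D_mat_nth:
  fixes V :: "'n::{finite,wellorder} \<Rightarrow> nat"
  shows "D_mat V $ i $ k =
    (if i < k then 0 else if i = k then 1 else if V i = 1 then 0 else - (\<Sum>j\<in>{..<i}. D_mat V $ j $ k))"
proof -
  let ?bs = "basis_list (map V (sorted_list_of_set UNIV))"
  have D: "D_mat V $ idx a $ idx b = ?bs ! b ! a" if "a < CARD('n)" "b < CARD('n)" for a b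
    using that by (simp add: D_mat_def list_to_vec_def basis_of_def basis_list_def card_less_idx)
  obtain a where a: "a < CARD('n)" "i = idx a"
    by (rule idx_cases)
  obtain b where b: "b < CARD('n)" "k = idx b"
    by (rule idx_cases)
  have "{..<i} = idx ` {..<a}"
  proof (intro equalityI subsetI)
    fix j assume "j \<in> {..<i}"
    then show "j \<in> idx ` {..<a}"
      using a idx_less_iff[where 'n = 'n] by (cases j rule: idx_cases) auto
  qed (use a in \<open>auto simp: idx_less_iff\<close>)
  then have "(\<Sum>j\<in>{..<i}. D_mat V $ j $ k) = (\<Sum>l<a. D_mat V $ idx l $ k)"
    using a by (simp add: sum.reindex inj_on_def idx_eq_iff)
  also have "\<dots> = (\<Sum>l<a. ?bs ! b ! l)"
    using a b by (intro sum.cong) (auto simp: D)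
  finally show ?thesis
    using a b D[OF a(1) b(1)] basis_list_nth[of b "map V (sorted_list_of_set UNIV)" a]
    by (simp add: idx_eq_iff idx_less_iff sorted_list_of_set_UNIV_idx)
qed

lemma D_mat_above_diagonal: "i < k \<Longrightarrow> D_mat V $ i $ k = 0"
  by (subst D_mat_nth) simp

lemma D_mat_diagonal: "D_mat V $ i $ i = 1"
  by (subst D_mat_nth) simp

lemma det_D_mat: "det (D_mat V) = 1"
  by (subst det_lowerdiagonal) (simp_all add: D_mat_above_diagonal D_mat_diagonal)

lemma D_mat_Ints: "D_mat V $ i $ k \<in> \<int>"
proof (induction i rule: less_induct)
  case (less i)
  then show ?case
    by (subst D_mat_nth) (auto intro!: Ints_sum)
qed

lemma shear_linear: "shear V (x + y) = shear V x + shear V y" "shear V (x - y) = shear V x - shear V y"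
  "shear V (c *\<^sub>R x) = c *\<^sub>R shear V x"
  by (auto simp: shear_def vec_eq_iff sum.distrib sum_subtractf sum_distrib_left)

text \<open>Below the diagonal a column of \<open>D_mat V\<close> has the entry 0 in a row with
  \<open>V i = 1\<close>, and in any other row an entry that makes the partial sum of the column
  vanish. Taking entries or partial sums accordingly leaves the identity matrix.\<close>

lemma shear_D_mat: "shear V (D_mat V *v x) = x"
proof -
  have delta: "(if V i = 1 then D_mat V $ i $ k else (\<Sum>j\<le>i. D_mat V $ j $ k)) = of_bool (i = k)" for i k
  proof -
    have "(\<Sum>j\<le>i. D_mat V $ j $ k) = D_mat V $ i $ k + (\<Sum>j<i. D_mat V $ j $ k)"
      by (simp add: lessThan_Suc_atMost[symmetric] ivl_disj_un(2)[symmetric])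
    moreover have "(\<Sum>j<i. D_mat V $ j $ k) = 0" if "i \<le> k"
      using that by (intro sum.neutral) (auto simp: D_mat_above_diagonal)
    ultimately show ?thesis
      using D_mat_nth[of V i k] by (auto simp: not_less)
  qed
  show ?thesis
  proof (rule vec_eq_iff[THEN iffD2], rule allI)
    fix i
    have "shear V (D_mat V *v x) $ i = (\<Sum>k\<in>UNIV. (if V i = 1 then D_mat V $ i $ k else (\<Sum>j\<le>i. D_mat V $ j $ k)) * x $ k)"
      by (auto simp: shear_def matrix_vector_mult_def sum_distrib_right sum.swap[of _ UNIV])
    also have "\<dots> = x $ i"
      unfolding delta by simp
    finally show "shear V (D_mat V *v x) $ i = x $ i" .
  qed
qed

lemma matrix_inv:
  fixes A :: "'a::semiring_1^'n^'n"
  assumes "invertible A"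
  shows "A ** matrix_inv A = mat 1" "matrix_inv A ** A = mat 1"
  using someI_ex[OF assms[unfolded invertible_def]] by (simp_all add: matrix_inv_def)

lemma D_mat_shear: "D_mat V *v shear V x = x"
proof -
  have "invertible (D_mat V)"
    by (simp add: invertible_det_nz det_D_mat)
  then have "x = D_mat V *v (matrix_inv (D_mat V) *v x)"
    by (simp add: matrix_vector_mul_assoc matrix_inv)
  then show ?thesis
    by (metis shear_D_mat)
qed

section \<open>The integer lattice and its cosets\<close>

lemma int_lattice_mult: "(\<And>i k. M $ i $ k \<in> \<int>) \<Longrightarrow> x \<in> int_lattice \<Longrightarrow> M *v x \<in> int_lattice"
  by (simp add: int_lattice_def matrix_vector_mult_def Ints_sum Ints_mult)

lemma int_lattice_add: "x \<in> int_lattice \<Longrightarrow> y \<in> int_lattice \<Longrightarrow> x + y \<in> int_lattice"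
  by (simp add: int_lattice_def)

lemma int_lattice_diff: "x \<in> int_lattice \<Longrightarrow> y \<in> int_lattice \<Longrightarrow> x - y \<in> int_lattice"
  by (simp add: int_lattice_def)

lemma int_lattice_shear: "x \<in> int_lattice \<Longrightarrow> shear V x \<in> int_lattice"
  by (simp add: int_lattice_def shear_def Ints_sum)

definition vfloor :: "real^'n \<Rightarrow> real^'n" where
  "vfloor x = (\<chi> k. of_int \<lfloor>x $ k\<rfloor>)"

definition unit_cell :: "(real^'n) set" where
  "unit_cell = {x. \<forall>k. 0 \<le> x $ k \<and> x $ k < 1}"

lemma vfloor_int_lattice: "vfloor x \<in> int_lattice"
  by (simp add: vfloor_def int_lattice_def)

lemma diff_vfloor_in_unit_cell: "x - vfloor x \<in> unit_cell"
  by (simp add: unit_cell_def vfloor_def) linarith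

lemma vfloor_unique: "x - n \<in> unit_cell \<Longrightarrow> n \<in> int_lattice \<Longrightarrow> vfloor x = n"
proof (rule vec_eq_iff[THEN iffD2], rule allI)
  fix k assume "x - n \<in> unit_cell" "n \<in> int_lattice"
  then have "0 \<le> x $ k - n $ k" "x $ k - n $ k < 1" "n $ k \<in> \<int>"
    by (auto simp: unit_cell_def int_lattice_def)
  moreover from this obtain m where m: "n $ k = of_int m"
    by (auto elim: Ints_cases)
  ultimately have "\<lfloor>x $ k\<rfloor> = m"
    by (intro floor_unique) auto
  then show "vfloor x $ k = n $ k"
    by (simp add: vfloor_def m)
qed

definition coset_reps :: "real^'n^'n \<Rightarrow> (real^'n) set" where
  "coset_reps M = {r \<in> unit_cell. M *v r \<in> int_lattice}"

lemma measure_unit_box: "measure lebesgue (box 0 (1 :: real^'n)) = 1"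
proof -
  have le: "0 \<bullet> b \<le> 1 \<bullet> b" if "b \<in> Basis" for b :: "real^'n"
    using that by (auto simp: Basis_vec_def inner_axis)
  have "measure lebesgue (box 0 (1 :: real^'n)) = measure lborel (cbox 0 (1 :: real^'n))"
    using emeasure_lborel_box[of 0 "1 :: real^'n", OF le] emeasure_lborel_cbox[of 0 "1 :: real^'n", OF le]
    by (simp add: measure_def)
  also have "\<dots> = 1"
    by (subst content_cbox_cart) (simp_all add: interval_ne_empty_cart)
  finally show ?thesis .
qed

text \<open>Open unit boxes at distinct integer points are disjoint and have volume 1 each.\<close>

lemma card_le_measure:
  fixes W X :: "(real^'n) set"
  assumes W: "finite W" "W \<subseteq> int_lattice" and X: "X \<in> lmeasurable"
    and sub: "\<And>n. n \<in> W \<Longrightarrow> (+) n ` box 0 1 \<subseteq> X"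
  shows "real (card W) \<le> measure lebesgue X"
proof -
  have lm: "(+) n ` box 0 1 \<in> lmeasurable" for n :: "real^'n"
    by (simp add: measurable_translation)
  have "disjoint_family_on (\<lambda>n. (+) n ` box 0 (1 :: real^'n)) W"
    unfolding disjoint_family_on_def
  proof (intro ballI impI)
    fix m n assume mn: "m \<in> W" "n \<in> W" "m \<noteq> n"
    show "(+) m ` box 0 1 \<inter> (+) n ` box 0 (1 :: real^'n) = {}"
    proof (rule ccontr)
      assume "(+) m ` box 0 1 \<inter> (+) n ` box 0 (1 :: real^'n) \<noteq> {}"
      then obtain x y where xy: "x \<in> box 0 1" "y \<in> box 0 (1 :: real^'n)" "m + x = n + y"
        by auto
      have "m $ k = n $ k" for k
      proof -
        have "m $ k - n $ k \<in> \<int>"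
          using mn W(2) by (auto simp: int_lattice_def intro!: Ints_diff)
        then obtain j where j: "m $ k - n $ k = of_int j"
          by (auto elim: Ints_cases)
        have "m $ k - n $ k = y $ k - x $ k"
          using arg_cong[OF xy(3), of "\<lambda>v. v $ k"] by simp
        then have "\<bar>real_of_int j\<bar> < 1"
        proof -
          have "0 < x $ k" "x $ k < 1" "0 < y $ k" "y $ k < 1"
            using xy(1,2) by (simp_all add: mem_box_cart)
          then show ?thesis
            using j \<open>m $ k - n $ k = y $ k - x $ k\<close> by linarith
        qed
        then have "j = 0"
          by linarith
        then show ?thesis
          using j by simp
      qed
      then show False
        using mn by (simp add: vec_eq_iff)
    qed
  qed
  then have "measure lebesgue (\<Union>n\<in>W. (+) n ` box 0 1) = (\<Sum>n\<in>W. measure lebesgue ((+) n ` box 0 (1 :: real^'n)))"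
    using lm W(1) fmeasurableD2[OF lm] fmeasurableD[OF lm]
    by (intro measure_finite_Union) (auto simp: infinity_ennreal_def)
  also have "\<dots> = real (card W)"
    by (simp add: measure_translation measure_unit_box)
  finally have "real (card W) = measure lebesgue (\<Union>n\<in>W. (+) n ` box 0 1)"
    by simp
  also have "\<dots> \<le> measure lebesgue X"
    using sub W(1) lm X by (intro measure_mono_fmeasurable) (auto simp: fmeasurable_def)
  finally show ?thesis .
qed


lemma
  assumes "det (M :: real^'n^'n) \<noteq> 0"
  shows mult_matrix_inv: "M *v (matrix_inv M *v x) = x" and matrix_inv_mult: "matrix_inv M *v (M *v x) = x"
  using matrix_inv[of M] assms by (simp_all add: matrix_vector_mul_assoc invertible_det_nz)

lemmas matrix_vector_linear = matrix_vector_mult_diff_distrib matrix_vector_right_distrib matrix_vector_mult_scaleR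

lemma card_box_points:
  "finite {n :: real^'n. \<forall>k. n $ k \<in> real ` {..<N}} \<and> card {n :: real^'n. \<forall>k. n $ k \<in> real ` {..<N}} = N ^ CARD('n)"
proof -
  have eq: "{n :: real^'n. \<forall>k. n $ k \<in> real ` {..<N}} = (\<lambda>f. \<chi> k. real (f k)) ` (\<Pi>\<^sub>E k\<in>UNIV. {..<N})"
  proof (intro equalityI subsetI)
    fix n :: "real^'n" assume "n \<in> {n. \<forall>k. n $ k \<in> real ` {..<N}}"
    then have "\<forall>k. \<exists>j. j < N \<and> n $ k = real j"
      by auto
    then obtain f where "\<forall>k. f k < N \<and> n $ k = real (f k)"
      by metis
    then show "n \<in> (\<lambda>f. \<chi> k. real (f k)) ` (\<Pi>\<^sub>E k\<in>UNIV. {..<N})"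
      by (intro image_eqI[of _ _ f]) (auto simp: vec_eq_iff)
  qed (auto simp: PiE_iff)
  have "inj_on (\<lambda>f. \<chi> k. real (f k) :: real^'n) (\<Pi>\<^sub>E k\<in>UNIV. {..<N})"
    by (auto simp: inj_on_def vec_eq_iff fun_eq_iff)
  then show ?thesis
    unfolding eq by (simp add: card_image card_PiE finite_PiE)
qed

text \<open>
  The lattice points in a large dilate of the parallelepiped \<open>M [0,1]\<^sup>d\<close> are counted both by
  volume and by cosets.
\<close>

lemma card_coset_reps:
  fixes M :: "real^'n::{finite,wellorder}^'n::_"
  assumes int: "\<And>i k. M $ i $ k \<in> \<int>" and det: "det M \<noteq> 0"
  shows "finite (coset_reps M)" "real (card (coset_reps M)) \<le> \<bar>det M\<bar>"
proof -
  have bound: "real (card F) \<le> \<bar>det M\<bar>" if F: "F \<subseteq> coset_reps M" "finite F" for F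
  proof -
    have "compact ((*v) (matrix_inv M) ` cbox 0 1)"
      by (intro compact_continuous_image linear_continuous_on matrix_vector_mul_bounded_linear) auto
    \<comment> \<open>\<open>K\<close> bounds, in the coordinates pulled back by \<open>M\<close>,
      how far a unit box attached to a counted point reaches.\<close>
    then obtain K where "\<forall>y\<in>(*v) (matrix_inv M) ` cbox 0 1. norm y \<le> K"
      using compact_imp_bounded bounded_iff by meson
    then have K: "norm (matrix_inv M *v x) \<le> K" if "x \<in> cbox 0 1" for x
      using that by blast
    have K0: "K \<ge> 0"
      using K[of 0] by (simp add: mem_box_cart)
    have est: "real (card F) * real N ^ CARD('n) \<le> \<bar>det M\<bar> * (real N + 2 * K) ^ CARD('n)" for N
    proof -
      let ?G = "{n :: real^'n::_. \<forall>k. n $ k \<in> real ` {..<N}}"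
      let ?X = "(*v) M ` cbox (\<chi> k. - K) (\<chi> k. real N + K)"
      have F': "r \<in> unit_cell" "M *v r \<in> int_lattice" if "r \<in> F" for r
        using F that by (auto simp: coset_reps_def)
      have G: "g \<in> int_lattice" if "g \<in> ?G" for g
        unfolding int_lattice_def
      proof (intro CollectI allI)
        fix k
        have "g $ k \<in> real ` {..<N}"
          using that by simp
        then show "g $ k \<in> \<int>"
          by auto
      qed
      have "inj_on (\<lambda>(r, g). M *v (r + g)) (F \<times> ?G)"
      proof (rule inj_onI, clarify)
        fix r g r' g' assume *: "r \<in> F" "r' \<in> F" "\<forall>k. g $ k \<in> real ` {..<N}" "\<forall>k. g' $ k \<in> real ` {..<N}"
          "M *v (r + g) = M *v (r' + g')"
        then have eq: "r + g = r' + g'"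
          using matrix_inv_mult[OF det] by metis
        moreover have "vfloor (r + g) = g" "vfloor (r' + g') = g'"
          using * F' G by (auto intro!: vfloor_unique)
        ultimately show "r = r' \<and> g = g'"
          by simp
      qed
      then have "real (card F) * real N ^ CARD('n) = real (card ((\<lambda>(r, g). M *v (r + g)) ` (F \<times> ?G)))"
        using card_box_points[where 'n = 'n and N = N] by (simp add: card_image card_cartesian_product)
      also have "\<dots> \<le> measure lebesgue ?X"
      proof (rule card_le_measure)
        show "finite ((\<lambda>(r, g). M *v (r + g)) ` (F \<times> ?G))"
          using F card_box_points[where 'n = 'n and N = N] by simp
        show "(\<lambda>(r, g). M *v (r + g)) ` (F \<times> ?G) \<subseteq> int_lattice"
          using F' G int_lattice_mult[OF int] by (auto simp: matrix_vector_right_distrib intro!: int_lattice_add)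
        show "?X \<in> lmeasurable"
          by (intro measurable_linear_image) auto
        fix n assume "n \<in> (\<lambda>(r, g). M *v (r + g)) ` (F \<times> ?G)"
        then obtain r g where rg: "r \<in> F" "g \<in> ?G" "n = M *v (r + g)"
          by auto
        show "(+) n ` box 0 1 \<subseteq> ?X"
        proof clarify
          fix b :: "real^'n::_" assume "b \<in> box 0 1"
          then have b: "norm (matrix_inv M *v b) \<le> K"
            using K box_subset_cbox[of 0 1] by blast
          have "- K \<le> (r + g + matrix_inv M *v b) $ k \<and> (r + g + matrix_inv M *v b) $ k \<le> real N + K" for k
          proof -
            have "0 \<le> r $ k" "r $ k < 1"
              using F'(1)[OF rg(1)] by (auto simp: unit_cell_def)
            moreover obtain j where "j < N" "g $ k = real j"
              using rg(2) by auto
            then have "0 \<le> g $ k" "g $ k + 1 \<le> real N"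
              by simp_all
            moreover have "\<bar>(matrix_inv M *v b) $ k\<bar> \<le> K"
              using component_le_norm_cart[of "matrix_inv M *v b" k] b by linarith
            ultimately show ?thesis
              by (simp, intro conjI; linarith)
          qed
          then have "r + g + matrix_inv M *v b \<in> cbox (\<chi> k. - K) (\<chi> k. real N + K)"
            by (simp add: mem_box_cart)
          moreover have "n + b = M *v (r + g + matrix_inv M *v b)"
            by (simp add: rg(3) matrix_vector_right_distrib mult_matrix_inv[OF det])
          ultimately show "n + b \<in> ?X"
            by blast
        qed
      qed
      also have "\<dots> = \<bar>det M\<bar> * measure lebesgue (cbox (\<chi> k. - K) (\<chi> k. real N + K) :: (real^'n::_) set)"
        by (subst measure_linear_image) (auto simp: matrix_of_matrix_vector_mul)
      also have "measure lebesgue (cbox (\<chi> k. - K) (\<chi> k. real N + K) :: (real^'n::_) set) = (real N + 2 * K) ^ CARD('n)"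
        using K0 by (simp add: content_cbox_cart interval_ne_empty_cart add.commute)
      finally show ?thesis .
    qed
    \<comment> \<open>As the dilate grows, the boundary layer of width \<open>K\<close> becomes
      negligible against the volume.\<close>
    have "(\<lambda>N. \<bar>det M\<bar> * (1 + 2 * K * (1 / real (Suc N))) ^ CARD('n)) \<longlonglongrightarrow> \<bar>det M\<bar> * (1 + 2 * K * 0) ^ CARD('n)"
      by (intro tendsto_intros lim_1_over_n[THEN LIMSEQ_Suc])
    moreover have "real (card F) \<le> \<bar>det M\<bar> * (1 + 2 * K * (1 / real (Suc N))) ^ CARD('n)" for N
    proof -
      have "(1 + 2 * K * (1 / real (Suc N))) ^ CARD('n) = (real (Suc N) + 2 * K) ^ CARD('n) / real (Suc N) ^ CARD('n)"
        by (subst power_divide[symmetric]) (simp add: field_simps)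
      then show ?thesis
        using est[of "Suc N"] by (simp add: pos_le_divide_eq)
    qed
    ultimately show ?thesis
      using LIMSEQ_le_const by fastforce
  qed
  \<comment> \<open>One bound for all finite subsets yields the finiteness of the whole set.\<close>
  then have "card F \<le> nat \<lfloor>\<bar>det M\<bar>\<rfloor>" if "F \<subseteq> coset_reps M" "finite F" for F
    using that by (meson le_nat_floor)
  then show "finite (coset_reps M)"
    using finite_if_finite_subsets_card_bdd by blast
  then show "real (card (coset_reps M)) \<le> \<bar>det M\<bar>"
    by (rule bound[OF order_refl])
qed

text \<open>With \<open>L = transpose (M ** D_mat V)\<close> the matrix
  \<open>transpose (matrix_inv L)\<close> is the inverse of \<open>M ** D_mat V\<close>, that is,
  the inverse of \<open>M\<close> followed by the inverse of \<open>D_mat V\<close>.\<close>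

lemma transpose_inv_mult:
  fixes M :: "real^'n::{finite,wellorder}^'n::_"
  assumes det: "det M \<noteq> 0"
  shows "transpose (matrix_inv (transpose (M ** D_mat V))) *v x = shear V (matrix_inv M *v x)"
proof -
  define A where "A = M ** D_mat V"
  define B where "B = transpose (matrix_inv (transpose A))"
  have "invertible (transpose A)"
    using det by (simp add: invertible_det_nz A_def det_mul det_D_mat)
  then have "transpose (matrix_inv (transpose A) ** transpose A) = mat 1"
    by (simp add: matrix_inv transpose_mat)
  then have "A ** B = mat 1"
    by (simp add: matrix_transpose_mul B_def transpose_transpose)
  then have "A *v (B *v x) = x"
    by (simp add: matrix_vector_mul_assoc)
  then have "M *v (D_mat V *v (B *v x)) = x"
    by (simp add: A_def matrix_vector_mul_assoc matrix_mul_assoc)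
  then have "D_mat V *v (B *v x) = matrix_inv M *v x"
    using matrix_inv_mult[OF det] by metis
  then show ?thesis
    unfolding A_def[symmetric] B_def[symmetric] by (metis shear_D_mat)
qed

text \<open>Only integer points \<open>n\<close> with \<open>u n\<close> in the unit cell
  contribute. Each coset of the image of the integer lattice under \<open>M\<close> contains exactly
  one of them, because adding \<open>M *v k\<close> moves \<open>u n\<close> by
  \<open>shear V k\<close>, which runs through all integer vectors. At that point \<open>u\<close>
  is a vector of fractional parts, so the factors become values of the periodic
  \<open>bern\<close>.\<close>

lemma bern_mat_sum:
  fixes M :: "real^'n::{finite,wellorder}^'n::_"
  assumes int: "\<And>i k. M $ i $ k \<in> \<int>" and det: "det M \<noteq> 0"
  shows "(\<Sum>\<^sub>\<infinity>n\<in>int_lattice. bern_mat J (transpose (M ** D_mat V)) (z + n))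
    = (\<Sum>r\<in>coset_reps M. \<Prod>k\<in>UNIV. bern (J k) (shear V (matrix_inv M *v z + r) $ k)) / \<bar>det M\<bar>"
proof -
  let ?I = "matrix_inv M"
  define u where "u n = shear V (?I *v (z + n))" for n
  define N where "N = {n \<in> int_lattice. u n \<in> unit_cell}"
  \<comment> \<open>The contributing point of the coset of \<open>r\<close>: \<open>D_mat V\<close>
    converts the floor of the sheared vector into the integer correction before shearing.\<close>
  define g where "g r = M *v (r - D_mat V *v vfloor (shear V (?I *v z + r)))" for r
  have DZ: "D_mat V *v x \<in> int_lattice" if "x \<in> int_lattice" for x
    using int_lattice_mult[OF D_mat_Ints that] .
  have Ig: "?I *v g r = r - D_mat V *v vfloor (shear V (?I *v z + r))" for r
    by (simp add: g_def matrix_inv_mult[OF det])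
  have ug: "u (g r) = shear V (?I *v z + r) - vfloor (shear V (?I *v z + r))" for r
    by (simp add: u_def matrix_vector_right_distrib Ig shear_linear shear_D_mat add_diff_eq)
  have bij: "bij_betw g (coset_reps M) N"
  proof (rule bij_betw_byWitness[where f' = "\<lambda>n. ?I *v n - vfloor (?I *v n)"])
    show "\<forall>r\<in>coset_reps M. ?I *v g r - vfloor (?I *v g r) = r"
    proof
      fix r assume r: "r \<in> coset_reps M"
      have "vfloor (?I *v g r) = - (D_mat V *v vfloor (shear V (?I *v z + r)))"
        using r int_lattice_diff[OF _ DZ[OF vfloor_int_lattice], of 0] unfolding Ig
        by (intro vfloor_unique) (auto simp: coset_reps_def int_lattice_def)
      then show "?I *v g r - vfloor (?I *v g r) = r"
        by (simp add: Ig)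
    qed
    show "\<forall>n\<in>N. g (?I *v n - vfloor (?I *v n)) = n"
    proof
      fix n assume n: "n \<in> N"
      let ?m = "vfloor (?I *v n)"
      have "shear V (?I *v z + (?I *v n - ?m)) = u n - shear V ?m"
        by (simp add: u_def matrix_vector_right_distrib shear_linear algebra_simps)
      moreover have "vfloor (u n - shear V ?m) = - shear V ?m"
        using n int_lattice_diff[OF _ int_lattice_shear[OF vfloor_int_lattice], of 0]
        by (intro vfloor_unique) (auto simp: N_def int_lattice_def)
      ultimately have "g (?I *v n - ?m) = M *v (?I *v n - ?m - D_mat V *v (- shear V ?m))"
        by (simp add: g_def)
      also have "D_mat V *v (- shear V ?m) = - ?m"
        using D_mat_shear[of V "- ?m"] shear_linear(3)[of V "-1" ?m] by simp
      finally show "g (?I *v n - ?m) = n"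
        by (simp add: mult_matrix_inv[OF det])
    qed
    show "g ` coset_reps M \<subseteq> N"
    proof clarify
      fix r assume "r \<in> coset_reps M"
      then have "M *v r - M *v (D_mat V *v vfloor (shear V (?I *v z + r))) \<in> int_lattice"
        by (intro int_lattice_diff[OF _ int_lattice_mult[OF int DZ[OF vfloor_int_lattice]]]) (simp add: coset_reps_def)
      then show "g r \<in> N"
        by (simp add: N_def ug diff_vfloor_in_unit_cell) (simp add: g_def matrix_vector_mult_diff_distrib)
    qed
    show "(\<lambda>n. ?I *v n - vfloor (?I *v n)) ` N \<subseteq> coset_reps M"
    proof clarify
      fix n assume "n \<in> N"
      then have "n - M *v vfloor (?I *v n) \<in> int_lattice"
        by (intro int_lattice_diff int_lattice_mult[OF int] vfloor_int_lattice) (simp add: N_def)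
      then show "?I *v n - vfloor (?I *v n) \<in> coset_reps M"
        by (simp add: coset_reps_def diff_vfloor_in_unit_cell matrix_vector_mult_diff_distrib mult_matrix_inv[OF det])
    qed
  qed
  have fin: "finite N"
    using bij_betw_finite[OF bij] card_coset_reps(1)[OF int det] by blast
  have det': "det (transpose (M ** D_mat V)) = det M"
    by (simp add: det_mul det_D_mat)
  have summand: "bern_mat J (transpose (M ** D_mat V)) (z + n) = bern_multi J (u n) / \<bar>det M\<bar>" for n
    unfolding bern_mat_def transpose_inv_mult[OF det] det' u_def ..
  have "(\<Sum>\<^sub>\<infinity>n\<in>int_lattice. bern_mat J (transpose (M ** D_mat V)) (z + n))
      = (\<Sum>\<^sub>\<infinity>n\<in>N. bern_multi J (u n) / \<bar>det M\<bar>)"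
    by (rule infsum_cong_neutral) (auto simp: summand N_def unit_cell_def bern_multi_def)
  also have "\<dots> = (\<Sum>n\<in>N. bern_multi J (u n) / \<bar>det M\<bar>)"
    using fin by simp
  also have "\<dots> = (\<Sum>r\<in>coset_reps M. bern_multi J (u (g r)) / \<bar>det M\<bar>)"
    by (rule sum.reindex_bij_betw[OF bij, symmetric])
  moreover have "bern_multi J (u (g r)) = (\<Prod>k\<in>UNIV. bern (J k) (shear V (?I *v z + r) $ k))" for r
  proof -
    have "u (g r) \<in> unit_cell"
      by (simp add: ug diff_vfloor_in_unit_cell)
    moreover have "u (g r) $ k = frac (shear V (?I *v z + r) $ k)" for k
      by (simp add: ug vfloor_def frac_def)
    ultimately show ?thesis
      by (simp add: bern_multi_def unit_cell_def bern_frac)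
  qed
  ultimately show ?thesis
    by (simp add: sum_divide_distrib)
qed

lemma face_points_CARD:
  "face_points CARD('n) \<xi> \<tau> = {x \<in> std_simplex. \<tau> *\<^sub>R x - (\<xi> :: real^'n::{finite,wellorder}) \<in> int_lattice}"
proof -
  have "(\<forall>i<CARD('n). \<tau> * x $ idx i - \<xi> $ idx i \<in> \<int>) \<longleftrightarrow> (\<forall>k. \<tau> * x $ k - \<xi> $ k \<in> \<int>)" for x
    by (metis idx_cases)
  then show ?thesis
    by (simp add: face_points_def face_CARD int_lattice_def)
qed

text \<open>If \<open>n + z\<close> is \<open>\<tau>\<close> times \<open>M *v x\<close>, then
  \<open>\<tau> *\<^sub>R x\<close> is the sum of the images of \<open>n\<close> and
  \<open>z\<close> under the inverse of \<open>M\<close>. The coset of the first image is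
  \<open>r\<close>, so \<open>x\<close> lies on the grid with shift
  \<open>matrix_inv M *v z + r\<close>.\<close>

lemma bij_betw_lattice_points:
  fixes M :: "real^'n::{finite,wellorder}^'n::_"
  assumes int: "\<And>i k. M $ i $ k \<in> \<int>" and det: "det M \<noteq> 0" and \<tau>: "\<tau> \<noteq> 0"
  shows "bij_betw (\<lambda>(r, x). \<tau> *\<^sub>R (M *v x) - z)
    (SIGMA r:coset_reps M. face_points CARD('n) (matrix_inv M *v z + r) \<tau>)
    {n \<in> int_lattice. n + z \<in> (\<lambda>x. \<tau> *\<^sub>R (M *v x)) ` std_simplex}"
proof -
  let ?I = "matrix_inv M"
  let ?A = "SIGMA r:coset_reps M. face_points CARD('n) (?I *v z + r) \<tau>"
  let ?B = "{n \<in> int_lattice. n + z \<in> (\<lambda>x. \<tau> *\<^sub>R (M *v x)) ` std_simplex}"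
  let ?f = "\<lambda>(r, x). \<tau> *\<^sub>R (M *v x) - z"
  let ?g = "\<lambda>n. (?I *v n - vfloor (?I *v n), (1 / \<tau>) *\<^sub>R (?I *v (n + z)))"
  have inv: "?I *v (\<tau> *\<^sub>R (M *v x) - z) = \<tau> *\<^sub>R x - ?I *v z" for x
    by (simp add: matrix_vector_linear matrix_inv_mult[OF det])
  show ?thesis
  proof (rule bij_betw_byWitness[where f' = ?g])
    show "\<forall>a\<in>?A. ?g (?f a) = a"
    proof clarify
      fix r x assume r: "r \<in> coset_reps M" and x: "x \<in> face_points CARD('n) (?I *v z + r) \<tau>"
      have "vfloor (\<tau> *\<^sub>R x - ?I *v z) = \<tau> *\<^sub>R x - (?I *v z + r)"
        using r x by (intro vfloor_unique) (auto simp: face_points_CARD coset_reps_def)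
      then show "?I *v (\<tau> *\<^sub>R (M *v x) - z) - vfloor (?I *v (\<tau> *\<^sub>R (M *v x) - z)) = r \<and>
          (1 / \<tau>) *\<^sub>R (?I *v ((\<tau> *\<^sub>R (M *v x) - z) + z)) = x"
        using \<tau> by (simp add: inv matrix_vector_mult_scaleR matrix_inv_mult[OF det])
    qed
    show "\<forall>n\<in>?B. ?f (?g n) = n"
      using \<tau> by (simp add: matrix_vector_mult_scaleR mult_matrix_inv[OF det])
    show "?f ` ?A \<subseteq> ?B"
    proof clarify
      fix r x assume r: "r \<in> coset_reps M" and x: "x \<in> face_points CARD('n) (?I *v z + r) \<tau>"
      have "M *v r + M *v (\<tau> *\<^sub>R x - (?I *v z + r)) \<in> int_lattice"
        using r x by (intro int_lattice_add[OF _ int_lattice_mult[OF int]]) (auto simp: face_points_CARD coset_reps_def)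
      then have "\<tau> *\<^sub>R (M *v x) - z \<in> int_lattice"
        by (simp add: matrix_vector_linear mult_matrix_inv[OF det])
      then show "\<tau> *\<^sub>R (M *v x) - z \<in> int_lattice \<and> \<tau> *\<^sub>R (M *v x) - z + z \<in> (\<lambda>x. \<tau> *\<^sub>R (M *v x)) ` std_simplex"
        using x by (auto simp: face_points_CARD)
    qed
    show "?g ` ?B \<subseteq> ?A"
    proof (rule image_subsetI)
      fix n assume "n \<in> ?B"
      then obtain x where n: "n \<in> int_lattice" and x: "x \<in> std_simplex" "n + z = \<tau> *\<^sub>R (M *v x)"
        by auto
      have "n - M *v vfloor (?I *v n) \<in> int_lattice"
        by (intro int_lattice_diff int_lattice_mult[OF int] vfloor_int_lattice n)
      then have r: "?I *v n - vfloor (?I *v n) \<in> coset_reps M"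
        by (simp add: coset_reps_def diff_vfloor_in_unit_cell matrix_vector_mult_diff_distrib mult_matrix_inv[OF det])
      have "(1 / \<tau>) *\<^sub>R (?I *v (n + z)) = x"
        using \<tau> by (simp add: x(2) matrix_vector_mult_scaleR matrix_inv_mult[OF det])
      moreover have "\<tau> *\<^sub>R x = ?I *v (n + z)"
        by (simp add: x(2) matrix_vector_mult_scaleR matrix_inv_mult[OF det])
      then have m: "\<tau> *\<^sub>R x - (?I *v z + (?I *v n - vfloor (?I *v n))) = vfloor (?I *v n)"
        by (simp add: matrix_vector_right_distrib)
      have "x \<in> face_points CARD('n) (?I *v z + (?I *v n - vfloor (?I *v n))) \<tau>"
        unfolding face_points_CARD mem_Collect_eq m by (simp add: x(1) vfloor_int_lattice)
      ultimately show "?g n \<in> ?A"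
        using r by simp
    qed
  qed
qed

section \<open>Averages over small balls\<close>

text \<open>Dominated convergence on the ball, through sequences tending to 0. Existence of the
  limit is part of the argument, since \<open>Lim\<close> says nothing about a divergent
  expression.\<close>

lemma
  fixes F :: "real^'n \<Rightarrow> real"
  assumes F: "F \<in> borel_measurable borel" and C: "\<And>x. \<bar>F x\<bar> \<le> C"
    and L: "\<And>y. ((\<lambda>\<epsilon>. F (x - \<epsilon> *\<^sub>R y)) \<longlongrightarrow> L y) (at_right 0)"
  shows regularize_eq: "regularize F x = (LINT y:cball 0 1|lborel. L y) / measure lborel (cball (0 :: real^'n) 1)"
    and set_integrable_directional_limit: "set_integrable lborel (cball 0 1) L"
proof -
  have L_seq: "(\<lambda>n. F (x - S n *\<^sub>R y)) \<longlonglongrightarrow> L y" if "\<And>n. 0 < S n" "S \<longlonglongrightarrow> 0" for S y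
    using that that(1)[THEN less_imp_neq] by (intro filterlim_compose[OF L]) (auto simp: filterlim_at)
  have mF: "(\<lambda>y. F (x - \<epsilon> *\<^sub>R y)) \<in> borel_measurable lborel" for \<epsilon>
    using F by measurable
  have mL: "L \<in> borel_measurable lborel"
  proof (rule borel_measurable_LIMSEQ_real)
    show "(\<lambda>n. F (x - (1 / real (Suc n)) *\<^sub>R y)) \<longlonglongrightarrow> L y" for y
      by (rule L_seq[OF _ lim_1_over_n[THEN LIMSEQ_Suc]]) simp
    show "(\<lambda>y. F (x - (1 / real (Suc n)) *\<^sub>R y)) \<in> borel_measurable lborel" for n
      by (rule mF)
  qed
  have dom: "integrable lborel (\<lambda>y. indicator (cball 0 1 :: (real^'n) set) y *\<^sub>R C)"
    using emeasure_bounded_finite[of "cball 0 1 :: (real^'n) set"] by (intro integrable_scaleR_left) auto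
  have conv: "(\<lambda>n. LINT y:cball 0 1|lborel. F (x - S n *\<^sub>R y)) \<longlonglongrightarrow> (LINT y:cball 0 1|lborel. L y)"
    if "\<And>n. 0 < S n" "S \<longlonglongrightarrow> 0" for S
    unfolding set_lebesgue_integral_def
  proof (rule integral_dominated_convergence[OF _ _ dom])
    show "AE y in lborel. (\<lambda>n. indicat_real (cball 0 1) y *\<^sub>R F (x - S n *\<^sub>R y)) \<longlonglongrightarrow> indicat_real (cball 0 1) y *\<^sub>R L y"
      using L_seq[OF that] by (intro AE_I2 tendsto_intros)
    show "AE y in lborel. norm (indicat_real (cball 0 1) y *\<^sub>R F (x - S n *\<^sub>R y)) \<le> indicat_real (cball 0 1) y *\<^sub>R C" for n
      using C by (intro AE_I2) (auto simp: indicator_def)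
    show "(\<lambda>y. indicat_real (cball 0 1) y *\<^sub>R L y) \<in> borel_measurable lborel"
      by (intro borel_measurable_scaleR borel_measurable_indicator mL) simp
    show "(\<lambda>y. indicat_real (cball 0 1) y *\<^sub>R F (x - S n *\<^sub>R y)) \<in> borel_measurable lborel" for n
      by (intro borel_measurable_scaleR borel_measurable_indicator mF) simp
  qed
  have "((\<lambda>\<epsilon>. LINT y:cball 0 1|lborel. F (x - \<epsilon> *\<^sub>R y)) \<longlongrightarrow> (LINT y:cball 0 1|lborel. L y)) (at_right 0)"
    by (rule tendsto_at_right_sequentially[of 0 1]) (auto intro: conv)
  then have "((\<lambda>\<epsilon>. (LINT y:cball 0 1|lborel. F (x - \<epsilon> *\<^sub>R y)) / measure lborel (cball (0 :: real^'n) 1))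
      \<longlongrightarrow> (LINT y:cball 0 1|lborel. L y) / measure lborel (cball (0 :: real^'n) 1)) (at_right 0)"
    unfolding divide_inverse by (rule tendsto_mult_right)
  then show "regularize F x = (LINT y:cball 0 1|lborel. L y) / measure lborel (cball (0 :: real^'n) 1)"
    unfolding regularize_def by (intro tendsto_Lim) auto
  have "\<bar>L y\<bar> \<le> C" for y
    by (rule tendsto_upperbound[OF tendsto_rabs[OF L]]) (auto intro!: always_eventually C)
  then show "set_integrable lborel (cball 0 1) L"
    unfolding set_integrable_def
    using mL by (intro Bochner_Integration.integrable_bound[OF dom])
      (auto simp: indicator_def intro!: AE_I2 order_trans[OF _ abs_ge_self])
qed

text \<open>Integrability is bundled with the value so that finite linear combinations of
  directional limits can be averaged term by term.\<close>

definition has_ball_average :: "(real^'n \<Rightarrow> real) \<Rightarrow> real \<Rightarrow> bool" where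
  "has_ball_average g a \<longleftrightarrow> set_integrable lborel (cball 0 1) g
     \<and> a = (LINT y:cball 0 1|lborel. g y) / measure lborel (cball (0 :: real^'n) 1)"

lemma has_ball_average_cmult: "has_ball_average g a \<Longrightarrow> has_ball_average (\<lambda>y. c * g y) (c * a)"
  by (auto simp: has_ball_average_def)

lemma has_ball_average_diff:
  "has_ball_average g a \<Longrightarrow> has_ball_average h b \<Longrightarrow> has_ball_average (\<lambda>y. g y - h y) (a - b)"
  by (auto simp: has_ball_average_def diff_divide_distrib)

lemma has_ball_average_sum:
  "(\<And>i. i \<in> S \<Longrightarrow> has_ball_average (g i) (a i)) \<Longrightarrow> has_ball_average (\<lambda>y. \<Sum>i\<in>S. g i y) (\<Sum>i\<in>S. a i)"
proof (induction S rule: infinite_finite_induct)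
  case (insert i S)
  then have "has_ball_average (\<lambda>y. g i y - (-1) * (\<Sum>i\<in>S. g i y)) (a i - (-1) * (\<Sum>i\<in>S. a i))"
    by (intro has_ball_average_diff has_ball_average_cmult) auto
  then show ?case
    using insert.hyps by simp
qed (simp_all add: has_ball_average_def set_integrable_def)

text \<open>A bound almost everywhere on the ball suffices, which allows the exceptional hyperplanes
  of directions to be discarded.\<close>

lemma has_ball_average_le:
  fixes g :: "real^'n \<Rightarrow> real"
  assumes g: "has_ball_average g a" and B: "AE y in lborel. y \<in> cball 0 1 \<longrightarrow> \<bar>g y\<bar> \<le> B" and "B \<ge> 0"
  shows "\<bar>a\<bar> \<le> B"
proof -
  have fin: "emeasure lborel (cball 0 1 :: (real^'n) set) < \<infinity>"
    by (rule emeasure_bounded_finite) simp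
  have "norm (LINT y:cball 0 1|lborel. g y) \<le> (LINT y|lborel. indicator (cball 0 1 :: (real^'n) set) y *\<^sub>R B)"
    unfolding set_lebesgue_integral_def
  proof (rule order_trans[OF integral_norm_bound integral_mono_AE])
    show "integrable lborel (\<lambda>y. norm (indicat_real (cball 0 1) y *\<^sub>R g y))"
      using g by (intro integrable_norm) (simp add: set_integrable_def has_ball_average_def)
    show "integrable lborel (\<lambda>y. indicat_real (cball 0 1 :: (real^'n) set) y *\<^sub>R B)"
      using fin by (intro integrable_scaleR_left) auto
  qed (use B in \<open>auto simp: indicator_def elim: eventually_mono\<close>)
  also have "\<dots> = measure lborel (cball (0 :: real^'n) 1) * B"
    using fin by simp
  finally have "\<bar>LINT y:cball 0 1|lborel. g y\<bar> \<le> measure lborel (cball (0 :: real^'n) 1) * B"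
    by simp
  \<comment> \<open>For measure 0 the quotient would be 0 by convention and the claim
    \<open>0 \<le> B\<close>.\<close>
  then have "\<bar>LINT y:cball 0 1|lborel. g y\<bar> / measure lborel (cball (0 :: real^'n) 1) \<le> B"
    using assms(3) by (cases "measure lborel (cball (0 :: real^'n) 1) = 0")
      (simp_all add: divide_le_eq mult.commute zero_less_measure_iff)
  then show ?thesis
    using g by (simp add: has_ball_average_def abs_divide)
qed

text \<open>By convexity a ray from a point of \<open>A\<close> either stays in \<open>A\<close> on
  an initial segment or leaves it at once; from a point outside, closedness keeps the ray outside
  for a while.\<close>

lemma indicator_directional_limit:
  fixes A :: "'a::real_normed_vector set"
  assumes "convex A" "closed A"
  shows "\<exists>l. ((\<lambda>\<epsilon>. indicat_real A (x - \<epsilon> *\<^sub>R y)) \<longlongrightarrow> l) (at_right 0)"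
    and "x \<notin> A \<Longrightarrow> ((\<lambda>\<epsilon>. indicat_real A (x - \<epsilon> *\<^sub>R y)) \<longlongrightarrow> 0) (at_right 0)"
proof -
  show out: "((\<lambda>\<epsilon>. indicat_real A (x - \<epsilon> *\<^sub>R y)) \<longlongrightarrow> 0) (at_right 0)" if "x \<notin> A"
  proof -
    have "((\<lambda>\<epsilon>. x - \<epsilon> *\<^sub>R y) \<longlongrightarrow> x - 0 *\<^sub>R y) (at_right 0)"
      by (intro tendsto_intros)
    then have "\<forall>\<^sub>F \<epsilon> in at_right 0. x - \<epsilon> *\<^sub>R y \<in> - A"
      using that assms(2) by (intro topological_tendstoD) (auto simp: open_Compl)
    then show ?thesis
      by (intro tendsto_eventually) (auto elim!: eventually_mono)
  qed
  show "\<exists>l. ((\<lambda>\<epsilon>. indicat_real A (x - \<epsilon> *\<^sub>R y)) \<longlongrightarrow> l) (at_right 0)"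
  proof (cases "x \<in> A \<and> (\<exists>\<epsilon>>0. x - \<epsilon> *\<^sub>R y \<in> A)")
    case True
    then obtain \<epsilon>0 where e0: "\<epsilon>0 > 0" "x - \<epsilon>0 *\<^sub>R y \<in> A" "x \<in> A"
      by auto
    have "x - \<epsilon> *\<^sub>R y \<in> A" if "0 < \<epsilon>" "\<epsilon> < \<epsilon>0" for \<epsilon>
    proof -
      have "(1 - \<epsilon> / \<epsilon>0) *\<^sub>R x + (\<epsilon> / \<epsilon>0) *\<^sub>R (x - \<epsilon>0 *\<^sub>R y) \<in> A"
        using that e0 by (intro convexD[OF assms(1)]) auto
      then show ?thesis
        using e0 by (simp add: algebra_simps)
    qed
    moreover have "\<forall>\<^sub>F \<epsilon> in at_right 0. \<epsilon> < \<epsilon>0"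
      using e0 by (intro order_tendstoD(2)[OF tendsto_ident_at])
    ultimately have "\<forall>\<^sub>F \<epsilon> in at_right 0. indicat_real A (x - \<epsilon> *\<^sub>R y) = 1"
      using eventually_at_right_less[of 0] by (auto elim!: eventually_elim2)
    then show ?thesis
      by (intro exI[of _ 1] tendsto_eventually)
  next
    case False
    then consider "x \<notin> A" | "\<And>\<epsilon>. \<epsilon> > 0 \<Longrightarrow> x - \<epsilon> *\<^sub>R y \<notin> A"
      by blast
    then show ?thesis
    proof cases
      case 2
      have "\<forall>\<^sub>F \<epsilon> in at_right 0. indicat_real A (x - \<epsilon> *\<^sub>R y) = 0"
        using eventually_at_right_less[of 0] by eventually_elim (simp add: 2)
      then show ?thesis
        by (intro exI[of _ 0] tendsto_eventually)
    qed (use out in blast)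
  qed
qed

section \<open>Geometry of the dilated simplex\<close>

lemma std_simplex_hull: "(std_simplex :: (real^'n) set) = convex hull (insert 0 (range (\<lambda>k. axis k 1)))"
proof -
  have B: "Basis = range (\<lambda>k. axis k (1::real)) "
    by (auto simp: Basis_vec_def)
  have "(std_simplex :: (real^'n) set) = {x. (\<forall>i\<in>Basis. 0 \<le> x \<bullet> i) \<and> (\<Sum>i\<in>Basis. x \<bullet> i) \<le> 1}"
    unfolding B by (auto simp: Defs.std_simplex_def inner_axis sum.reindex inj_on_def axis_eq_axis)
  then show ?thesis
    using std_simplex[where 'a = "real^'n"] by (simp add: B)
qed

lemma simplex_of_eq: "simplex_of M = (*v) M ` std_simplex"
proof -
  have "(*v) M ` insert 0 (range (\<lambda>k. axis k 1)) = insert 0 (range (\<lambda>k. column k M))"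
    by (auto simp: matrix_vector_mult_basis image_image)
  then show ?thesis
    unfolding std_simplex_hull simplex_of_def
    by (metis convex_hull_linear_image matrix_vector_mul_linear)
qed

lemma compact_std_simplex: "compact (std_simplex :: (real^'n) set)"
  unfolding std_simplex_hull by (intro compact_convex_hull finite_imp_compact) auto

lemma convex_std_simplex: "convex (std_simplex :: (real^'n) set)"
  unfolding std_simplex_hull by (rule convex_convex_hull)

lemma dilated_simplex:
  fixes M :: "real^'n^'n" and \<tau> :: real
  defines "A \<equiv> (*\<^sub>R) \<tau> ` simplex_of M"
  shows "A = (\<lambda>x. \<tau> *\<^sub>R (M *v x)) ` std_simplex" "convex A" "closed A" "bounded A"
proof -
  show eq: "A = (\<lambda>x. \<tau> *\<^sub>R (M *v x)) ` std_simplex"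
    by (simp add: A_def simplex_of_eq image_image)
  have "compact A"
    unfolding eq by (intro compact_continuous_image compact_std_simplex continuous_intros
        linear_continuous_on matrix_vector_mul_bounded_linear)
  then show "closed A" "bounded A"
    by (simp_all add: compact_imp_closed compact_imp_bounded)
  show "convex A"
    unfolding A_def simplex_of_eq
    by (intro convex_scaling convex_linear_image convex_std_simplex matrix_vector_mul_linear)
qed

lemma finite_int_lattice_bounded:
  fixes S :: "(real^'n) set"
  assumes "bounded S"
  shows "finite (int_lattice \<inter> S)"
proof -
  obtain B where B: "\<And>x. x \<in> S \<Longrightarrow> norm x \<le> B"
    using assms by (auto simp: bounded_iff)
  have "int_lattice \<inter> S \<subseteq> (\<lambda>f. \<chi> k. of_int (f k)) ` (\<Pi>\<^sub>E k\<in>UNIV. {- \<lceil>B\<rceil>..\<lceil>B\<rceil>})"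
  proof
    fix x assume x: "x \<in> int_lattice \<inter> S"
    then have "\<forall>k. \<exists>m::int. x $ k = of_int m"
      by (auto simp: int_lattice_def elim: Ints_cases)
    then obtain f where f: "\<And>k. x $ k = of_int (f k)"
      by metis
    have "f k \<in> {- \<lceil>B\<rceil>..\<lceil>B\<rceil>}" for k
    proof -
      have "\<bar>of_int (f k)\<bar> \<le> B"
        using component_le_norm_cart[of x k] B[of x] x f by force
      then show ?thesis
        by auto linarith+
    qed
    then show "x \<in> (\<lambda>f. \<chi> k. of_int (f k)) ` (\<Pi>\<^sub>E k\<in>UNIV. {- \<lceil>B\<rceil>..\<lceil>B\<rceil>})"
      by (intro image_eqI[of _ _ f]) (auto simp: vec_eq_iff f)
  qed
  then show ?thesis
    by (rule finite_subset) (intro finite_imageI finite_PiE; simp)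
qed

text \<open>By \<open>bern_mat_sum\<close> this is \<open>\<bar>det M\<bar>\<close> times the
  function that \<open>bern_periodized\<close> regularizes for the matrix
  \<open>transpose (M ** D_mat V)\<close>.\<close>

definition periodized_product :: "real^'n::{finite,wellorder}^'n::_ \<Rightarrow> ('n \<Rightarrow> nat) \<Rightarrow> ('n \<Rightarrow> nat) \<Rightarrow> real^'n::_ \<Rightarrow> real" where
  "periodized_product M V J z = (\<Sum>r\<in>coset_reps M. \<Prod>k\<in>UNIV. bern (J k) (shear V (matrix_inv M *v z + r) $ k))"

lemma borel_measurable_vec_nth_affine:
  fixes M :: "real^'n::{finite,wellorder}^'n::_"
  shows "(\<lambda>z. shear V (matrix_inv M *v z + r) $ k) \<in> borel_measurable borel"
proof -
  define w where "w z = matrix_inv M *v z + r" for z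
  have "continuous_on UNIV w"
    unfolding w_def by (intro continuous_intros linear_continuous_on matrix_vector_mul_bounded_linear)
  then have "continuous_on UNIV (\<lambda>z. shear V (w z) $ k)"
    unfolding shear_def by (cases "V k = 1") (auto intro!: continuous_intros)
  then have "continuous_on UNIV (\<lambda>z. shear V (matrix_inv M *v z + r) $ k)"
    by (simp only: w_def)
  then show ?thesis
    by (rule borel_measurable_continuous_onI)
qed

lemma periodized_product_measurable:
  fixes M :: "real^'n::{finite,wellorder}^'n::_"
  shows "periodized_product M V J \<in> borel_measurable borel"
  unfolding periodized_product_def[abs_def]
  by (intro borel_measurable_sum borel_measurable_prod measurable_compose[OF borel_measurable_vec_nth_affine borel_measurable_bern])

lemma periodized_product_bounded:
  fixes M :: "real^'n::{finite,wellorder}^'n::_"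
  shows "\<exists>C. \<forall>z. \<bar>periodized_product M V J z\<bar> \<le> C"
proof -
  have "\<forall>k. \<exists>C. \<forall>x. \<bar>bern (J k) x\<bar> \<le> C"
    using bern_bounded by blast
  then obtain C where C: "\<And>k x. \<bar>bern (J k) x\<bar> \<le> C k"
    by metis
  have "\<bar>periodized_product M V J z\<bar> \<le> (\<Sum>r\<in>coset_reps M. \<Prod>k\<in>UNIV. C k)" for z
    unfolding periodized_product_def
    by (rule order_trans[OF sum_abs], rule sum_mono) (auto simp: abs_prod C intro!: prod_mono)
  then show ?thesis
    by blast
qed

lemma shear_along_line:
  fixes M :: "real^'n::{finite,wellorder}^'n::_"
  shows "shear V (matrix_inv M *v (x - \<epsilon> *\<^sub>R y) + r) $ k
    = shear V (matrix_inv M *v x + r) $ k + \<epsilon> * - (shear V (matrix_inv M *v y) $ k)"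
  by (simp add: matrix_vector_linear shear_linear)

text \<open>Along a ray every Bernoulli argument is affine in \<open>\<epsilon>\<close>, so each
  factor has a one-sided limit.\<close>

lemma periodized_product_directional_limit:
  fixes M :: "real^'n::{finite,wellorder}^'n::_"
  shows "\<exists>l. ((\<lambda>\<epsilon>. periodized_product M V J (x - \<epsilon> *\<^sub>R y)) \<longlongrightarrow> l) (at_right 0)"
proof -
  have "\<forall>r k. \<exists>l. ((\<lambda>\<epsilon>. bern (J k) (shear V (matrix_inv M *v (x - \<epsilon> *\<^sub>R y) + r) $ k)) \<longlongrightarrow> l) (at_right 0)"
    unfolding shear_along_line using bern_directional_limit by blast
  then obtain l where l: "\<And>r k. ((\<lambda>\<epsilon>. bern (J k) (shear V (matrix_inv M *v (x - \<epsilon> *\<^sub>R y) + r) $ k)) \<longlongrightarrow> l r k) (at_right 0)"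
    by metis
  have "((\<lambda>\<epsilon>. periodized_product M V J (x - \<epsilon> *\<^sub>R y)) \<longlongrightarrow> (\<Sum>r\<in>coset_reps M. \<Prod>k\<in>UNIV. l r k)) (at_right 0)"
    unfolding periodized_product_def by (intro tendsto_sum tendsto_prod l)
  then show ?thesis ..
qed

section \<open>The remainder\<close>

lemma has_ball_average_regularize:
  fixes F :: "real^'n \<Rightarrow> real"
  assumes "F \<in> borel_measurable borel" "\<And>x. \<bar>F x\<bar> \<le> C"
    "\<And>y. ((\<lambda>\<epsilon>. F (x - \<epsilon> *\<^sub>R y)) \<longlongrightarrow> L y) (at_right 0)"
  shows "has_ball_average L (regularize F x)"
  using regularize_eq[OF assms] set_integrable_directional_limit[OF assms] by (simp add: has_ball_average_def)

text \<open>The two constant choices of \<open>V\<close> already produce all coordinates and all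
  partial sums.\<close>

lemma generic_shear:
  fixes \<xi> :: "real^'n::{finite,wellorder}"
  assumes "\<And>k. shear (\<lambda>_. 1) \<xi> $ k \<notin> \<int>" "\<And>k. shear (\<lambda>_. 2) \<xi> $ k \<notin> \<int>"
  shows "generic \<xi>"
  unfolding generic_def
proof (intro allI impI)
  fix h v :: nat assume h: "h < CARD('n)"
  have "bern_arg h v \<xi> = bern_arg h (if v = 1 then 1 else 2) \<xi>"
    by (simp add: bern_arg_def)
  then show "bern_arg h v \<xi> \<notin> \<int>"
    using assms[of "idx h"] bern_arg_idx[OF h, of "\<lambda>_. 1" \<xi>] bern_arg_idx[OF h, of "\<lambda>_. 2" \<xi>] by auto
qed

lemma shear_nonint:
  fixes \<xi> :: "real^'n::{finite,wellorder}"
  assumes "generic \<xi>"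
  shows "shear V \<xi> $ k \<notin> \<int>"
proof -
  obtain i where i: "i < CARD('n)" "k = idx i"
    by (rule idx_cases)
  then show ?thesis
    using assms unfolding generic_def by (metis bern_arg_idx)
qed

text \<open>The excluded directions form a hyperplane: \<open>shear V\<close> composed with the
  inverse of \<open>M\<close> is invertible, so its rows are nonzero. Off these hyperplanes every
  Bernoulli argument really moves along the ray and becomes nonintegral at once.\<close>

lemma AE_shear_nonzero:
  fixes M :: "real^'n::{finite,wellorder}^'n::_"
  assumes det: "det M \<noteq> 0"
  shows "AE y in lborel. shear V (matrix_inv M *v y) $ k \<noteq> 0"
proof -
  define B where "B = transpose (matrix_inv (transpose (M ** D_mat V)))"
  have B: "B *v y = shear V (matrix_inv M *v y)" for y
    unfolding B_def by (rule transpose_inv_mult[OF det])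
  have "B *v (M *v (D_mat V *v axis k 1)) = axis k 1"
    by (simp add: B matrix_inv_mult[OF det] shear_D_mat)
  then have "(B $ k) \<bullet> (M *v (D_mat V *v axis k 1)) = 1"
    by (metis matrix_vector_mul_component axis_nth)
  then have "B $ k \<noteq> 0"
    by auto
  then have "negligible {y. (B $ k) \<bullet> y = 0}"
    by (intro negligible_hyperplane) auto
  moreover have "closed {y. (B $ k) \<bullet> y = 0}"
    by (rule closed_hyperplane)
  ultimately have "{y. (B $ k) \<bullet> y = 0} \<in> null_sets lborel"
    using null_sets_completion_iff[of "{y. (B $ k) \<bullet> y = 0}" lborel]
    by (simp add: negligible_iff_null_sets borel_closed)
  then have "AE y in lborel. y \<notin> {y. (B $ k) \<bullet> y = 0}"
    by (rule AE_not_in)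
  then show ?thesis
    by (simp add: B[symmetric] matrix_vector_mul_component)
qed

text \<open>The remainder is the ball average of a function of the direction \<open>y\<close>. For
  almost every \<open>y\<close> this function is the limit along \<open>- \<epsilon> y\<close> of
  differences between sums and expansions, one for each coset, up to a term that vanishes in the
  limit; there are at most \<open>\<bar>det M\<bar>\<close> cosets.\<close>

lemma remainder_le:
  fixes M :: "real^'n::{finite,wellorder}^'n::_" and q :: "real^'n::_ \<Rightarrow> real"
  assumes int: "\<And>i k. M $ i $ k \<in> \<int>" and det: "det M \<noteq> 0" and q: "C_class (Suc w) q"
    and g: "C_class (Suc w) (dilated q \<tau> M)" and \<tau>: "\<tau> > 0"
    and E: "\<And>\<xi>. generic \<xi> \<Longrightarrow> \<bar>(\<Sum>x\<in>face_points CARD('n) \<xi> \<tau>. dilated q \<tau> M x)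
      - expansion \<xi> \<tau> CARD('n) w (dilated q \<tau> M)\<bar> \<le> E" and E0: "E \<ge> 0"
  shows "\<bar>remainder M q w \<tau>\<bar> \<le> \<bar>det M\<bar> * E"
proof -
  let ?I = "matrix_inv M" and ?R = "coset_reps M"
  define A where "A = (*\<^sub>R) \<tau> ` simplex_of M"
  have A_eq: "A = (\<lambda>x. \<tau> *\<^sub>R (M *v x)) ` std_simplex"
    unfolding A_def by (rule dilated_simplex(1))
  have A: "convex A" "closed A" "bounded A"
    unfolding A_def by (rule dilated_simplex)+
  obtain B where B: "\<And>x. x \<in> A \<Longrightarrow> norm x \<le> B"
    using A(3) unfolding bounded_iff by blast
  \<comment> \<open>The enlargement by 1 lets the same finite set serve all shifts \<open>z\<close>
    of norm at most 1.\<close>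
  define W where "W = int_lattice \<inter> cball (0 :: real^'n::_) (B + 1)"
  have finW: "finite W"
    unfolding W_def by (rule finite_int_lattice_bounded) simp
  have finR: "finite ?R" and cardR: "real (card ?R) \<le> \<bar>det M\<bar>"
    using card_coset_reps[OF int det] by blast+

  have "\<forall>n y. \<exists>l. ((\<lambda>\<epsilon>. indicat_real A (n - \<epsilon> *\<^sub>R y)) \<longlongrightarrow> l) (at_right 0)"
    using indicator_directional_limit(1)[OF A(1,2)] by blast
  then obtain \<iota> where \<iota>: "\<And>n y. ((\<lambda>\<epsilon>. indicat_real A (n - \<epsilon> *\<^sub>R y)) \<longlongrightarrow> \<iota> n y) (at_right 0)"
    by metis
  have solid: "has_ball_average (\<iota> n) (solid_angle A n)" for n
    unfolding solid_angle_def using A(2)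
    by (intro has_ball_average_regularize[where C = 1] \<iota> borel_measurable_indicator borel_closed)
      (auto simp: indicator_def)
  have solid_0: "solid_angle A n = 0" if "n \<notin> A" for n
  proof -
    have "\<iota> n y = 0" for y
      using tendsto_unique[OF _ \<iota> indicator_directional_limit(2)[OF A(1,2) that]] by simp
    then show ?thesis
      using solid[of n] by (simp add: has_ball_average_def set_lebesgue_integral_def)
  qed
  have lattice: "lattice_sum M q \<tau> = (\<Sum>n\<in>W. q n * solid_angle A n)"
  proof -
    have "lattice_sum M q \<tau> = (\<Sum>\<^sub>\<infinity>n\<in>W. q n * solid_angle A n)"
      unfolding lattice_sum_def A_def[symmetric] using B
      by (intro infsum_cong_neutral) (force simp: W_def intro: solid_0)+
    then show ?thesis
      using finW by simp
  qed

  define P where "P V J z = periodized_product M V J z / \<bar>det M\<bar>" for V J z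
  have "\<forall>V J y. \<exists>l. ((\<lambda>\<epsilon>. P V J (0 - \<epsilon> *\<^sub>R y)) \<longlongrightarrow> l) (at_right 0)"
    unfolding P_def
  proof (intro allI)
    fix V J y
    obtain l where "((\<lambda>\<epsilon>. periodized_product M V J (0 - \<epsilon> *\<^sub>R y)) \<longlongrightarrow> l) (at_right 0)"
      using periodized_product_directional_limit by blast
    then have "((\<lambda>\<epsilon>. periodized_product M V J (0 - \<epsilon> *\<^sub>R y) / \<bar>det M\<bar>) \<longlongrightarrow> l / \<bar>det M\<bar>) (at_right 0)"
      using det by (intro tendsto_intros) auto
    then show "\<exists>l. ((\<lambda>\<epsilon>. periodized_product M V J (0 - \<epsilon> *\<^sub>R y) / \<bar>det M\<bar>) \<longlongrightarrow> l) (at_right 0)" ..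
  qed
  then obtain \<beta> where \<beta>: "\<And>V J y. ((\<lambda>\<epsilon>. P V J (0 - \<epsilon> *\<^sub>R y)) \<longlongrightarrow> \<beta> V J y) (at_right 0)"
    by metis
  have bern: "has_ball_average (\<beta> V J) (bern_periodized J (transpose (M ** D_mat V)) 0)" for V J
  proof -
    have eq: "(\<lambda>x. \<Sum>\<^sub>\<infinity>n\<in>int_lattice. bern_mat J (transpose (M ** D_mat V)) (x + n)) = P V J"
      unfolding bern_mat_sum[OF int det] P_def periodized_product_def ..
    obtain C where C: "\<And>z. \<bar>periodized_product M V J z\<bar> \<le> C"
      using periodized_product_bounded by blast
    show ?thesis
      unfolding bern_periodized_def eq
    proof (rule has_ball_average_regularize[OF _ _ \<beta>])
      show "P V J \<in> borel_measurable borel"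
        unfolding P_def by (intro borel_measurable_divide periodized_product_measurable borel_measurable_const)
      show "\<bar>P V J x\<bar> \<le> C / \<bar>det M\<bar>" for x
        unfolding P_def using C[of x] by (simp add: divide_right_mono)
    qed
  qed

  define c where "c V I J = \<tau> powi (int CARD('n) - int (sum I UNIV) - int (sum J UNIV)) * mu V I J (dilated q \<tau> M)"
    for V I J :: "'n \<Rightarrow> nat"
  \<comment> \<open>Lattice sum minus main term as a function of the point weights \<open>a\<close>
    and the Bernoulli values \<open>b\<close>. It is evaluated at the directional limits, where its
    average is the remainder, and at the actual values for small \<open>\<epsilon>\<close>, where
    the expansion applies.\<close>
  define H where "H a b = (\<Sum>n\<in>W. q n * a n) - \<bar>det M\<bar> *
    (\<Sum>V\<in>dirs. \<Sum>I\<in>flags. \<Sum>J\<in>orders w I. c V I J * b V (\<lambda>k. J k + I k))" for a b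
  have "has_ball_average (\<lambda>y. H (\<lambda>n. \<iota> n y) (\<lambda>V J. \<beta> V J y)) (remainder M q w \<tau>)"
    unfolding H_def remainder_def lattice main_term_def dirs_def[symmetric] flags_def[symmetric]
      orders_def[symmetric] c_def[symmetric]
    by (intro has_ball_average_diff has_ball_average_cmult has_ball_average_sum solid bern)
  moreover have "AE y in lborel. y \<in> cball 0 1 \<longrightarrow> \<bar>H (\<lambda>n. \<iota> n y) (\<lambda>V J. \<beta> V J y)\<bar> \<le> \<bar>det M\<bar> * E"
  proof -
    have "AE y in lborel. \<forall>k\<in>UNIV. shear (\<lambda>_. 1) (?I *v y) $ k \<noteq> 0 \<and> shear (\<lambda>_. 2) (?I *v y) $ k \<noteq> 0"
      using AE_shear_nonzero[OF det] by (intro AE_finite_allI AE_conjI) auto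
    then show ?thesis
    proof eventually_elim
      case (elim y)
      show ?case
      proof
        assume y: "y \<in> cball 0 1"
        let ?z = "\<lambda>\<epsilon>. 0 - \<epsilon> *\<^sub>R y"
        have "\<forall>\<^sub>F \<epsilon> in at_right 0. \<forall>r\<in>?R. \<forall>k\<in>UNIV. shear (\<lambda>_. 1) (?I *v ?z \<epsilon> + r) $ k \<notin> \<int>
            \<and> shear (\<lambda>_. 2) (?I *v ?z \<epsilon> + r) $ k \<notin> \<int>"
          unfolding shear_along_line using elim
          by (intro eventually_ball_finite finR finite_class.finite_UNIV ballI eventually_conj eventually_nonint) auto
        then have gen: "\<forall>\<^sub>F \<epsilon> in at_right 0. \<forall>r\<in>?R. generic (?I *v ?z \<epsilon> + r)"
          by eventually_elim (auto intro: generic_shear)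
        have small: "\<forall>\<^sub>F \<epsilon> in at_right 0. 0 < \<epsilon> \<and> \<epsilon> < (1 :: real)"
          by (auto simp: eventually_at_right_less intro!: eventually_conj order_tendstoD(2)[OF tendsto_ident_at])
        \<comment> \<open>\<open>H\<close> keeps the coefficients \<open>q n\<close>, whereas the
          expansion concerns \<open>q\<close> at the shifted points; the last sum is the price and
          tends to 0.\<close>
        have ev: "\<forall>\<^sub>F \<epsilon> in at_right 0. \<bar>H (\<lambda>n. indicat_real A (n - \<epsilon> *\<^sub>R y)) (\<lambda>V J. P V J (?z \<epsilon>))\<bar>
            \<le> \<bar>det M\<bar> * E + (\<Sum>n\<in>W. \<bar>q n - q (n - \<epsilon> *\<^sub>R y)\<bar>)"
          using gen small
        proof eventually_elim
          case (elim \<epsilon>)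
          define z where "z = ?z \<epsilon>"
          have nz: "n - \<epsilon> *\<^sub>R y = n + z" for n
            by (simp add: z_def)
          have "norm z \<le> \<epsilon> * 1"
            unfolding z_def using elim y by (simp add: mult_left_mono)
          then have z1: "norm z \<le> 1"
            using elim by simp
          have gen': "generic (?I *v z + r)" if "r \<in> ?R" for r
            using elim that by (simp add: z_def)
          have "(\<Sum>n\<in>W. q (n + z) * indicat_real A (n + z)) = (\<Sum>n\<in>{n \<in> int_lattice. n + z \<in> A}. q (n + z))"
          proof (rule sum.mono_neutral_cong_right)
            show "{n \<in> int_lattice. n + z \<in> A} \<subseteq> W"
            proof
              fix n assume n: "n \<in> {n \<in> int_lattice. n + z \<in> A}"
              then have "norm n \<le> B + 1"
                using B[of "n + z"] z1 norm_triangle_ineq4[of "n + z" z] by simp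
              then show "n \<in> W"
                using n by (simp add: W_def)
            qed
            show "finite W"
              by (rule finW)
          qed (auto simp: W_def)
          also have "\<dots> = (\<Sum>(r, x)\<in>(SIGMA r:?R. face_points CARD('n) (?I *v z + r) \<tau>). dilated q \<tau> M x)"
            unfolding A_eq using \<tau>
            by (subst sum.reindex_bij_betw[OF bij_betw_lattice_points[OF int det], symmetric])
              (auto simp: dilated_def intro!: sum.cong)
          also have "\<dots> = (\<Sum>r\<in>?R. \<Sum>x\<in>face_points CARD('n) (?I *v z + r) \<tau>. dilated q \<tau> M x)"
            using finite_face_points[OF \<tau>] finR by (intro sum.Sigma[symmetric]) auto
          finally have points: "(\<Sum>n\<in>W. q (n + z) * indicat_real A (n + z))
              = (\<Sum>r\<in>?R. \<Sum>x\<in>face_points CARD('n) (?I *v z + r) \<tau>. dilated q \<tau> M x)" .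
          have P: "\<bar>det M\<bar> * P V J z = (\<Sum>r\<in>?R. \<Prod>k\<in>UNIV. bern_per (J k) (shear V (?I *v z + r) $ k))" for V J
            unfolding P_def periodized_product_def using det
            by (simp add: bern_nonint[OF shear_nonint[OF gen']])
          \<comment> \<open>The factor \<open>\<bar>det M\<bar>\<close> cancels the normalization of
            \<open>P\<close>, and exchanging the sums leaves one full expansion for each
            coset.\<close>
          have "\<bar>det M\<bar> * (\<Sum>V\<in>dirs. \<Sum>I\<in>flags. \<Sum>J\<in>orders w I. c V I J * P V (\<lambda>k. J k + I k) z)
              = (\<Sum>V\<in>dirs. \<Sum>I\<in>flags. \<Sum>J\<in>orders w I. c V I J * (\<bar>det M\<bar> * P V (\<lambda>k. J k + I k) z))"
            by (simp add: sum_distrib_left mult.left_commute)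
          also have "\<dots> = (\<Sum>V\<in>dirs. \<Sum>I\<in>flags. \<Sum>J\<in>orders w I. \<Sum>r\<in>?R.
              c V I J * (\<Prod>k\<in>UNIV. bern_per (J k + I k) (shear V (?I *v z + r) $ k)))"
            by (simp only: P sum_distrib_left)
          also have "\<dots> = (\<Sum>r\<in>?R. \<Sum>V\<in>dirs. \<Sum>I\<in>flags. \<Sum>J\<in>orders w I.
              c V I J * (\<Prod>k\<in>UNIV. bern_per (J k + I k) (shear V (?I *v z + r) $ k)))"
            unfolding sum.swap[of _ ?R] ..
          also have "\<dots> = (\<Sum>r\<in>?R. expansion (?I *v z + r) \<tau> CARD('n) w (dilated q \<tau> M))"
            using \<tau> by (simp add: expansion_explicit[OF g] c_def)
          finally have exp: "\<bar>det M\<bar> * (\<Sum>V\<in>dirs. \<Sum>I\<in>flags. \<Sum>J\<in>orders w I. c V I J * P V (\<lambda>k. J k + I k) z)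
              = (\<Sum>r\<in>?R. expansion (?I *v z + r) \<tau> CARD('n) w (dilated q \<tau> M))" .
          have "H (\<lambda>n. indicat_real A (n + z)) (\<lambda>V J. P V J z)
              = (\<Sum>r\<in>?R. (\<Sum>x\<in>face_points CARD('n) (?I *v z + r) \<tau>. dilated q \<tau> M x)
                  - expansion (?I *v z + r) \<tau> CARD('n) w (dilated q \<tau> M))
                + (\<Sum>n\<in>W. (q n - q (n + z)) * indicat_real A (n + z))"
            unfolding H_def exp sum_subtractf points[symmetric] by (simp add: left_diff_distrib sum_subtractf)
          also have "\<bar>\<dots>\<bar> \<le> (\<Sum>r\<in>?R. E) + (\<Sum>n\<in>W. \<bar>q n - q (n + z)\<bar>)"
          proof (rule order_trans[OF abs_triangle_ineq add_mono])
            show "\<bar>\<Sum>r\<in>?R. (\<Sum>x\<in>face_points CARD('n) (?I *v z + r) \<tau>. dilated q \<tau> M x)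
                - expansion (?I *v z + r) \<tau> CARD('n) w (dilated q \<tau> M)\<bar> \<le> (\<Sum>r\<in>?R. E)"
              by (rule order_trans[OF sum_abs sum_mono]) (rule E[OF gen'])
            show "\<bar>\<Sum>n\<in>W. (q n - q (n + z)) * indicat_real A (n + z)\<bar> \<le> (\<Sum>n\<in>W. \<bar>q n - q (n + z)\<bar>)"
              by (rule order_trans[OF sum_abs sum_mono]) (auto simp: indicator_def abs_mult)
          qed
          also have "(\<Sum>r\<in>?R. E) \<le> \<bar>det M\<bar> * E"
            using cardR E0 by (simp add: mult_right_mono)
          finally show ?case
            unfolding nz z_def[symmetric] by simp
        qed
        have lim1: "((\<lambda>\<epsilon>. \<bar>H (\<lambda>n. indicat_real A (n - \<epsilon> *\<^sub>R y)) (\<lambda>V J. P V J (?z \<epsilon>))\<bar>)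
            \<longlongrightarrow> \<bar>H (\<lambda>n. \<iota> n y) (\<lambda>V J. \<beta> V J y)\<bar>) (at_right 0)"
          unfolding H_def by (intro tendsto_intros \<iota> \<beta>)
        have lim2: "((\<lambda>\<epsilon>. \<bar>det M\<bar> * E + (\<Sum>n\<in>W. \<bar>q n - q (n - \<epsilon> *\<^sub>R y)\<bar>))
            \<longlongrightarrow> \<bar>det M\<bar> * E + (\<Sum>n\<in>W. \<bar>q n - q (n - 0 *\<^sub>R y)\<bar>)) (at_right 0)"
        proof (intro tendsto_intros)
          fix n
          have "isCont q (n - 0 *\<^sub>R y)"
            using C_class_continuous[OF q] by (simp add: continuous_on_eq_continuous_at)
          then show "((\<lambda>\<epsilon>. q (n - \<epsilon> *\<^sub>R y)) \<longlongrightarrow> q (n - 0 *\<^sub>R y)) (at_right 0)"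
            by (rule isCont_tendsto_compose) (intro tendsto_intros)
        qed
        have "\<bar>H (\<lambda>n. \<iota> n y) (\<lambda>V J. \<beta> V J y)\<bar> \<le> \<bar>det M\<bar> * E + (\<Sum>n\<in>W. \<bar>q n - q (n - 0 *\<^sub>R y)\<bar>)"
          by (rule tendsto_le[OF trivial_limit_at_right_real lim2 lim1 ev])
        then show "\<bar>H (\<lambda>n. \<iota> n y) (\<lambda>V J. \<beta> V J y)\<bar> \<le> \<bar>det M\<bar> * E"
          by simp
      qed
    qed
  qed
  ultimately show ?thesis
    by (rule has_ball_average_le) (simp add: E0)
qed

lemma C_class_dilated:
  fixes q :: "real^'n \<Rightarrow> real"
  assumes "C_class m q"
  shows "C_class m (dilated q \<tau> M)"
proof -
  have "linear (\<lambda>x. \<tau> *\<^sub>R (M *v x))"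
    by (rule linearI) (simp_all add: matrix_vector_linear scaleR_add_right)
  from C_class_affine[OF assms this, of 0] show ?thesis
    by (simp add: dilated_def[abs_def])
qed

text \<open>Finiteness of the set of multi-indices and compactness of the simplex make the two
  suprema genuine upper bounds.\<close>

lemma deriv_bound_SUP:
  fixes g :: "real^'n::{finite,wellorder} \<Rightarrow> real"
  assumes g: "C_class (w + 1) g"
  defines "S \<equiv> {\<alpha> :: 'n \<Rightarrow> nat. int w - int CARD('n) + 2 \<le> int (sum \<alpha> UNIV) \<and> int (sum \<alpha> UNIV) \<le> int w + 1}"
  defines "K \<equiv> (SUP \<alpha>\<in>S. SUP x\<in>std_simplex. \<bar>multi_deriv \<alpha> g x\<bar>)"
  shows "w + 2 \<le> n + CARD('n) \<Longrightarrow> n \<le> Suc w \<Longrightarrow> deriv_bound CARD('n) n K g" and "K \<ge> 0"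
proof -
  have "S \<subseteq> orders (w + 1) (\<lambda>_. 1)"
    unfolding S_def orders_def by (auto simp del: of_nat_sum)
  then have fin: "finite S"
    using finite_orders finite_subset by blast
  have le: "\<bar>fold pd ws g x\<bar> \<le> K" if "count_list ws \<in> S" "length ws \<le> w + 1" "x \<in> std_simplex" for ws x
  proof -
    have C: "C_class (length ws) g"
      using g that(2) by (rule C_class_mono)
    have eq: "fold pd ws g = multi_deriv (count_list ws) g"
      by (rule fold_partial_deriv_eq_multi_deriv[OF C])
    have "C_class 0 (fold pd ws g)"
      by (rule C_class_fold) (use C in simp)
    then have "continuous_on std_simplex (\<lambda>x. \<bar>multi_deriv (count_list ws) g x\<bar>)"
      unfolding eq by (auto intro!: continuous_intros intro: continuous_on_subset)
    then have "bdd_above ((\<lambda>x. \<bar>multi_deriv (count_list ws) g x\<bar>) ` std_simplex)"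
      by (intro compact_imp_bounded[THEN bounded_imp_bdd_above] compact_continuous_image compact_std_simplex)
    then have "\<bar>multi_deriv (count_list ws) g x\<bar> \<le> (SUP x\<in>std_simplex. \<bar>multi_deriv (count_list ws) g x\<bar>)"
      using that by (intro cSUP_upper)
    also have "\<dots> \<le> K"
      unfolding K_def using that fin by (intro cSUP_upper) auto
    finally show ?thesis
      by (simp add: eq)
  qed
  have mem: "count_list ws \<in> S" if "w + 2 \<le> length ws + CARD('n)" "length ws \<le> Suc w" for ws :: "'n list"
    unfolding S_def using that sum_count_list[of ws] by (auto simp del: of_nat_sum)
  show "deriv_bound CARD('n) n K g" if "w + 2 \<le> n + CARD('n)" "n \<le> Suc w"
    unfolding deriv_bound_def face_CARD using that mem le by auto
  \<comment> \<open>One admissible multi-index, \<open>w + 1\<close> derivatives in the first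
    coordinate, evaluated at the origin: the supremum dominates an absolute value.\<close>
  have "\<bar>fold pd (replicate (Suc w) (idx 0)) g 0\<bar> \<le> K"
    by (intro le mem) (auto simp: std_simplex_def Suc_le_eq)
  then show "K \<ge> 0"
    by linarith
qed

text \<open>One term of the exponential series bounds \<open>(s * (w + 2)) ^ d\<close> by
  \<open>fact d * exp s ^ (w + 2)\<close>, and \<open>s\<close> is chosen so that
  \<open>exp s * \<rho> = \<rho>'\<close>. The exponent \<open>w + 2\<close> against
  \<open>w + 1\<close> leaves the factor \<open>exp s\<close> in the constant.\<close>

lemma polynomial_le_exponential:
  fixes \<rho> \<rho>' :: real
  assumes "0 < \<rho>" "\<rho> < \<rho>'"
  shows "\<exists>c\<ge>0. \<forall>w. real (w + 2) ^ d * \<rho> ^ (w + 1) \<le> c * \<rho>' ^ (w + 1)"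
proof -
  define s where "s = ln (\<rho>' / \<rho>)"
  have s: "s > 0" "exp s = \<rho>' / \<rho>"
    using assms by (simp_all add: s_def)
  have "real (w + 2) ^ d * \<rho> ^ (w + 1) \<le> (fact d / s ^ d * exp s) * \<rho>' ^ (w + 1)" for w
  proof -
    have "(s * real (w + 2)) ^ d / fact d \<le> (\<Sum>i\<in>{d}. inverse (fact i) * (s * real (w + 2)) ^ i)"
      by (simp add: field_simps)
    also have "\<dots> \<le> exp (s * real (w + 2))"
      unfolding exp_def real_scaleR_def
      using summable_exp[of "s * real (w + 2)"] s by (intro sum_le_suminf) auto
    also have "\<dots> = exp s ^ (w + 2)"
      by (rule exp_of_nat2_mult)
    finally have "fact d / s ^ d * ((s * real (w + 2)) ^ d / fact d) \<le> fact d / s ^ d * exp s ^ (w + 2)"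
      using s(1) by (intro mult_left_mono) auto
    moreover have "fact d / s ^ d * ((s * real (w + 2)) ^ d / fact d) = real (w + 2) ^ d"
      using s(1) by (simp only: power_mult_distrib) simp
    ultimately have "real (w + 2) ^ d \<le> fact d / s ^ d * exp s ^ (w + 2)"
      by simp
    then have "real (w + 2) ^ d * \<rho> ^ (w + 1) \<le> fact d / s ^ d * exp s ^ (w + 2) * \<rho> ^ (w + 1)"
      using assms by (intro mult_right_mono) auto
    also have "\<dots> = (fact d / s ^ d * exp s) * (exp s * \<rho>) ^ (w + 1)"
      by (simp add: power_mult_distrib)
    also have "exp s * \<rho> = \<rho>'"
      using s assms by simp
    finally show ?thesis .
  qed
  moreover have "0 \<le> fact d / s ^ d * exp s"
    using s(1) by simp
  ultimately show ?thesis
    by blast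
qed

theorem theorem9:
  fixes \<delta> \<tau>\<^sub>0 :: real
  assumes "\<delta> > 0" and "\<tau>\<^sub>0 > 0"
  shows "\<exists>c::real. \<forall>(M :: real^'n::{finite,wellorder}^'n::_) (w :: nat) (q :: real^'n::_ \<Rightarrow> real) (\<tau> :: nat).
    (\<forall>i k. M $ i $ k \<in> \<int>) \<longrightarrow> det M \<noteq> 0 \<longrightarrow> C_class (w + 1) q \<longrightarrow> real \<tau> > \<tau>\<^sub>0 \<longrightarrow>
      \<bar>remainder M q w (real \<tau>)\<bar>
        \<le> c * \<bar>det M\<bar> * real \<tau> powi (int CARD('n) - int w - 1)
            * (2 powi (int CARD('n) - 2) / pi + \<delta>) ^ (w + 1)
            * (SUP \<alpha>\<in>{\<alpha> :: 'n \<Rightarrow> nat. int w - int CARD('n) + 2 \<le> int (sum \<alpha> UNIV)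
                                \<and> int (sum \<alpha> UNIV) \<le> int w + 1}.
                SUP x\<in>std_simplex. \<bar>multi_deriv \<alpha> (dilated q (real \<tau>) M) x\<bar>)"
proof -
  let ?d = "CARD('n)"
  \<comment> \<open>The factor \<open>2 ^ d / 2\<close> of the rate turns the margin
    \<open>\<delta> / 2 ^ d\<close> into \<open>\<delta> / 2\<close>; the other half of
    \<open>\<delta>\<close> is left for the polynomial factor.\<close>
  define r where "r = 1 / (2 * pi) + \<delta> / 2 ^ ?d"
  have r: "r > 1 / (2 * pi)"
    using assms(1) by (simp add: r_def)
  have r0: "r > 0"
    by (rule less_trans[OF _ r]) simp
  obtain C0 where C0: "C0 \<ge> 1" "\<And>j x. \<bar>bern_per j x\<bar> \<le> C0 * r ^ j"
    using bern_per_bound[OF r] by blast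
  \<comment> \<open>\<open>max 1 r\<close> makes one constant serve the indices \<open>j\<close> and
    \<open>j + 1\<close> with the same power \<open>r ^ j\<close>.\<close>
  define C where "C = C0 * max 1 r"
  have "1 * 1 \<le> C"
    unfolding C_def using C0 by (intro mult_mono) auto
  then have C1: "C \<ge> 1"
    by simp
  have B1: "\<bar>bern_per j x\<bar> \<le> C * r ^ j" for j x
  proof -
    have "C0 * 1 * r ^ j \<le> C0 * max 1 r * r ^ j"
      using C0 r0 by (intro mult_right_mono mult_left_mono) auto
    then show ?thesis
      using C0(2)[of j x] by (simp add: C_def)
  qed
  have B2: "\<bar>bern_per (Suc j) x\<bar> \<le> C * r ^ j" for j x
  proof -
    have "C0 * r * r ^ j \<le> C0 * max 1 r * r ^ j"
      using C0 r0 by (intro mult_right_mono mult_left_mono) auto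
    then show ?thesis
      using C0(2)[of "Suc j" x] by (simp add: C_def)
  qed
  define \<rho> where "\<rho> = 2 ^ ?d * r / 2"
  define \<rho>' where "\<rho>' = 2 powi (int ?d - 2) / pi + \<delta>"
  have "2 powi (int ?d - 2) = (2 ^ ?d / 4 :: real)"
    by (simp add: power_int_diff)
  then have "\<rho>' = 2 ^ ?d / 4 / pi + \<delta>"
    by (simp only: \<rho>'_def)
  moreover have "\<rho> = 2 ^ ?d / 4 / pi + \<delta> / 2"
    by (simp add: \<rho>_def r_def distrib_left add_divide_distrib)
  ultimately have "\<rho> < \<rho>'"
    using assms(1) by linarith
  moreover have "0 < \<rho>"
    using r0 by (simp add: \<rho>_def)
  ultimately have \<rho>: "0 < \<rho>" "\<rho> < \<rho>'"
    by blast+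
  obtain c where c: "c \<ge> 0" "\<And>w. real (w + 2) ^ ?d * \<rho> ^ (w + 1) \<le> c * \<rho>' ^ (w + 1)"
    using polynomial_le_exponential[OF \<rho>] by blast
  show ?thesis
  proof (intro exI[of _ "(4 * C) ^ ?d * c"] allI impI)
    fix M :: "real^'n::_^'n::_" and w :: nat and q :: "real^'n::_ \<Rightarrow> real" and \<tau> :: nat
    assume int: "\<forall>i k. M $ i $ k \<in> \<int>" and det: "det M \<noteq> 0" and q: "C_class (w + 1) q" and \<tau>: "real \<tau> > \<tau>\<^sub>0"
    define g where "g = dilated q (real \<tau>) M"
    define K where "K = (SUP \<alpha>\<in>{\<alpha> :: 'n \<Rightarrow> nat. int w - int CARD('n) + 2 \<le> int (sum \<alpha> UNIV)
        \<and> int (sum \<alpha> UNIV) \<le> int w + 1}. SUP x\<in>std_simplex. \<bar>multi_deriv \<alpha> g x\<bar>)"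
    have \<tau>1: "real \<tau> \<ge> 1"
      using \<tau> assms(2) by (cases \<tau>) auto
    have g: "C_class (w + 1) g"
      unfolding g_def by (rule C_class_dilated[OF q])
    note K = deriv_bound_SUP[OF g, folded K_def]
    define E where "E = (4 * C * real (w + 2)) ^ ?d * real \<tau> powi (int ?d - int w - 1) * \<rho> ^ Suc w * K"
    have E: "\<bar>(\<Sum>x\<in>face_points ?d \<xi> \<tau>. g x) - expansion \<xi> \<tau> ?d w g\<bar> \<le> E" if "generic \<xi>" for \<xi> :: "real^'n::_"
      unfolding E_def \<rho>_def
      using expansion_error[OF that \<tau>1 _ C1 r0 B1 B2 order_refl _ K(2) K(1)] g by simp
    have E0: "E \<ge> 0"
      unfolding E_def using C1 \<rho> K(2) by simp
    have "\<bar>remainder M q w \<tau>\<bar> \<le> \<bar>det M\<bar> * E"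
      by (rule remainder_le) (use int det q g E E0 \<tau>1 in \<open>simp_all add: g_def del: C_class.simps\<close>)
    also have "\<dots> = (4 * C) ^ ?d * \<bar>det M\<bar> * real \<tau> powi (int ?d - int w - 1) * (real (w + 2) ^ ?d * \<rho> ^ (w + 1)) * K"
      by (simp add: E_def power_mult_distrib)
    also have "\<dots> \<le> (4 * C) ^ ?d * \<bar>det M\<bar> * real \<tau> powi (int ?d - int w - 1) * (c * \<rho>' ^ (w + 1)) * K"
      using C1 K(2) by (intro mult_right_mono[OF mult_left_mono[OF c(2)]]) auto
    finally show "\<bar>remainder M q w (real \<tau>)\<bar>
        \<le> (4 * C) ^ ?d * c * \<bar>det M\<bar> * real \<tau> powi (int CARD('n) - int w - 1)
            * (2 powi (int CARD('n) - 2) / pi + \<delta>) ^ (w + 1)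
            * (SUP \<alpha>\<in>{\<alpha> :: 'n \<Rightarrow> nat. int w - int CARD('n) + 2 \<le> int (sum \<alpha> UNIV)
                                \<and> int (sum \<alpha> UNIV) \<le> int w + 1}.
                SUP x\<in>std_simplex. \<bar>multi_deriv \<alpha> (dilated q (real \<tau>) M) x\<bar>)"
      unfolding \<rho>'_def[symmetric] g_def[symmetric] K_def[symmetric] by (simp add: mult_ac)
  qed
qed

end
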